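(* Let $\varepsilon,\mu:\Omega\to\mathbb{R}^{3\times 3}$ be matrix fields with bounded measurable entries such that $\varepsilon(x)$ and $\mu(x)$ are symmetric for all $x\in\Omega$, and such that there exist constants $\varepsilon_*>0$ and $\mu_*>0$ with $\varepsilon(x)\xi\cdot\xi\ge\varepsilon_*|\xi|^2$ and $\mu(x)\xi\cdot\xi\ge\mu_*|\xi|^2$ for all $x\in\Omega$ and all $\xi\in\mathbb{R}^3$. Let $j(x,t,\xi)=j_0(x,t)+j_1(x,t,\xi)$ for $(x,t,\xi)\in Q_T\times\mathbb{R}^3$, where $j_0\in L^2(Q_T)^3$ and $j_1:Q_T\times\mathbb{R}^3\to\mathbb{R}^3$ is a Carath\'eodory function such that, for some constant $c_1>0$, $|j_1(x,t,\xi)|\le c_1|\xi|$ for all $(x,t,\xi)\in Q_T\times\mathbb{R}^3$. In addition, suppose that $$\big(j(x,t,\xi)-j(x,t,\eta)\big)\cdot(\xi-\eta)\ge 0\qquad\text{for all }(x,t)\in Q_T\text{ and all }\xi,\eta\in\mathbb{R}^3.$$ Let $(e^{(k)},h^{(k)})\in L^2(Q_T)^3\times L^2(Q_T)^3$ $(k=1,2)$ be weak solutions of the Maxwell problem with data $(\varepsilon,\mu,j,e_0^{(k)},h_0^{(k)})$, where $(e_0^{(k)},h_0^{(k)})\in L^2(\Omega)^3\times L^2(\Omega)^3$ $(k=1,2)$, respectively. Then, for all $t\in[0,T]$, $$\|e^{(1)}(t)-e^{(2)}(t)\|_{H_\varepsilon}^2+\|h^{(1)}(t)-h^{(2)}(t)\|_{H_\mu}^2\le\|e_0^{(1)}-e_0^{(2)}\|_{H_\varepsilon}^2+\|h_0^{(1)}-h_0^{(2)}\|_{H_\mu}^2,$$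 where on the left-hand side $e^{(k)},h^{(k)}$ denote the representatives in $C([0,T];H)$ of the corresponding equivalence classes in $L^2(0,T;H)$.
   Context: Setting and notation. $\Omega\subset\mathbb{R}^3$ is an open set, $0<T<+\infty$, $Q_T=\Omega\times\,]0,T[$. $H:=L^2(\Omega)^3$ with scalar product $(u,v)_H=\int_\Omega u\cdot v\,dx$; weighted scalar products on $H$ are $(u,v)_{H_\varepsilon}=\int_\Omega\varepsilon(x)u(x)\cdot v(x)\,dx$ and $(u,v)_{H_\mu}=\int_\Omega\mu(x)u(x)\cdot v(x)\,dx$, with induced norms $\|\cdot\|_{H_\varepsilon}$, $\|\cdot\|_{H_\mu}$. $V$ is the space of all $u\in L^2(\Omega)^3$ whose distributional curl is represented by a field in $L^2(\Omega)^3$, i.e. there is $F=:\operatorname{curl}u\in L^2(\Omega)^3$ with $\int_\Omega u\cdot\operatorname{curl}\varphi\,dx=\int_\Omega F\cdot\varphi\,dx$ for all $\varphi\in C_c^\infty(\Omega)^3$; it is a Hilbert space with scalar product $(u,v)_V=\int_\Omega(u\cdot v+\operatorname{curl}u\cdot\operatorname{curl}v)\,dx$. $V_0$ is the closed subspace $V_0:=\{u\in V:\int_\Omega(\operatorname{curl}u)\cdot\psi\,dx=\int_\Omega u\cdot\operatorname{curl}\psi\,dx\text{ for all }\psi\in V\}$. $L^2(Q_T)^3$ is identified with the Bochner space $L^2(0,T;H)$ via $u\mapsto(t\mapsto u(\cdot,t))$. Carath\'eodory function: $(x,t)\mapsto j_1(x,t,\xi)$ is measurable in $Q_T$ for all $\xi\in\mathbb{R}^3$,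 and $\xi\mapsto j_1(x,t,\xi)$ is continuous on $\mathbb{R}^3$ for a.e. $(x,t)\in Q_T$. For $u\in L^2(Q_T)^3$, $j(u)$ denotes the field $(x,t)\mapsto j(x,t,u(x,t))$, which lies in $L^2(Q_T)^3$. Weak solution: for $(e_0,h_0)\in H\times H$, $(e,h)\in L^2(Q_T)^3\times L^2(Q_T)^3$ is a weak solution of the Maxwell problem with data $(\varepsilon,\mu,j,e_0,h_0)$ (that is, of $\partial_t(\varepsilon e)=\operatorname{curl}h-j$, $\partial_t(\mu h)=-\operatorname{curl}e$ in $Q_T$, $n\times e=0$ on $\partial\Omega\times\,]0,T[$, $e=e_0$, $h=h_0$ at $t=0$) if $$-\int_{Q_T}(\varepsilon e)\cdot\partial_t\Phi\,dx\,dt+\int_{Q_T}\big(-h\cdot\operatorname{curl}\Phi+j(e)\cdot\Phi\big)\,dx\,dt=\int_\Omega(\varepsilon e_0)(x)\cdot\Phi(x,0)\,dx$$ for all $\Phi\in L^2(0,T;V_0)$ with $\partial_t\Phi\in L^2(Q_T)^3$ and $\Phi(\cdot,T)=0$ a.e. in $\Omega$, and $$-\int_{Q_T}(\mu h)\cdot\partial_t\Psi\,dx\,dt+\int_{Q_T}e\cdot\operatorname{curl}\Psi\,dx\,dt=\int_\Omega(\mu h_0)(x)\cdot\Psi(x,0)\,dx$$ for all $\Psi\in L^2(0,T;V)$ with $\partial_t\Psi\in L^2(Q_T)^3$ and $\Psi(\cdot,T)=0$ a.e. in $\Omega$. (Values of $\Phi,\Psi$ at $t=0,T$ are those of the representatives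 in $C([0,T];H)$.) Under the stated hypotheses, every weak solution $(e,h)$ has (unique) representatives in $C([0,T];H)$ of the classes $e,h\in L^2(0,T;H)$, and these take the values $e_0$, $h_0$ at $t=0$. *)

theory Defs
  imports "HOL-Analysis.Analysis"
begin

text \<open>
  Elements of \<open>L\<^sup>2\<close> are represented by functions, not by equivalence classes; the function
  spaces and the notion of weak solution are insensitive to changes on null sets (of space, and of time, respectively).
\<close>

type_synonym vfield = "real^3 \<Rightarrow> real^3"
type_synonym tfield = "(real^3) \<times> real \<Rightarrow> real^3"

definition L2 :: "'a measure \<Rightarrow> ('a \<Rightarrow> real^3) set" where
  "L2 M = {u \<in> borel_measurable M. integrable M (\<lambda>x. (norm (u x))\<^sup>2)}"

definition Hspace :: "(real^3) set \<Rightarrow> vfield set" where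
  "Hspace \<Omega> = L2 (lebesgue_on \<Omega>)"

definition H_norm :: "(real^3) set \<Rightarrow> vfield \<Rightarrow> real" where
  "H_norm \<Omega> u = sqrt (LINT x|lebesgue_on \<Omega>. u x \<bullet> u x)"

definition weighted_inner :: "(real^3) set \<Rightarrow> (real^3 \<Rightarrow> real^3^3) \<Rightarrow> vfield \<Rightarrow> vfield \<Rightarrow> real" where
  "weighted_inner \<Omega> a u v = (LINT x|lebesgue_on \<Omega>. (a x *v u x) \<bullet> v x)"

definition weighted_norm :: "(real^3) set \<Rightarrow> (real^3 \<Rightarrow> real^3^3) \<Rightarrow> vfield \<Rightarrow> real" where
  "weighted_norm \<Omega> a u = sqrt (weighted_inner \<Omega> a u u)"

definition QT :: "(real^3) set \<Rightarrow> real \<Rightarrow> ((real^3) \<times> real) set" where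
  "QT \<Omega> T = \<Omega> \<times> {0<..<T}"

primrec Ck :: "nat \<Rightarrow> ('a::euclidean_space \<Rightarrow> 'b::real_normed_vector) \<Rightarrow> bool" where
  "Ck 0 f \<longleftrightarrow> continuous_on UNIV f"
| "Ck (Suc k) f \<longleftrightarrow> (\<forall>x. f differentiable (at x)) \<and>
     (\<forall>b\<in>Basis. Ck k (\<lambda>x. frechet_derivative f (at x) b))"

text \<open>\<open>C\<^sub>c\<^sup>\<infinity>(S)\<^sup>3\<close>; its elements are extended by zero to the whole space.\<close>

definition test_fields :: "'a::euclidean_space set \<Rightarrow> ('a \<Rightarrow> real^3) set" where
  "test_fields S = {\<phi>. (\<forall>k. Ck k \<phi>) \<and> compact (closure {x. \<phi> x \<noteq> 0})
     \<and> closure {x. \<phi> x \<noteq> 0} \<subseteq> S}"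

definition pderiv_comp :: "3 \<Rightarrow> 3 \<Rightarrow> vfield \<Rightarrow> real^3 \<Rightarrow> real" where
  "pderiv_comp i k \<phi> x = frechet_derivative \<phi> (at x) (axis i 1) $ k"

definition classical_curl :: "vfield \<Rightarrow> vfield" where
  "classical_curl \<phi> x = vector
     [pderiv_comp 2 3 \<phi> x - pderiv_comp 3 2 \<phi> x,
      pderiv_comp 3 1 \<phi> x - pderiv_comp 1 3 \<phi> x,
      pderiv_comp 1 2 \<phi> x - pderiv_comp 2 1 \<phi> x]"

definition has_curl :: "(real^3) set \<Rightarrow> vfield \<Rightarrow> vfield \<Rightarrow> bool" where
  "has_curl \<Omega> u F \<longleftrightarrow> F \<in> Hspace \<Omega> \<and>
     (\<forall>\<phi>\<in>test_fields \<Omega>. (LINT x|lebesgue_on \<Omega>. u x \<bullet> classical_curl \<phi> x)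
                        = (LINT x|lebesgue_on \<Omega>. F x \<bullet> \<phi> x))"

definition curl :: "(real^3) set \<Rightarrow> vfield \<Rightarrow> vfield" where
  "curl \<Omega> u = (SOME F. has_curl \<Omega> u F)"

definition Vspace :: "(real^3) set \<Rightarrow> vfield set" where
  "Vspace \<Omega> = {u \<in> Hspace \<Omega>. \<exists>F. has_curl \<Omega> u F}"

definition V_norm :: "(real^3) set \<Rightarrow> vfield \<Rightarrow> real" where
  "V_norm \<Omega> u = sqrt (LINT x|lebesgue_on \<Omega>. u x \<bullet> u x + curl \<Omega> u x \<bullet> curl \<Omega> u x)"

definition V0space :: "(real^3) set \<Rightarrow> vfield set" where
  "V0space \<Omega> = {u \<in> Vspace \<Omega>. \<forall>\<psi>\<in>Vspace \<Omega>.
     (LINT x|lebesgue_on \<Omega>. curl \<Omega> u x \<bullet> \<psi> x) = (LINT x|lebesgue_on \<Omega>. u x \<bullet> curl \<Omega> \<psi> x)}"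

text \<open>
  The Bochner space \<open>L\<^sup>2(0,T;X)\<close>, for a space \<open>X\<close> of fields with norm \<open>N\<close>: strong
  measurability (a.e. limit of \<open>X\<close>-valued simple functions) and square integrability of the norm.
\<close>

definition bochner_L2 :: "real \<Rightarrow> vfield set \<Rightarrow> (vfield \<Rightarrow> real) \<Rightarrow> (real \<Rightarrow> vfield) set" where
  "bochner_L2 T X N = {U.
     (AE t in lebesgue_on {0<..<T}. U t \<in> X) \<and>
     (\<exists>s :: nat \<Rightarrow> real \<Rightarrow> vfield.
        (\<forall>n. s n ` {0<..<T} \<subseteq> X \<and> finite (s n ` {0<..<T}) \<and>
             (\<forall>v. {t\<in>{0<..<T}. s n t = v} \<in> sets lebesgue)) \<and>
        (AE t in lebesgue_on {0<..<T}. (\<lambda>n. N (\<lambda>x. s n t x - U t x)) \<longlonglongrightarrow> 0)) \<and>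
     integrable (lebesgue_on {0<..<T}) (\<lambda>t. (N (U t))\<^sup>2)}"

text \<open>\<open>G\<close> is a jointly measurable version of the spatial curl of \<open>\<Phi>\<close>. (Applying \<open>curl\<close>
  separately for every \<open>t\<close> would pick representatives without joint measurability.)\<close>

definition has_space_curl :: "(real^3) set \<Rightarrow> real \<Rightarrow> tfield \<Rightarrow> tfield \<Rightarrow> bool" where
  "has_space_curl \<Omega> T \<Phi> G \<longleftrightarrow> G \<in> L2 (lebesgue_on (QT \<Omega> T)) \<and>
     (AE t in lebesgue_on {0<..<T}. has_curl \<Omega> (\<lambda>x. \<Phi> (x, t)) (\<lambda>x. G (x, t)))"

definition has_time_deriv :: "(real^3) set \<Rightarrow> real \<Rightarrow> tfield \<Rightarrow> tfield \<Rightarrow> bool" where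
  "has_time_deriv \<Omega> T \<Phi> D \<longleftrightarrow> D \<in> L2 (lebesgue_on (QT \<Omega> T)) \<and>
     (\<forall>\<phi>\<in>test_fields (QT \<Omega> T).
        (LINT z|lebesgue_on (QT \<Omega> T). \<Phi> z \<bullet> frechet_derivative \<phi> (at z) (0, 1))
        = - (LINT z|lebesgue_on (QT \<Omega> T). D z \<bullet> \<phi> z))"

text \<open>\<open>U\<close> is the representative in \<open>C([0,T];H)\<close> of the class of \<open>u\<close>.\<close>

definition cont_rep :: "(real^3) set \<Rightarrow> real \<Rightarrow> tfield \<Rightarrow> (real \<Rightarrow> vfield) \<Rightarrow> bool" where
  "cont_rep \<Omega> T u U \<longleftrightarrow>
     (\<forall>t\<in>{0..T}. U t \<in> Hspace \<Omega>) \<and>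
     (\<forall>t\<in>{0..T}. ((\<lambda>s. H_norm \<Omega> (\<lambda>x. U s x - U t x)) \<longlongrightarrow> 0) (at t within {0..T})) \<and>
     (AE t in lebesgue_on {0<..<T}. AE x in lebesgue_on \<Omega>. u (x, t) = U t x)"

text \<open>\<open>\<Phi> \<in> L\<^sup>2(0,T;X)\<close> with \<open>\<partial>\<^sub>t\<Phi> \<in> L\<^sup>2(Q\<^sub>T)\<^sup>3\<close> and \<open>\<Phi>(\<cdot>,T) = 0\<close>, where \<open>X\<close> is \<open>V\<close> or
  \<open>V\<^sub>0\<close>; \<open>G\<close>, \<open>D\<close>, \<open>P\<close> are its curl, its time derivative and its continuous representative.
  For such a \<open>\<Phi>\<close> they exist and are unique up to null sets, so quantifying universally over
  \<open>\<Phi>, G, D, P\<close> below amounts to quantifying over \<open>\<Phi>\<close>.\<close>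

definition admissible ::
  "(real^3) set \<Rightarrow> real \<Rightarrow> vfield set \<Rightarrow> tfield \<Rightarrow> tfield \<Rightarrow> tfield \<Rightarrow> (real \<Rightarrow> vfield) \<Rightarrow> bool" where
  "admissible \<Omega> T X \<Phi> G D P \<longleftrightarrow>
     \<Phi> \<in> L2 (lebesgue_on (QT \<Omega> T)) \<and>
     (\<lambda>t x. \<Phi> (x, t)) \<in> bochner_L2 T X (V_norm \<Omega>) \<and>
     has_space_curl \<Omega> T \<Phi> G \<and>
     has_time_deriv \<Omega> T \<Phi> D \<and>
     cont_rep \<Omega> T \<Phi> P \<and>
     (AE x in lebesgue_on \<Omega>. P T x = 0)"

definition weak_solution ::
  "(real^3) set \<Rightarrow> real \<Rightarrow> (real^3 \<Rightarrow> real^3^3) \<Rightarrow> (real^3 \<Rightarrow> real^3^3)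
   \<Rightarrow> ((real^3) \<times> real \<Rightarrow> real^3 \<Rightarrow> real^3) \<Rightarrow> vfield \<Rightarrow> vfield \<Rightarrow> tfield \<Rightarrow> tfield \<Rightarrow> bool" where
  "weak_solution \<Omega> T \<epsilon> \<mu> j e0 h0 e h \<longleftrightarrow>
     e \<in> L2 (lebesgue_on (QT \<Omega> T)) \<and> h \<in> L2 (lebesgue_on (QT \<Omega> T)) \<and>
     (\<forall>\<Phi> G D P. admissible \<Omega> T (V0space \<Omega>) \<Phi> G D P \<longrightarrow>
        - (LINT z|lebesgue_on (QT \<Omega> T). (\<epsilon> (fst z) *v e z) \<bullet> D z)
        + (LINT z|lebesgue_on (QT \<Omega> T). - (h z \<bullet> G z) + j z (e z) \<bullet> \<Phi> z)
        = (LINT x|lebesgue_on \<Omega>. (\<epsilon> x *v e0 x) \<bullet> P 0 x)) \<and>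
     (\<forall>\<Psi> G D P. admissible \<Omega> T (Vspace \<Omega>) \<Psi> G D P \<longrightarrow>
        - (LINT z|lebesgue_on (QT \<Omega> T). (\<mu> (fst z) *v h z) \<bullet> D z)
        + (LINT z|lebesgue_on (QT \<Omega> T). e z \<bullet> G z)
        = (LINT x|lebesgue_on \<Omega>. (\<mu> x *v h0 x) \<bullet> P 0 x))"

definition bdd_meas_matrix_field :: "(real^3) set \<Rightarrow> (real^3 \<Rightarrow> real^3^3) \<Rightarrow> bool" where
  "bdd_meas_matrix_field \<Omega> a \<longleftrightarrow>
     (\<forall>i k. (\<lambda>x. a x $ i $ k) \<in> borel_measurable (lebesgue_on \<Omega>) \<and>
            (\<exists>C. \<forall>x\<in>\<Omega>. \<bar>a x $ i $ k\<bar> \<le> C))"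

definition caratheodory ::
  "(real^3) set \<Rightarrow> real \<Rightarrow> ((real^3) \<times> real \<Rightarrow> real^3 \<Rightarrow> real^3) \<Rightarrow> bool" where
  "caratheodory \<Omega> T g \<longleftrightarrow>
     (\<forall>\<xi>. (\<lambda>z. g z \<xi>) \<in> borel_measurable (lebesgue_on (QT \<Omega> T))) \<and>
     (AE z in lebesgue_on (QT \<Omega> T). continuous_on UNIV (g z))"

end

theory Submission
  imports Defs
begin

text \<open>
  The differences \<open>e = e\<^sub>1 - e\<^sub>2\<close> and \<open>h = h\<^sub>1 - h\<^sub>2\<close> solve the linear problem
  \<open>\<partial>\<^sub>t(\<epsilon>e) = curl h - q\<close>, \<open>\<partial>\<^sub>t(\<mu>h) = - curl e\<close> with \<open>q = j(e\<^sub>1) - j(e\<^sub>2)\<close>, and monotonicity of \<open>j\<close> says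
  \<open>q \<bullet> e \<ge> 0\<close>. Formally, multiplying by \<open>e\<close> and \<open>h\<close> shows that the energy
  \<open>(\<epsilon>e, e) + (\<mu>h, h)\<close> does not increase. A weak solution need not have a time derivative
  in \<open>L\<^sup>2\<close> nor a curl at a single time, so this computation has to be made on time integrals.

  Let \<open>A\<close>, \<open>B\<close>, \<open>Q\<close> be the integrals of \<open>e\<close>, \<open>h\<close>, \<open>q\<close> over a time interval \<open>[a, b]\<close>. Test fields of
  the form \<open>\<theta>(t) \<phi>(x)\<close> and the lemma of du Bois-Reymond (\<open>weak_evolution\<close>) turn the weak formulation
  into identities at fixed times:
  \<open>(\<epsilon>(e(b) - e(a)) + Q, \<phi>) = (B, curl \<phi>)\<close> for \<open>\<phi>\<close> in \<open>V\<^sub>0\<close>, and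
  \<open>(\<mu>(h(b) - h(a)), \<psi>) = - (A, curl \<psi>)\<close> for \<open>\<psi>\<close> in \<open>V\<close>.
  The second one says exactly that \<open>A\<close> belongs to \<open>V\<^sub>0\<close> with \<open>curl A = - \<mu>(h(b) - h(a))\<close>. Hence \<open>A\<close> is a
  legitimate choice of \<open>\<phi>\<close> in the first one, and the curls cancel:
  \<open>(\<epsilon>(e(b) - e(a)), A) + (\<mu>(h(b) - h(a)), B) = - (Q, A)\<close> (\<open>energy_identity\<close>).

  With the two-time energy \<open>g(r, s) = (\<epsilon>e(r), e(s)) + (\<mu>h(r), h(s))\<close>, a continuous symmetric function,
  the left-hand side is the integral of \<open>g(b, s) - g(a, s)\<close> over \<open>s \<in> [a, b]\<close>. On the right,
  \<open>(Q, A)\<close> is a double integral of \<open>(q(s), e(r))\<close> over \<open>[a, b]\<^sup>2\<close>; since \<open>(q(s), e(s)) \<ge> 0\<close>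
  it is bounded below in terms of the modulus of continuity of \<open>e\<close>, with a bound of smaller order than
  \<open>b - a\<close> times the integral of the norm of \<open>q\<close> (\<open>dissipation_lower_bound\<close>). Taking \<open>b = a + l\<close>,
  integrating in \<open>a\<close>, and letting \<open>l\<close> tend to 0 yields that \<open>g(t, t)\<close> never exceeds \<open>g(0, 0)\<close>
  (\<open>diagonal_decreasing\<close>). No derivative of \<open>e\<close> or \<open>h\<close> is ever formed.

  That weak curls are unique almost everywhere, and that the continuous representatives take the
  initial values, both follow from the fundamental lemma of the calculus of variations
  (\<open>fundamental_lemma\<close>), for which smooth bump functions are constructed.
\<close>

section \<open>Square-integrable vector fields\<close>

lemma L2_measurable: "u \<in> L2 M \<Longrightarrow> u \<in> borel_measurable M"
  by (simp add: L2_def)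

lemma L2_inner_integrable:
  assumes "u \<in> L2 M" "v \<in> L2 M"
  shows "integrable M (\<lambda>x. u x \<bullet> v x)"
proof (rule Bochner_Integration.integrable_bound)
  show "integrable M (\<lambda>x. (norm (u x))\<^sup>2 + (norm (v x))\<^sup>2)"
    using assms by (auto simp: L2_def)
  show "(\<lambda>x. u x \<bullet> v x) \<in> borel_measurable M"
    using assms by (auto simp: L2_def)
  show "AE x in M. norm (u x \<bullet> v x) \<le> norm ((norm (u x))\<^sup>2 + (norm (v x))\<^sup>2)"
  proof (rule AE_I2)
    fix x
    have "\<bar>u x \<bullet> v x\<bar> \<le> norm (u x) * norm (v x)" by (rule Cauchy_Schwarz_ineq2)
    also have "\<dots> \<le> (norm (u x))\<^sup>2 + (norm (v x))\<^sup>2"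
      using sum_squares_bound[of "norm (u x)" "norm (v x)"]
        mult_nonneg_nonneg[OF norm_ge_zero[of "u x"] norm_ge_zero[of "v x"]] by linarith
    finally show "norm (u x \<bullet> v x) \<le> norm ((norm (u x))\<^sup>2 + (norm (v x))\<^sup>2)" by simp
  qed
qed

text \<open>
  Products with bounded functions and with bounded matrix fields stay in \<open>L2\<close> by this domination principle.
\<close>

lemma L2_bound:
  assumes "u \<in> L2 M" "v \<in> borel_measurable M" "AE x in M. norm (v x) \<le> K * norm (u x)"
  shows "v \<in> L2 M"
proof -
  have "integrable M (\<lambda>x. (norm (v x))\<^sup>2)"
  proof (rule Bochner_Integration.integrable_bound)
    show "integrable M (\<lambda>x. K\<^sup>2 * (norm (u x))\<^sup>2)"
      using assms by (auto simp: L2_def)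
    show "(\<lambda>x. (norm (v x))\<^sup>2) \<in> borel_measurable M"
      using assms by auto
    show "AE x in M. norm ((norm (v x))\<^sup>2) \<le> norm (K\<^sup>2 * (norm (u x))\<^sup>2)"
      using assms(3)
    proof eventually_elim
      case (elim x)
      then show ?case using power_mono[OF elim, of 2] by (simp add: power_mult_distrib)
    qed
  qed
  then show ?thesis using assms by (auto simp: L2_def)
qed

lemma L2_zero [simp]: "(\<lambda>x. 0) \<in> L2 M"
  by (simp add: L2_def)

lemma L2_scaleR: "u \<in> L2 M \<Longrightarrow> (\<lambda>x. c *\<^sub>R u x) \<in> L2 M"
  by (rule L2_bound[where u=u and K="\<bar>c\<bar>"]) (auto simp: L2_def)

lemma L2_add:
  assumes "u \<in> L2 M" "v \<in> L2 M" shows "(\<lambda>x. u x + v x) \<in> L2 M"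
proof -
  have "integrable M (\<lambda>x. u x \<bullet> u x + 2 * (u x \<bullet> v x) + v x \<bullet> v x)"
    using L2_inner_integrable[OF assms(1) assms(1)] L2_inner_integrable[OF assms(1) assms(2)]
      L2_inner_integrable[OF assms(2) assms(2)] by auto
  then have "integrable M (\<lambda>x. (norm (u x + v x))\<^sup>2)"
    by (simp add: power2_norm_eq_inner inner_add inner_commute algebra_simps)
  then show ?thesis using assms by (auto simp: L2_def)
qed

lemma L2_minus: "u \<in> L2 M \<Longrightarrow> (\<lambda>x. - u x) \<in> L2 M"
  using L2_scaleR[of u M "-1"] by simp

lemma L2_diff:
  assumes "u \<in> L2 M" "v \<in> L2 M" shows "(\<lambda>x. u x - v x) \<in> L2 M"
  using L2_add[OF assms(1) L2_minus[OF assms(2)]] by simp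

lemma L2_cong_AE:
  assumes "u \<in> L2 M" "v \<in> borel_measurable M" "AE x in M. u x = v x" shows "v \<in> L2 M"
  by (rule L2_bound[OF assms(1,2), of 1]) (use assms(3) in auto)

definition L2_norm :: "'a measure \<Rightarrow> ('a \<Rightarrow> real^3) \<Rightarrow> real" where
  "L2_norm M u = sqrt (LINT x|M. u x \<bullet> u x)"

lemma L2_norm_nonneg [simp]: "0 \<le> L2_norm M u"
  by (simp add: L2_norm_def)

lemma L2_norm_power2: "(L2_norm M u)\<^sup>2 = (LINT x|M. u x \<bullet> u x)"
  by (simp add: L2_norm_def)

lemma L2_Cauchy_Schwarz:
  assumes u: "u \<in> L2 M" and v: "v \<in> L2 M"
  shows "\<bar>LINT x|M. u x \<bullet> v x\<bar> \<le> L2_norm M u * L2_norm M v"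
proof -
  define a where "a = (LINT x|M. u x \<bullet> u x)"
  define b where "b = (LINT x|M. v x \<bullet> v x)"
  define c where "c = (LINT x|M. u x \<bullet> v x)"
  have q: "0 \<le> t\<^sup>2 * a + 2 * t * c + b" for t
  proof -
    have "0 \<le> (LINT x|M. (t *\<^sub>R u x + v x) \<bullet> (t *\<^sub>R u x + v x))"
      by (rule integral_nonneg_AE) auto
    also have "\<dots> = (LINT x|M. t\<^sup>2 * (u x \<bullet> u x) + (2 * t) * (u x \<bullet> v x) + v x \<bullet> v x)"
      by (rule Bochner_Integration.integral_cong)
        (auto simp: inner_add inner_commute algebra_simps power2_eq_square)
    also have "\<dots> = t\<^sup>2 * a + 2 * t * c + b"
      using L2_inner_integrable[OF u u] L2_inner_integrable[OF u v] L2_inner_integrable[OF v v]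
      by (simp add: a_def b_def c_def)
    finally show ?thesis .
  qed
  have a0: "0 \<le> a" and b0: "0 \<le> b"
    unfolding a_def b_def by (auto intro: integral_nonneg_AE)
  \<comment> \<open>The quadratic \<open>q\<close> in \<open>t\<close> is nonnegative; it is evaluated at its minimum, or, if it degenerates to a linear function, far out.\<close>
  have "c\<^sup>2 \<le> a * b"
  proof (cases "a = 0")
    case True
    have "c = 0"
    proof (rule ccontr)
      assume "c \<noteq> 0"
      then show False using q[of "-(b+1)/(2*c)"] True by (simp add: field_simps)
    qed
    then show ?thesis using True by simp
  next
    case False
    then have "a > 0" using a0 by simp
    then show ?thesis using q[of "-c/a"] by (simp add: field_simps power2_eq_square)
  qed
  then have "sqrt (c\<^sup>2) \<le> sqrt (a * b)" by (rule real_sqrt_le_mono)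
  then show ?thesis by (simp add: a_def b_def c_def L2_norm_def real_sqrt_mult)
qed

lemma L2_norm_triangle:
  assumes u: "u \<in> L2 M" and v: "v \<in> L2 M"
  shows "L2_norm M (\<lambda>x. u x + v x) \<le> L2_norm M u + L2_norm M v"
proof -
  have "(L2_norm M (\<lambda>x. u x + v x))\<^sup>2 = (LINT x|M. u x \<bullet> u x + 2 * (u x \<bullet> v x) + v x \<bullet> v x)"
    unfolding L2_norm_power2
    by (rule Bochner_Integration.integral_cong) (auto simp: inner_add inner_commute algebra_simps)
  also have "\<dots> = (L2_norm M u)\<^sup>2 + 2 * (LINT x|M. u x \<bullet> v x) + (L2_norm M v)\<^sup>2"
    using L2_inner_integrable[OF u u] L2_inner_integrable[OF u v] L2_inner_integrable[OF v v]
    by (simp add: L2_norm_power2)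
  also have "\<dots> \<le> (L2_norm M u + L2_norm M v)\<^sup>2"
    using L2_Cauchy_Schwarz[OF u v] by (simp add: power2_sum)
  finally show ?thesis by (rule power2_le_imp_le) simp
qed

lemma L2_norm_minus_commute: "L2_norm M (\<lambda>x. u x - v x) = L2_norm M (\<lambda>x. v x - u x)"
  unfolding L2_norm_def by (rule arg_cong[where f=sqrt], rule Bochner_Integration.integral_cong)
    (auto simp: inner_diff inner_commute)

lemma L2_norm_scaleR: "L2_norm M (\<lambda>x. c *\<^sub>R u x) = \<bar>c\<bar> * L2_norm M u"
proof -
  have "(LINT x|M. (c *\<^sub>R u x) \<bullet> (c *\<^sub>R u x)) = c\<^sup>2 * (LINT x|M. u x \<bullet> u x)"
    by (simp add: power2_eq_square mult.assoc)
  then show ?thesis by (simp add: L2_norm_def real_sqrt_mult)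
qed

lemma L2_matrix_mult:
  assumes meas: "\<And>i k. (\<lambda>x. a x $ i $ k) \<in> borel_measurable M"
    and bnd: "AE x in M. \<forall>\<xi>. norm (a x *v \<xi>) \<le> K * norm \<xi>" and u: "u \<in> L2 M"
  shows "(\<lambda>x. (a x :: real^3^3) *v u x) \<in> L2 M"
proof (rule L2_bound[OF u, of _ K])
  have um: "(\<lambda>x. u x $ k) \<in> borel_measurable M" for k
  proof -
    have "(\<lambda>x. u x \<bullet> axis k 1) \<in> borel_measurable M"
      using L2_measurable[OF u] by simp
    then show ?thesis by (simp add: inner_axis)
  qed
  show "(\<lambda>x. a x *v u x) \<in> borel_measurable M"
  proof (subst borel_measurable_euclidean_space, safe)
    fix b :: "real^3" assume "b \<in> Basis"
    then obtain i where b: "b = axis i 1" by (auto simp: Basis_vec_def)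
    have "(\<lambda>x. \<Sum>k\<in>UNIV. a x $ i $ k * u x $ k) \<in> borel_measurable M"
      using meas um by measurable
    then show "(\<lambda>x. (a x *v u x) \<bullet> b) \<in> borel_measurable M"
      by (simp add: b inner_axis matrix_vector_mult_def)
  qed
qed (use bnd in auto)

lemma bdd_meas_matrix_field_bound:
  assumes "bdd_meas_matrix_field \<Omega> a"
  obtains K where "\<And>x \<xi>. x \<in> \<Omega> \<Longrightarrow> norm (a x *v \<xi>) \<le> K * norm \<xi>"
proof -
  have "\<forall>i k. \<exists>C. \<forall>x\<in>\<Omega>. \<bar>a x $ i $ k\<bar> \<le> C" using assms by (simp add: bdd_meas_matrix_field_def)
  then obtain C where C: "\<And>i k x. x \<in> \<Omega> \<Longrightarrow> \<bar>a x $ i $ k\<bar> \<le> C i k" by metis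
  define B where "B = (\<Sum>i\<in>UNIV. \<Sum>k\<in>UNIV. \<bar>C i k\<bar>)"
  have CB: "C i k \<le> B" for i k
  proof -
    have "C i k \<le> (\<Sum>k\<in>UNIV. \<bar>C i k\<bar>)"
      by (rule order_trans[OF abs_ge_self member_le_sum[of k UNIV "\<lambda>k. \<bar>C i k\<bar>"]]) auto
    also have "\<dots> \<le> B" unfolding B_def
      by (rule member_le_sum[of i UNIV "\<lambda>i. \<Sum>k\<in>UNIV. \<bar>C i k\<bar>"]) (auto intro: sum_nonneg)
    finally show ?thesis .
  qed
  show ?thesis
  proof (rule that)
    fix x \<xi> assume x: "x \<in> \<Omega>"
    have "onorm ((*v) (a x)) \<le> real CARD(3) * real CARD(3) * B"
      by (rule onorm_le_matrix_component) (use C[OF x] CB in \<open>meson order_trans\<close>)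
    then show "norm (a x *v \<xi>) \<le> (real CARD(3) * real CARD(3) * B) * norm \<xi>"
      using onorm[OF matrix_vector_mul_bounded_linear[of "a x"], of \<xi>]
      by (meson mult_right_mono norm_ge_zero order_trans)
  qed
qed

section \<open>Lebesgue measure on product sets\<close>

text \<open>
  The product of two Lebesgue sigma-algebras is strictly smaller than the Lebesgue sigma-algebra of the
  product, so Fubini's theorem for product measures does not apply to \<open>lebesgue_on (A \<times> B)\<close> directly. Passing to a Borel
  representative moves everything to \<open>lborel\<close>, where \<open>lborel_prod\<close> identifies the product measure.
\<close>

lemma ex_borel_representative:
  fixes f :: "'a::euclidean_space \<Rightarrow> 'b::euclidean_space"
  assumes "f \<in> borel_measurable lebesgue"
  obtains g where "g \<in> borel_measurable borel" "AE x in lborel. f x = g x"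
proof -
  have "\<exists>g\<in>borel_measurable lborel. AE x in lborel. f x \<bullet> b = g x" for b
    by (rule completion_ex_borel_measurable_real) (use assms in simp)
  then obtain G where G: "\<And>b. G b \<in> borel_measurable lborel" "\<And>b. AE x in lborel. f x \<bullet> b = G b x"
    by metis
  have "AE x in lborel. \<forall>b\<in>Basis. f x \<bullet> b = G b x"
    using G(2) by (simp add: AE_finite_all)
  then have "AE x in lborel. f x = (\<Sum>b\<in>Basis. G b x *\<^sub>R b)"
  proof eventually_elim
    case (elim x)
    then have "(\<Sum>b\<in>Basis. G b x *\<^sub>R b) = (\<Sum>b\<in>Basis. (f x \<bullet> b) *\<^sub>R b)" by (intro sum.cong) auto
    then show ?case by (simp add: euclidean_representation)
  qed
  moreover have "(\<lambda>x. \<Sum>b\<in>Basis. G b x *\<^sub>R b) \<in> borel_measurable borel"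
    using G(1) by (auto simp: measurable_lborel1)
  ultimately show ?thesis using that by blast
qed

lemma AE_lebesgue_on_iff:
  assumes "S \<in> sets lebesgue"
  shows "(AE x in lebesgue_on S. P x) \<longleftrightarrow> (AE x in lborel. x \<in> S \<longrightarrow> P x)"
  using assms by (simp add: AE_restrict_space_iff AE_completion_iff)

text \<open>
  Completeness of Lebesgue measure, in the form that is used for functions defined only on a subset.
\<close>

lemma borel_measurable_lebesgue_on_AE:
  fixes f g :: "'a::euclidean_space \<Rightarrow> 'b::euclidean_space"
  assumes S: "S \<in> sets lebesgue" and f: "f \<in> borel_measurable (lebesgue_on S)"
    and ae: "AE x in lebesgue_on S. f x = g x"
  shows "g \<in> borel_measurable (lebesgue_on S)"
proof -
  have m: "(\<lambda>x. if x \<in> S then f x else 0) \<in> borel_measurable lebesgue"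
    by (rule borel_measurable_if[OF S, THEN iffD2, OF f])
  have "AE x in lebesgue. (if x \<in> S then f x else 0) = (if x \<in> S then g x else 0)"
    using ae unfolding AE_lebesgue_on_iff[OF S] AE_completion_iff by eventually_elim auto
  from borel_measurable_AE[OF m this] show ?thesis
    by (rule borel_measurable_if[OF S, THEN iffD1])
qed

text \<open>
  A null set of the product is covered by a Borel null set; only for the latter may the two
  quantifiers be exchanged.
\<close>

lemma AE_lebesgue_on_Times:
  fixes A :: "'a::euclidean_space set" and B :: "'b::euclidean_space set"
  assumes A: "A \<in> sets borel" and B: "B \<in> sets borel"
    and P: "AE z in lebesgue_on (A \<times> B). P z"
  shows "AE y in lebesgue_on B. AE x in lebesgue_on A. P (x, y)"
    and "AE x in lebesgue_on A. AE y in lebesgue_on B. P (x, y)"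
proof -
  have AB: "A \<times> B \<in> sets lebesgue"
    using A B by (simp add: borel_Times)
  have Al: "A \<in> sets lebesgue" and Bl: "B \<in> sets lebesgue" using A B by auto
  have "AE z in lborel. z \<in> A \<times> B \<longrightarrow> P z"
    using P AB by (simp only: AE_lebesgue_on_iff)
  then obtain N where N: "N \<in> sets lborel" "emeasure lborel N = 0"
      "{z. \<not> (z \<in> A \<times> B \<longrightarrow> P z)} \<subseteq> N"
    by (auto elim!: AE_E)
  have Ns: "N \<in> sets (lborel \<Otimes>\<^sub>M lborel)" using N(1) unfolding lborel_prod .
  have "AE z in lborel \<Otimes>\<^sub>M lborel. z \<notin> N"
    unfolding lborel_prod by (rule AE_not_in) (use N in auto)
  then have xy: "AE x in lborel. AE y in lborel. (x, y) \<notin> N"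
    by (rule lborel_pair.AE_pair)
  moreover have "{z\<in>space (lborel \<Otimes>\<^sub>M lborel). (fst z, snd z) \<notin> N} \<in> sets (lborel \<Otimes>\<^sub>M lborel)"
    using sets.compl_sets[OF Ns] by (simp add: set_diff_eq)
  ultimately have yx: "AE y in lborel. AE x in lborel. (x, y) \<notin> N"
    using lborel_pair.AE_commute[of "\<lambda>x y. (x, y) \<notin> N"] by simp
  have *: "(x, y) \<notin> N \<Longrightarrow> x \<in> A \<Longrightarrow> y \<in> B \<Longrightarrow> P (x, y)" for x y
    using N(3) by auto
  show "AE x in lebesgue_on A. AE y in lebesgue_on B. P (x, y)"
    unfolding AE_lebesgue_on_iff[OF Al] AE_lebesgue_on_iff[OF Bl] using xy
    by eventually_elim (auto elim: eventually_mono intro: *)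
  show "AE y in lebesgue_on B. AE x in lebesgue_on A. P (x, y)"
    unfolding AE_lebesgue_on_iff[OF Al] AE_lebesgue_on_iff[OF Bl] using yx
    by eventually_elim (auto elim: eventually_mono intro: *)
qed

lemma AE_lebesgue_on_Times_fst:
  fixes A :: "'a::euclidean_space set" and B :: "'b::euclidean_space set"
  assumes A: "A \<in> sets borel" and B: "B \<in> sets borel"
    and P: "AE x in lebesgue_on A. P x"
  shows "AE z in lebesgue_on (A \<times> B). P (fst z)"
proof -
  have AB: "A \<times> B \<in> sets lebesgue"
    using A B by (simp add: borel_Times)
  have Al: "A \<in> sets lebesgue" using A by auto
  have "AE x in lborel. x \<in> A \<longrightarrow> P x"
    using P Al by (simp only: AE_lebesgue_on_iff)
  then obtain N where N: "N \<in> sets lborel" "emeasure lborel N = 0" "{x. \<not> (x \<in> A \<longrightarrow> P x)} \<subseteq> N"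
    by (auto elim!: AE_E)
  have "emeasure (lborel \<Otimes>\<^sub>M lborel) (N \<times> (UNIV :: 'b set)) = emeasure lborel N * emeasure lborel (UNIV :: 'b set)"
    by (rule lborel.emeasure_pair_measure_Times) (use N in auto)
  then have "N \<times> (UNIV :: 'b set) \<in> null_sets lborel"
    using N by (auto simp: lborel_prod null_sets_def borel_Times)
  then have "AE z in lborel. z \<notin> N \<times> (UNIV :: 'b set)" by (rule AE_not_in)
  then show ?thesis
    unfolding AE_lebesgue_on_iff[OF AB] by eventually_elim (use N(3) in auto)
qed

lemma integrable_lebesgue_on_iff:
  fixes f :: "'a::euclidean_space \<Rightarrow> real"
  assumes "S \<in> sets lebesgue"
  shows "integrable (lebesgue_on S) f \<longleftrightarrow> integrable lebesgue (\<lambda>x. if x \<in> S then f x else 0)"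
proof -
  have "(\<lambda>x. indicator S x *\<^sub>R f x) = (\<lambda>x. if x \<in> S then f x else 0)" by auto
  then show ?thesis using assms by (simp add: integrable_restrict_space)
qed

lemma integrable_lebesgue_on_subset:
  fixes f :: "'a::euclidean_space \<Rightarrow> real"
  assumes f: "integrable (lebesgue_on S) f" and sub: "A \<subseteq> S" and S: "S \<in> sets lebesgue" and A: "A \<in> sets lebesgue"
  shows "integrable (lebesgue_on A) f"
proof -
  have "integrable lebesgue (\<lambda>x. indicat_real A x *\<^sub>R (if x \<in> S then f x else 0))"
    using f A by (intro integrable_mult_indicator) (simp_all add: integrable_lebesgue_on_iff[OF S])
  moreover have "(\<lambda>x. indicat_real A x *\<^sub>R (if x \<in> S then f x else 0)) = (\<lambda>x. if x \<in> A then f x else 0)"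
    using sub by (auto simp: indicator_def fun_eq_iff)
  ultimately show ?thesis by (simp add: integrable_lebesgue_on_iff[OF A])
qed

lemma integral_lebesgue_on_eq:
  fixes f :: "'a::euclidean_space \<Rightarrow> real"
  assumes "S \<in> sets lebesgue"
  shows "integral\<^sup>L (lebesgue_on S) f = integral\<^sup>L lebesgue (\<lambda>x. if x \<in> S then f x else 0)"
proof -
  have "(\<lambda>x. indicator S x *\<^sub>R f x) = (\<lambda>x. if x \<in> S then f x else 0)" by auto
  then show ?thesis using assms by (simp add: integral_restrict_space)
qed

lemma borel_integrable_cong_lebesgue:
  fixes f g :: "'a::euclidean_space \<Rightarrow> real"
  assumes g: "g \<in> borel_measurable borel" and ae: "AE x in lborel. f x = g x"
  shows "integrable lebesgue f \<longleftrightarrow> integrable lborel g"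
    and "integral\<^sup>L lebesgue f = integral\<^sup>L lborel g"
proof -
  have gl: "g \<in> borel_measurable lebesgue" "g \<in> borel_measurable lborel"
    using g by (auto simp: measurable_completion)
  have ae': "AE x in lebesgue. g x = f x" using ae by (simp add: AE_completion_iff eq_commute)
  have fl: "f \<in> borel_measurable lebesgue"
    by (rule borel_measurable_AE[OF gl(1) ae'])
  show "integrable lebesgue f \<longleftrightarrow> integrable lborel g"
    using integrable_cong_AE[OF gl(1) fl ae'] integrable_completion[OF gl(2)] by simp
  show "integral\<^sup>L lebesgue f = integral\<^sup>L lborel g"
    using integral_cong_AE[OF gl(1) fl ae'] integral_completion[OF gl(2)] by simp
qed

text \<open>
  Facts 1 to 3 integrate over the first coordinate inside, facts 4 to 6 over the second. Both orders hold for a Borel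
  representative, and almost every slice of the function agrees almost everywhere with that of its representative.
\<close>

lemma Fubini_lebesgue_on:
  fixes A :: "'a::euclidean_space set" and B :: "'b::euclidean_space set" and f :: "'a \<times> 'b \<Rightarrow> real"
  assumes A: "A \<in> sets borel" and B: "B \<in> sets borel"
    and f: "integrable (lebesgue_on (A \<times> B)) f"
  shows "AE y in lebesgue_on B. integrable (lebesgue_on A) (\<lambda>x. f (x, y))"
    and "integrable (lebesgue_on B) (\<lambda>y. LINT x|lebesgue_on A. f (x, y))"
    and "(LINT y|lebesgue_on B. LINT x|lebesgue_on A. f (x, y)) = integral\<^sup>L (lebesgue_on (A \<times> B)) f"
    and "AE x in lebesgue_on A. integrable (lebesgue_on B) (\<lambda>y. f (x, y))"
    and "integrable (lebesgue_on A) (\<lambda>x. LINT y|lebesgue_on B. f (x, y))"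
    and "(LINT x|lebesgue_on A. LINT y|lebesgue_on B. f (x, y)) = integral\<^sup>L (lebesgue_on (A \<times> B)) f"
proof -
  have AB: "A \<times> B \<in> sets lebesgue"
    using A B by (simp add: borel_Times)
  have Al: "A \<in> sets lebesgue" and Bl: "B \<in> sets lebesgue" using A B by auto
  define F where "F z = (if z \<in> A \<times> B then f z else 0)" for z
  have F: "integrable lebesgue F"
    using f unfolding integrable_lebesgue_on_iff[OF AB] by (simp add: F_def[abs_def])
  obtain g where g: "g \<in> borel_measurable borel" "AE z in lborel. F z = g z"
    using ex_borel_representative[of F] F by blast
  have gi: "integrable lborel g"
    using borel_integrable_cong_lebesgue(1)[OF g] F by simp
  then have gi: "integrable (lborel \<Otimes>\<^sub>M lborel) g" by (simp add: lborel_prod)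
  then have gic: "integrable (lborel \<Otimes>\<^sub>M lborel) (case_prod (\<lambda>x y. g (x, y)))" by simp
  have fg: "integral\<^sup>L (lebesgue_on (A \<times> B)) f = integral\<^sup>L (lborel \<Otimes>\<^sub>M lborel) g"
    using borel_integrable_cong_lebesgue(2)[OF g]
    unfolding integral_lebesgue_on_eq[OF AB] by (simp add: F_def[abs_def] lborel_prod)
  have gm1: "(\<lambda>x. g (x, y)) \<in> borel_measurable borel" for y
    using g(1) by measurable
  have gm2: "(\<lambda>y. g (x, y)) \<in> borel_measurable borel" for x
    using g(1) by measurable
  have "AE z in lebesgue_on (UNIV \<times> UNIV). F z = g z"
    using g(2) unfolding UNIV_Times_UNIV lebesgue_on_UNIV_eq AE_completion_iff .
  note sl = AE_lebesgue_on_Times[OF _ _ this, simplified lebesgue_on_UNIV_eq AE_completion_iff, simplified]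
  have "AE y in lborel. integrable lborel (\<lambda>x. g (x, y))"
    using lborel_pair.AE_integrable_snd[OF gic] .
  with sl(1) have ae1: "AE y in lborel. (y \<in> B \<longrightarrow> integrable (lebesgue_on A) (\<lambda>x. f (x, y)))
    \<and> (if y \<in> B then LINT x|lebesgue_on A. f (x, y) else 0) = (LINT x|lborel. g (x, y))"
  proof eventually_elim
    case (elim y)
    have "(\<lambda>x. if x \<in> A then f (x, y) else 0) = (\<lambda>x. F (x, y))" if "y \<in> B"
      using that by (auto simp: F_def)
    moreover have "(LINT x|lebesgue. F (x, y)) = 0" if "y \<notin> B"
      using that by (simp add: F_def)
    ultimately show ?case using borel_integrable_cong_lebesgue[OF gm1 elim(1)] elim(2)
      by (auto simp: integrable_lebesgue_on_iff[OF Al] integral_lebesgue_on_eq[OF Al])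
  qed
  have "AE x in lborel. integrable lborel (\<lambda>y. g (x, y))"
    using lborel_pair.AE_integrable_fst[OF gic] .
  with sl(2) have ae2: "AE x in lborel. (x \<in> A \<longrightarrow> integrable (lebesgue_on B) (\<lambda>y. f (x, y)))
    \<and> (if x \<in> A then LINT y|lebesgue_on B. f (x, y) else 0) = (LINT y|lborel. g (x, y))"
  proof eventually_elim
    case (elim x)
    have "(\<lambda>y. if y \<in> B then f (x, y) else 0) = (\<lambda>y. F (x, y))" if "x \<in> A"
      using that by (auto simp: F_def)
    moreover have "(LINT y|lebesgue. F (x, y)) = 0" if "x \<notin> A"
      using that by (simp add: F_def)
    ultimately show ?case using borel_integrable_cong_lebesgue[OF gm2 elim(1)] elim(2)
      by (auto simp: integrable_lebesgue_on_iff[OF Bl] integral_lebesgue_on_eq[OF Bl])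
  qed
  show "AE y in lebesgue_on B. integrable (lebesgue_on A) (\<lambda>x. f (x, y))"
    unfolding AE_lebesgue_on_iff[OF Bl] using ae1 by eventually_elim simp
  show "AE x in lebesgue_on A. integrable (lebesgue_on B) (\<lambda>y. f (x, y))"
    unfolding AE_lebesgue_on_iff[OF Al] using ae2 by eventually_elim simp
  have i1: "integrable lborel (\<lambda>y. LINT x|lborel. g (x, y))"
    using lborel_pair.integrable_snd[OF gic] .
  have i2: "integrable lborel (\<lambda>x. LINT y|lborel. g (x, y))"
    using lborel_pair.integrable_fst[OF gic] .
  have m1: "(\<lambda>y. LINT x|lborel. g (x, y)) \<in> borel_measurable borel"
    using borel_measurable_integrable[OF i1] by simp
  have m2: "(\<lambda>x. LINT y|lborel. g (x, y)) \<in> borel_measurable borel"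
    using borel_measurable_integrable[OF i2] by simp
  note c1 = borel_integrable_cong_lebesgue[OF m1, of "\<lambda>y. if y \<in> B then LINT x|lebesgue_on A. f (x, y) else 0"]
  note c2 = borel_integrable_cong_lebesgue[OF m2, of "\<lambda>x. if x \<in> A then LINT y|lebesgue_on B. f (x, y) else 0"]
  have a1: "AE y in lborel. (if y \<in> B then LINT x|lebesgue_on A. f (x, y) else 0) = (LINT x|lborel. g (x, y))"
    using ae1 by eventually_elim simp
  have a2: "AE x in lborel. (if x \<in> A then LINT y|lebesgue_on B. f (x, y) else 0) = (LINT y|lborel. g (x, y))"
    using ae2 by eventually_elim simp
  show "integrable (lebesgue_on B) (\<lambda>y. LINT x|lebesgue_on A. f (x, y))"
    unfolding integrable_lebesgue_on_iff[OF Bl] using c1(1)[OF a1] i1 by simp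
  show "integrable (lebesgue_on A) (\<lambda>x. LINT y|lebesgue_on B. f (x, y))"
    unfolding integrable_lebesgue_on_iff[OF Al] using c2(1)[OF a2] i2 by simp
  show "(LINT y|lebesgue_on B. LINT x|lebesgue_on A. f (x, y)) = integral\<^sup>L (lebesgue_on (A \<times> B)) f"
    unfolding integral_lebesgue_on_eq[OF Bl] fg c1(2)[OF a1]
    using lborel_pair.integral_snd[OF gic] by simp
  show "(LINT x|lebesgue_on A. LINT y|lebesgue_on B. f (x, y)) = integral\<^sup>L (lebesgue_on (A \<times> B)) f"
    unfolding integral_lebesgue_on_eq[OF Al] fg c2(2)[OF a2]
    using lborel_pair.integral_fst[OF gic] by simp
qed

lemma measurable_lebesgue_on_fst:
  fixes A :: "'a::euclidean_space set" and B :: "'b::euclidean_space set"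
    and u :: "'a \<Rightarrow> 'c::euclidean_space"
  assumes A: "A \<in> sets borel" and B: "B \<in> sets borel" and u: "u \<in> borel_measurable (lebesgue_on A)"
  shows "(\<lambda>z. u (fst z)) \<in> borel_measurable (lebesgue_on (A \<times> B))"
proof -
  have AB: "A \<times> B \<in> sets lebesgue"
    using A B by (simp add: borel_Times)
  have Al: "A \<in> sets lebesgue" using A by auto
  have "(\<lambda>x. if x \<in> A then u x else 0) \<in> borel_measurable lebesgue"
    using u borel_measurable_if[OF Al] by blast
  then obtain g where g: "g \<in> borel_measurable borel" "AE x in lborel. (if x \<in> A then u x else 0) = g x"
    by (rule ex_borel_representative)
  have "AE x in lebesgue_on A. u x = g x"
    unfolding AE_lebesgue_on_iff[OF Al] using g(2) by eventually_elim auto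
  from AE_lebesgue_on_Times_fst[OF A B this]
  have "AE z in lebesgue_on (A \<times> B). u (fst z) = g (fst z)" .
  then have ae: "AE z in lebesgue_on (A \<times> B). g (fst z) = u (fst z)"
    by eventually_elim simp
  have "(\<lambda>z. g (fst z) :: 'c) \<in> borel_measurable (borel :: ('a \<times> 'b) measure)"
    using g(1) by (intro measurable_compose[OF borel_measurable_continuous_onI[of fst]] continuous_on_fst continuous_on_id)
  then have "(\<lambda>z. g (fst z) :: 'c) \<in> borel_measurable (lebesgue_on (A \<times> B))"
    by (intro measurable_restrict_space1 measurable_completion) simp
  from borel_measurable_lebesgue_on_AE[OF AB this ae] show ?thesis .
qed

lemma integrable_lebesgue_on_fst:
  fixes A :: "'a::euclidean_space set" and B :: "'b::euclidean_space set" and f :: "'a \<Rightarrow> real"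
  assumes A: "A \<in> sets borel" and B: "B \<in> sets borel" and Bfin: "emeasure lborel B < \<infinity>"
    and f: "integrable (lebesgue_on A) f"
  shows "integrable (lebesgue_on (A \<times> B)) (\<lambda>z. f (fst z))"
proof -
  have AB: "A \<times> B \<in> sets lebesgue"
    using A B by (simp add: borel_Times)
  have Al: "A \<in> sets lebesgue" using A by auto
  define F where "F x = (if x \<in> A then f x else 0)" for x
  have F: "integrable lebesgue F"
    using f unfolding integrable_lebesgue_on_iff[OF Al] by (simp add: F_def[abs_def])
  obtain g where g: "g \<in> borel_measurable borel" "AE x in lborel. F x = g x"
    using ex_borel_representative[of F] F by blast
  have gi: "integrable lborel g"
    using borel_integrable_cong_lebesgue(1)[OF g] F by simp
  define G where "G z = indicat_real B (snd z) * g (fst z)" for z :: "'a \<times> 'b"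
  have Gm: "G \<in> borel_measurable borel"
  proof -
    have "(\<lambda>z. g (fst z)) \<in> borel_measurable (borel :: ('a \<times> 'b) measure)"
      using g(1) by (intro measurable_compose[OF borel_measurable_continuous_onI[of fst]] continuous_on_fst continuous_on_id)
    moreover have "(\<lambda>z. indicat_real B (snd z)) \<in> borel_measurable (borel :: ('a \<times> 'b) measure)"
      using borel_measurable_indicator[OF B]
      by (intro measurable_compose[OF borel_measurable_continuous_onI[of snd]] continuous_on_snd continuous_on_id) simp
    ultimately show ?thesis unfolding G_def by measurable
  qed
  have Bi: "integrable lborel (indicat_real B)" using B Bfin by simp
  have "integrable (lborel \<Otimes>\<^sub>M lborel) G"
  proof (rule lborel_pair.Fubini_integrable)
    show "G \<in> borel_measurable (lborel \<Otimes>\<^sub>M lborel)" using Gm by (simp add: lborel_prod)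
    show "integrable lborel (\<lambda>x. LINT y|lborel. norm (G (x, y)))"
      using gi Bi by (simp add: G_def abs_mult)
    show "AE x in lborel. integrable lborel (\<lambda>y. G (x, y))"
      using Bi by (simp add: G_def)
  qed
  then have Gi: "integrable lborel G" by (simp add: lborel_prod)
  have "AE x in lebesgue_on A. f x = g x"
    unfolding AE_lebesgue_on_iff[OF Al] using g(2) by eventually_elim (auto simp: F_def)
  from AE_lebesgue_on_Times_fst[OF A B this]
  have 1: "AE z in lborel. z \<in> A \<times> B \<longrightarrow> f (fst z) = g (fst z)"
    unfolding AE_lebesgue_on_iff[OF AB] .
  have "AE x in lebesgue_on (-A). g x = 0"
    using g(2) A by (subst AE_lebesgue_on_iff) (auto simp: F_def elim: eventually_mono)
  from AE_lebesgue_on_Times_fst[OF borel_comp[OF A] B this]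
  have 2: "AE z in lborel. z \<in> (-A) \<times> B \<longrightarrow> g (fst z) = 0"
    using A B by (subst (asm) AE_lebesgue_on_iff) (auto simp: borel_Times)
  have "AE z in lborel. (if z \<in> A \<times> B then f (fst z) else 0) = G z"
    using 1 2 by eventually_elim (auto simp: G_def indicator_def)
  from borel_integrable_cong_lebesgue(1)[OF Gm this] Gi show ?thesis
    unfolding integrable_lebesgue_on_iff[OF AB] by simp
qed

lemma L2_lebesgue_on_fst:
  fixes A :: "'a::euclidean_space set" and B :: "'b::euclidean_space set"
  assumes A: "A \<in> sets borel" and B: "B \<in> sets borel" and Bfin: "emeasure lborel B < \<infinity>"
    and u: "u \<in> L2 (lebesgue_on A)"
  shows "(\<lambda>z. u (fst z)) \<in> L2 (lebesgue_on (A \<times> B))"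
  using measurable_lebesgue_on_fst[OF A B] integrable_lebesgue_on_fst[OF A B Bfin] u
  by (auto simp: L2_def)

lemma L2_indicator:
  fixes B S :: "'a::euclidean_space set"
  assumes B: "B \<in> sets borel" "emeasure lborel B < \<infinity>" and S: "S \<in> sets lebesgue"
  shows "(\<lambda>x. indicator B x *\<^sub>R e) \<in> L2 (lebesgue_on S)"
proof -
  have "integrable lborel (\<lambda>x. indicat_real B x * (norm e)\<^sup>2)"
    by (rule integrable_mult_left, rule integrable_real_indicator) (use B in auto)
  then have "integrable lebesgue (\<lambda>x. indicat_real B x * (norm e)\<^sup>2)"
    by (subst integrable_completion) (use B in \<open>auto intro!: borel_measurable_times\<close>)
  then have "integrable (lebesgue_on S) (\<lambda>x. indicat_real B x * (norm e)\<^sup>2)"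
    using S by (intro integrable_restrict_space[THEN iffD2] integrable_mult_indicator) auto
  moreover have "(norm (indicat_real B x *\<^sub>R e))\<^sup>2 = indicat_real B x * (norm e)\<^sup>2" for x
    by (auto simp: indicator_def)
  moreover have "(\<lambda>x. indicat_real B x *\<^sub>R e) \<in> borel_measurable (lebesgue_on S)"
    by (intro measurable_restrict_space1 measurable_completion borel_measurable_scaleR) (use B in auto)
  ultimately show ?thesis by (simp add: L2_def)
qed

section \<open>Smooth bumps and the fundamental lemma of the calculus of variations\<close>

text \<open>
  The classical smooth function with a zero of infinite order. The powers of \<open>1 / s\<close> are included because
  differentiation produces them: the family is closed under derivatives up to linear combinations.
\<close>

definition flat :: "nat \<Rightarrow> real \<Rightarrow> real" where
  "flat k s = (if s > 0 then inverse s ^ k * exp (- inverse s) else 0)"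

lemma flat_tendsto_0: "(flat k \<longlongrightarrow> 0) (at 0)"
proof (rule filterlim_split_at)
  have "eventually (\<lambda>s. s < (0::real)) (at_left 0)"
    by (simp add: eventually_at_filter)
  then have "eventually (\<lambda>s. flat k s = 0) (at_left 0)"
    by eventually_elim (simp add: flat_def)
  then show "(flat k \<longlongrightarrow> 0) (at_left 0)" by (rule tendsto_eventually)
  have "((\<lambda>s. inverse s ^ k / exp (inverse s)) \<longlongrightarrow> (0::real)) (at_right 0)"
    by (rule filterlim_compose[OF tendsto_power_div_exp_0 filterlim_inverse_at_top_right])
  moreover have "eventually (\<lambda>s. s > (0::real)) (at_right 0)"
    by (simp add: eventually_at_filter)
  then have "eventually (\<lambda>s. inverse s ^ k / exp (inverse s) = flat k s) (at_right 0)"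
    by eventually_elim (simp add: flat_def exp_minus field_simps)
  ultimately show "(flat k \<longlongrightarrow> 0) (at_right 0)" by (rule Lim_transform_eventually)
qed

lemma DERIV_flat: "(flat k has_real_derivative flat (k + 2) s - real k * flat (k + 1) s) (at s)"
proof -
  consider "s > 0" | "s < 0" | "s = 0" by linarith
  then show ?thesis
  proof cases
    case 1
    have "((\<lambda>s. inverse s ^ k * exp (- inverse s)) has_real_derivative
        flat (k + 2) s - real k * flat (k + 1) s) (at s)"
    proof (cases k)
      case 0
      then show ?thesis using 1
        by (auto intro!: derivative_eq_intros simp: flat_def power2_eq_square)
    next
      case (Suc m)
      show ?thesis using 1 unfolding Suc
        by (auto intro!: derivative_eq_intros simp: flat_def power2_eq_square algebra_simps
            simp flip: power_Suc)
    qed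
    then show ?thesis
      by (rule has_field_derivative_transform_within_open[of _ _ _ "{0<..}"])
        (use 1 in \<open>auto simp: flat_def\<close>)
  next
    case 2
    have "((\<lambda>s. 0) has_real_derivative flat (k + 2) s - real k * flat (k + 1) s) (at s)"
      using 2 by (auto simp: flat_def)
    then show ?thesis
      by (rule has_field_derivative_transform_within_open[of _ _ _ "{..<0}"])
        (use 2 in \<open>auto simp: flat_def\<close>)
  next
    case 3
    \<comment> \<open>At the origin the difference quotient of \<open>flat k\<close> is \<open>flat (k + 1)\<close>.\<close>
    have "((\<lambda>h. (flat k (0 + h) - flat k 0) / h) \<longlongrightarrow> 0) (at 0)"
    proof (rule Lim_transform_eventually[OF flat_tendsto_0[of "Suc k"]])
      show "\<forall>\<^sub>F h in at 0. flat (Suc k) h = (flat k (0 + h) - flat k 0) / h"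
        by (rule eventually_at_filter[THEN iffD2], rule always_eventually) (auto simp: flat_def field_simps)
    qed
    then show ?thesis by (simp add: 3 DERIV_def flat_def)
  qed
qed

lemma flat_bounds: "0 \<le> flat 0 s" "flat 0 s \<le> 1"
  by (auto simp: flat_def)

lemma flat_eq_0_iff: "flat 0 s = 0 \<longleftrightarrow> s \<le> 0"
  by (auto simp: flat_def)

lemma flat_scaled_tendsto: "(\<lambda>n. flat 0 (real n * s)) \<longlonglongrightarrow> (if s > 0 then 1 else 0)"
proof (cases "s > 0")
  case True
  have "(\<lambda>n. exp (- (inverse (real n) * inverse s))) \<longlonglongrightarrow> exp (- (0 * inverse s))"
    by (intro tendsto_intros lim_inverse_n)
  moreover have "eventually (\<lambda>n. exp (- (inverse (real n) * inverse s)) = flat 0 (real n * s)) sequentially"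
    using eventually_gt_at_top[of 0] by eventually_elim (use True in \<open>simp add: flat_def\<close>)
  ultimately have "(\<lambda>n. flat 0 (real n * s)) \<longlonglongrightarrow> exp (- (0 * inverse s))"
    by (rule Lim_transform_eventually)
  then show ?thesis using True by simp
next
  case False
  then have "real n * s \<le> 0" for n by (simp add: mult_nonneg_nonpos)
  then have "flat 0 (real n * s) = 0" for n by (simp add: flat_eq_0_iff)
  then show ?thesis using False by simp
qed

text \<open>
  The algebra generated by \<open>flat\<close> of affine functions. It is closed under directional derivatives
  (\<open>flat_generated_derivative\<close>), so all of its members are smooth, without an induction over
  products and chain rules for derivatives of higher order.
\<close>

inductive flat_generated :: "('a::euclidean_space \<Rightarrow> real) \<Rightarrow> bool" where
  const: "flat_generated (\<lambda>x. c)"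
| flat: "flat_generated (\<lambda>x. flat k (x \<bullet> b + c))"
| add: "flat_generated f \<Longrightarrow> flat_generated g \<Longrightarrow> flat_generated (\<lambda>x. f x + g x)"
| mult: "flat_generated f \<Longrightarrow> flat_generated g \<Longrightarrow> flat_generated (\<lambda>x. f x * g x)"

lemma flat_generated_derivative:
  "flat_generated f \<Longrightarrow> \<exists>f'. (\<forall>x. (f has_derivative f' x) (at x)) \<and> (\<forall>v. flat_generated (\<lambda>x. f' x v))"
proof (induction rule: flat_generated.induct)
  case (const c)
  show ?case by (rule exI[of _ "\<lambda>x v. 0"]) (auto intro: flat_generated.const)
next
  case (flat k b c)
  define d where "d s = flat (k + 2) s + (- real k) * flat (k + 1) s" for s
  have D: "(flat k has_real_derivative d s) (at s)" for s
    using DERIV_flat[of k s] by (simp add: d_def)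
  have "((\<lambda>x. flat k (x \<bullet> b + c)) has_derivative (\<lambda>v. (v \<bullet> b) * d (x \<bullet> b + c))) (at x)" for x
    by (rule DERIV_compose_FDERIV[OF D]) (auto intro!: derivative_eq_intros)
  moreover have "flat_generated (\<lambda>x. (v \<bullet> b) * d (x \<bullet> b + c))" for v
    unfolding d_def by (intro flat_generated.intros)
  ultimately show ?case by (intro exI[of _ "\<lambda>x v. (v \<bullet> b) * d (x \<bullet> b + c)"]) auto
next
  case (add f g)
  then obtain f' g' where "\<And>x. (f has_derivative f' x) (at x)" "\<And>v. flat_generated (\<lambda>x. f' x v)"
    "\<And>x. (g has_derivative g' x) (at x)" "\<And>v. flat_generated (\<lambda>x. g' x v)" by blast
  then show ?case
    by (intro exI[of _ "\<lambda>x v. f' x v + g' x v"]) (auto intro: has_derivative_add flat_generated.add)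
next
  case (mult f g)
  then obtain f' g' where "\<And>x. (f has_derivative f' x) (at x)" "\<And>v. flat_generated (\<lambda>x. f' x v)"
    "\<And>x. (g has_derivative g' x) (at x)" "\<And>v. flat_generated (\<lambda>x. g' x v)" by blast
  then have "(\<forall>x. ((\<lambda>x. f x * g x) has_derivative (\<lambda>v. f x * g' x v + f' x v * g x)) (at x))
      \<and> (\<forall>v. flat_generated (\<lambda>x. f x * g' x v + f' x v * g x))"
    using mult.hyps by (intro conjI allI has_derivative_mult flat_generated.add flat_generated.mult)
  then show ?case by (rule exI[of _ "\<lambda>x v. f x * g' x v + f' x v * g x"])
qed

lemma Ck_flat_generated:
  fixes w :: "'b::real_normed_vector"
  assumes "flat_generated f" shows "Ck k (\<lambda>x. f x *\<^sub>R w)"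
  using assms
proof (induction k arbitrary: f)
  case 0
  then obtain f' where "\<And>x. (f has_derivative f' x) (at x)"
    using flat_generated_derivative by blast
  then have "continuous_on UNIV f"
    by (meson differentiable_def differentiable_imp_continuous_on differentiable_on_def has_derivative_at_withinI)
  then show ?case by (auto intro: continuous_intros)
next
  case (Suc k)
  then obtain f' where f': "\<And>x. (f has_derivative f' x) (at x)" "\<And>v. flat_generated (\<lambda>x. f' x v)"
    using flat_generated_derivative by blast
  have D: "((\<lambda>x. f x *\<^sub>R w) has_derivative (\<lambda>v. f' x v *\<^sub>R w)) (at x)" for x
    by (intro has_derivative_scaleR_left f')
  then have "frechet_derivative (\<lambda>x. f x *\<^sub>R w) (at x) = (\<lambda>v. f' x v *\<^sub>R w)" for x
    by (metis frechet_derivative_at)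
  then show ?case using D Suc.IH[OF f'(2)] by (auto simp: differentiable_def)
qed

text \<open>
  Each factor \<open>flat 0 (n * s)\<close> is \<open>exp (- 1 / (n * s))\<close> for \<open>s > 0\<close> and \<open>n > 0\<close>. It is supported in the half line for
  every \<open>n\<close> and increases to its indicator function, so the bumps approximate the indicator
  of the box from inside with values in \<open>[0, 1]\<close>.
\<close>

definition box_bump :: "'a::euclidean_space \<Rightarrow> 'a \<Rightarrow> nat \<Rightarrow> 'a \<Rightarrow> real" where
  "box_bump l u n x = (\<Prod>b\<in>Basis. flat 0 (real n * (x \<bullet> b - l \<bullet> b)) * flat 0 (real n * (u \<bullet> b - x \<bullet> b)))"

lemma flat_generated_prod:
  "finite I \<Longrightarrow> (\<And>i. i \<in> I \<Longrightarrow> flat_generated (f i)) \<Longrightarrow> flat_generated (\<lambda>x. \<Prod>i\<in>I. f i x)"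
  by (induction rule: finite_induct) (auto intro: flat_generated.const flat_generated.mult)

lemma flat_generated_box_bump: "flat_generated (box_bump l u n)"
proof -
  have 1: "flat_generated (\<lambda>x. flat 0 (real n * (x \<bullet> b - l \<bullet> b)))" for b :: 'a
  proof -
    have "flat_generated (\<lambda>x. flat 0 (x \<bullet> (real n *\<^sub>R b) + - (real n * (l \<bullet> b))))" by (rule flat_generated.flat)
    then show ?thesis by (simp add: algebra_simps)
  qed
  have 2: "flat_generated (\<lambda>x. flat 0 (real n * (u \<bullet> b - x \<bullet> b)))" for b :: 'a
  proof -
    have "flat_generated (\<lambda>x. flat 0 (x \<bullet> (- real n *\<^sub>R b) + real n * (u \<bullet> b)))" by (rule flat_generated.flat)
    then show ?thesis by (simp add: algebra_simps)
  qed
  show ?thesis unfolding box_bump_def[abs_def]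
    by (rule flat_generated_prod) (auto intro: 1 2 flat_generated.mult)
qed

lemma box_bump_bounds: "0 \<le> box_bump l u n x" "box_bump l u n x \<le> 1"
  unfolding box_bump_def by (auto intro!: prod_nonneg prod_le_1 mult_le_one mult_nonneg_nonneg simp: flat_bounds)

lemma box_bump_nonzero: "box_bump l u n x \<noteq> 0 \<Longrightarrow> x \<in> box l u"
  by (auto simp: box_bump_def flat_eq_0_iff mem_box not_le zero_less_mult_iff)

lemma box_bump_tendsto: "(\<lambda>n. box_bump l u n x) \<longlonglongrightarrow> indicator (box l u) x"
proof -
  have "(\<lambda>n. box_bump l u n x) \<longlonglongrightarrow>
      (\<Prod>b\<in>Basis. (if x \<bullet> b - l \<bullet> b > 0 then 1 else 0) * (if u \<bullet> b - x \<bullet> b > 0 then 1 else 0))"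
    unfolding box_bump_def by (intro tendsto_prod tendsto_mult flat_scaled_tendsto)
  also have "(\<Prod>b\<in>Basis. (if x \<bullet> b - l \<bullet> b > 0 then 1 else 0) * (if u \<bullet> b - x \<bullet> b > 0 then 1 else 0))
      = indicat_real (box l u) x"
  proof (cases "x \<in> box l u")
    case True
    then show ?thesis by (auto simp: mem_box intro!: prod.neutral)
  next
    case False
    then obtain b where "b \<in> Basis" "\<not> (l \<bullet> b < x \<bullet> b \<and> x \<bullet> b < u \<bullet> b)" by (auto simp: mem_box)
    then have "(\<Prod>b\<in>Basis. (if x \<bullet> b - l \<bullet> b > 0 then 1 else 0) * (if u \<bullet> b - x \<bullet> b > 0 then 1 else 0 :: real)) = 0"
      by (intro prod_zero) (auto intro!: bexI[of _ b])
    then show ?thesis using False by simp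
  qed
  finally show ?thesis .
qed

lemma box_bump_test_field:
  assumes "cbox l u \<subseteq> S"
  shows "(\<lambda>x. box_bump l u n x *\<^sub>R w) \<in> test_fields S"
proof -
  have "{x. box_bump l u n x *\<^sub>R w \<noteq> 0} \<subseteq> cbox l u"
    using box_bump_nonzero box_subset_cbox by fastforce
  then have *: "closure {x. box_bump l u n x *\<^sub>R w \<noteq> 0} \<subseteq> cbox l u"
    by (rule closure_minimal) (rule closed_cbox)
  then have "compact (closure {x. box_bump l u n x *\<^sub>R w \<noteq> 0})"
    using compact_Int_closed[OF compact_cbox, of "closure {x. box_bump l u n x *\<^sub>R w \<noteq> 0}" l u]
    by (simp add: inf_absorb2)
  with * assms show ?thesis
    unfolding test_fields_def using Ck_flat_generated[OF flat_generated_box_bump] by blast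
qed

text \<open>
  The positive and the negative part of \<open>g\<close> are densities of finite measures that agree on the boxes,
  an intersection-stable generator of the Borel sets; hence the measures and their densities agree.
\<close>

lemma AE_0_if_box_integrals_0:
  fixes g :: "'a::euclidean_space \<Rightarrow> real"
  assumes g: "integrable lborel g" and 0: "\<And>l u. (LINT x|lborel. indicator (box l u) x * g x) = 0"
  shows "AE x in lborel. g x = 0"
proof -
  have gm [measurable]: "g \<in> borel_measurable borel" using g by auto
  have fin: "(\<integral>\<^sup>+x. ennreal (g x) * indicator A x \<partial>lborel) < \<infinity>"
     "(\<integral>\<^sup>+x. ennreal (- g x) * indicator A x \<partial>lborel) < \<infinity>" for A
  proof -
    have g': "(\<integral>\<^sup>+x. ennreal (norm (g x)) \<partial>lborel) < \<infinity>"
      using g by (simp add: integrable_iff_bounded)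
    show "(\<integral>\<^sup>+x. ennreal (g x) * indicator A x \<partial>lborel) < \<infinity>"
      by (rule le_less_trans[OF nn_integral_mono g']) (auto simp: indicator_def intro: ennreal_leI)
    show "(\<integral>\<^sup>+x. ennreal (- g x) * indicator A x \<partial>lborel) < \<infinity>"
      by (rule le_less_trans[OF nn_integral_mono g']) (auto simp: indicator_def intro: ennreal_leI)
  qed
  have eq: "(\<integral>\<^sup>+x. ennreal (g x) * indicator (box l u) x \<partial>lborel)
      = (\<integral>\<^sup>+x. ennreal (- g x) * indicator (box l u) x \<partial>lborel)" for l u
  proof -
    have i: "integrable lborel (\<lambda>x. indicator (box l u) x * g x)"
      by (rule Bochner_Integration.integrable_bound[OF g]) (auto simp: indicator_def)
    have e: "ennreal (indicator (box l u) x * g x) = ennreal (g x) * indicator (box l u) x"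
      "ennreal (- (indicator (box l u) x * g x)) = ennreal (- g x) * indicator (box l u) x" for x
      by (auto simp: indicator_def)
    have "enn2real (\<integral>\<^sup>+x. ennreal (g x) * indicator (box l u) x \<partial>lborel)
      = enn2real (\<integral>\<^sup>+x. ennreal (- g x) * indicator (box l u) x \<partial>lborel)"
      using real_lebesgue_integral_def[OF i] 0[of l u] by (simp add: e)
    then show ?thesis using fin by (metis ennreal_enn2real infinity_ennreal_def)
  qed
  have "density lborel (\<lambda>x. ennreal (g x)) = density lborel (\<lambda>x. ennreal (- g x))"
  proof (rule measure_eqI_generator_eq)
    let ?E = "range (\<lambda>(a, b). box a b::'a set)"
    show "Int_stable ?E"
      by (auto simp: Int_stable_def box_Int_box)
    show "?E \<subseteq> Pow UNIV" "sets (density lborel (\<lambda>x. ennreal (g x))) = sigma_sets UNIV ?E"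
      "sets (density lborel (\<lambda>x. ennreal (- g x))) = sigma_sets UNIV ?E"
      by (simp_all add: borel_eq_box)
    let ?A = "\<lambda>n::nat. box (- (real n *\<^sub>R One)) (real n *\<^sub>R One) :: 'a set"
    show "range ?A \<subseteq> ?E" "(\<Union>i. ?A i) = UNIV"
      unfolding UN_box_eq_UNIV by auto
    show "emeasure (density lborel (\<lambda>x. ennreal (g x))) (?A i) \<noteq> \<infinity>" for i
      using fin by (simp add: emeasure_density less_top)
    show "emeasure (density lborel (\<lambda>x. ennreal (g x))) X = emeasure (density lborel (\<lambda>x. ennreal (- g x))) X"
      if "X \<in> ?E" for X
      using that eq by (auto simp: emeasure_density)
  qed
  then have "AE x in lborel. ennreal (g x) = ennreal (- g x)"
    by (rule sigma_finite_measure.density_unique[OF sigma_finite_lborel, rotated 2]) measurable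
  then show ?thesis
    proof eventually_elim
    case (elim x)
    then show ?case by (cases "g x \<ge> 0") (auto simp: ennreal_neg ennreal_eq_0_iff)
  qed
qed

text \<open>
  Integrals of \<open>w\<close> against \<open>box_bump\<close> converge to integrals over boxes. Countably many compact boxes
  cover \<open>\<Omega>\<close>, and inside each of them all box integrals vanish.
\<close>

lemma fundamental_lemma:
  assumes \<Omega>: "open \<Omega>" and w: "w \<in> Hspace \<Omega>"
    and 0: "\<And>\<phi>. \<phi> \<in> test_fields \<Omega> \<Longrightarrow> (LINT x|lebesgue_on \<Omega>. w x \<bullet> \<phi> x) = 0"
  shows "AE x in lebesgue_on \<Omega>. w x = 0"
proof -
  have \<Omega>l: "\<Omega> \<in> sets lebesgue" using \<Omega> by auto
  have wL: "w \<in> L2 (lebesgue_on \<Omega>)" using w by (simp add: Hspace_def)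
  have box0: "AE x in lborel. x \<in> cbox a b \<longrightarrow> w x \<bullet> e = 0" if ab: "cbox a b \<subseteq> \<Omega>" for a b e
  proof -
    define v where "v x = indicator (cbox a b) x *\<^sub>R e" for x :: "real^3"
    have v: "v \<in> L2 (lebesgue_on \<Omega>)"
      unfolding v_def by (rule L2_indicator[OF _ emeasure_bounded_finite[OF bounded_cbox] \<Omega>l]) simp
    define f where "f x = (if x \<in> \<Omega> then w x \<bullet> v x else 0)" for x
    have f: "integrable lebesgue f"
      using L2_inner_integrable[OF wL v] unfolding integrable_lebesgue_on_iff[OF \<Omega>l] f_def[abs_def] .
    obtain g where g: "g \<in> borel_measurable borel" "AE x in lborel. f x = g x"
      using ex_borel_representative[of f] f by blast
    have gi: "integrable lborel g"
      using borel_integrable_cong_lebesgue(1)[OF g] f by simp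
    have "(LINT x|lborel. indicator (box l u) x * g x) = 0" for l u
    proof -
      \<comment> \<open>Restricting the field to a compact box makes it integrable; only subboxes of that box see it.\<close>
      obtain l' u' where lu: "box l u \<inter> box a b = box l' u'" using box_Int_box by blast
      define B where "B = box l' u'"
      have B: "box l u \<inter> box a b = B" "B \<subseteq> cbox a b" using lu box_subset_cbox[of a b] by (auto simp: B_def)
      have fr: "AE x in lborel. x \<notin> cbox a b - box a b"
        by (rule AE_completion_iff[THEN iffD1], rule AE_not_in, fold negligible_iff_null_sets)
          (rule negligible_frontier_interval)
      have "(LINT x|lborel. indicator (box l u) x * g x)
          = (LINT x|lebesgue. (if x \<in> \<Omega> then w x \<bullet> (indicator B x *\<^sub>R e) else 0))"
      proof (rule borel_integrable_cong_lebesgue(2)[symmetric])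
        show "(\<lambda>x. indicat_real (box l u) x * g x) \<in> borel_measurable borel"
          using g(1) by measurable
        show "AE x in lborel. (if x \<in> \<Omega> then w x \<bullet> (indicator B x *\<^sub>R e) else 0) = indicat_real (box l u) x * g x"
          using fr g(2)
        proof eventually_elim
          case (elim x)
          have 1: "x \<in> B \<longleftrightarrow> x \<in> box l u \<and> x \<in> cbox a b" using elim(1) B by blast
          have 2: "x \<in> cbox a b \<Longrightarrow> x \<in> \<Omega>" using ab by blast
          show ?case
          proof (cases "x \<in> box l u \<and> x \<in> cbox a b")
            case True
            then show ?thesis using 1 2 elim(2)[symmetric] by (simp add: f_def v_def)
          next
            case False
            then have "x \<notin> B" using 1 by simp
            moreover have "indicat_real (box l u) x * g x = 0"
              using False elim(2)[symmetric] by (cases "x \<in> box l u") (simp_all add: f_def v_def)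
            ultimately show ?thesis by simp
          qed
        qed
      qed
      also have "\<dots> = (LINT x|lebesgue_on \<Omega>. w x \<bullet> (indicator B x *\<^sub>R e))"
        unfolding integral_lebesgue_on_eq[OF \<Omega>l] ..
      also have "\<dots> = 0"
      proof (cases "B = {}")
        case False
        then have "cbox l' u' = closure B" unfolding B_def by (rule closure_box[symmetric])
        also have "\<dots> \<subseteq> cbox a b" using B(2) by (rule closure_minimal) (rule closed_cbox)
        finally have cB: "cbox l' u' \<subseteq> cbox a b" .
        have "(\<lambda>n. LINT x|lebesgue_on \<Omega>. w x \<bullet> (box_bump l' u' n x *\<^sub>R e))
            \<longlonglongrightarrow> (LINT x|lebesgue_on \<Omega>. w x \<bullet> (indicator B x *\<^sub>R e))"
        proof (rule integral_dominated_convergence[where w="\<lambda>x. \<bar>w x \<bullet> v x\<bar>"])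
          show "integrable (lebesgue_on \<Omega>) (\<lambda>x. \<bar>w x \<bullet> v x\<bar>)"
            using L2_inner_integrable[OF wL v] by simp
          show "(\<lambda>x. w x \<bullet> (indicator B x *\<^sub>R e)) \<in> borel_measurable (lebesgue_on \<Omega>)"
          proof -
            have "(\<lambda>x. indicator B x *\<^sub>R e) \<in> borel_measurable (lebesgue_on \<Omega>)"
              unfolding B_def by (intro measurable_restrict_space1 measurable_completion) auto
            then show ?thesis using L2_measurable[OF wL] by measurable
          qed
          show "(\<lambda>x. w x \<bullet> (box_bump l' u' n x *\<^sub>R e)) \<in> borel_measurable (lebesgue_on \<Omega>)" for n
          proof -
            have "continuous_on UNIV (\<lambda>x. box_bump l' u' n x *\<^sub>R e)"
              using Ck_flat_generated[OF flat_generated_box_bump, of 0 l' u' n e] by simp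
            then have "(\<lambda>x. box_bump l' u' n x *\<^sub>R e) \<in> borel_measurable (lebesgue_on \<Omega>)"
              by (intro measurable_restrict_space1 measurable_completion) (simp add: borel_measurable_continuous_onI)
            then show ?thesis using L2_measurable[OF wL] by measurable
          qed
          show "AE x in lebesgue_on \<Omega>. (\<lambda>n. w x \<bullet> (box_bump l' u' n x *\<^sub>R e)) \<longlonglongrightarrow> w x \<bullet> (indicator B x *\<^sub>R e)"
            unfolding B_def by (intro AE_I2 tendsto_intros box_bump_tendsto)
          show "AE x in lebesgue_on \<Omega>. norm (w x \<bullet> (box_bump l' u' n x *\<^sub>R e)) \<le> \<bar>w x \<bullet> v x\<bar>" for n
          proof (rule AE_I2)
            fix x
            show "norm (w x \<bullet> (box_bump l' u' n x *\<^sub>R e)) \<le> \<bar>w x \<bullet> v x\<bar>"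
            proof (cases "x \<in> cbox a b")
              case True
              then show ?thesis
                using box_bump_bounds[of l' u' n x] mult_right_mono[of "box_bump l' u' n x" 1 "\<bar>w x \<bullet> e\<bar>"]
                by (simp add: v_def abs_mult)
            next
              case False
              then have "box_bump l' u' n x = 0"
                using box_bump_nonzero[of l' u' n x] B(2) by (auto simp: B_def)
              then show ?thesis by simp
            qed
          qed
        qed
        moreover have "(LINT x|lebesgue_on \<Omega>. w x \<bullet> (box_bump l' u' n x *\<^sub>R e)) = 0" for n
          by (rule 0[OF box_bump_test_field]) (use cB ab in auto)
        ultimately show ?thesis by (simp add: LIMSEQ_const_iff)
      qed simp
      finally show ?thesis .
    qed
    then have "AE x in lborel. g x = 0" by (rule AE_0_if_box_integrals_0[OF gi])
    with g(2) show ?thesis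
      by eventually_elim (use ab in \<open>auto simp: f_def v_def\<close>)
  qed
  obtain \<D> where \<D>: "countable \<D>" "\<D> \<subseteq> Pow \<Omega>" "\<And>X. X \<in> \<D> \<Longrightarrow> \<exists>a b. X = cbox a b" "\<Union>\<D> = \<Omega>"
    using open_countable_Union_open_cbox[OF \<Omega>] by blast
  have "AE x in lborel. \<forall>X\<in>\<D>. \<forall>e\<in>Basis. x \<in> X \<longrightarrow> w x \<bullet> e = 0"
  proof (subst AE_ball_countable[OF \<D>(1)], rule ballI)
    fix X assume X: "X \<in> \<D>"
    then obtain a b where ab: "X = cbox a b" using \<D>(3) by blast
    then have "cbox a b \<subseteq> \<Omega>" using X \<D>(2) by auto
    then have "\<forall>e\<in>Basis. AE x in lborel. x \<in> X \<longrightarrow> w x \<bullet> e = 0" using box0 ab by auto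
    then show "AE x in lborel. \<forall>e\<in>Basis. x \<in> X \<longrightarrow> w x \<bullet> e = 0"
      by (subst AE_finite_all) auto
  qed
  then show ?thesis unfolding AE_lebesgue_on_iff[OF \<Omega>l]
  proof eventually_elim
    case (elim x)
    show ?case
    proof
      assume "x \<in> \<Omega>"
      then obtain X where "X \<in> \<D>" "x \<in> X" using \<D>(4) by blast
      then have "w x \<bullet> e = 0 \<bullet> e" if "e \<in> Basis" for e
        using bspec[OF bspec[OF elim \<open>X \<in> \<D>\<close>] that] by simp
      then show "w x = 0" by (rule euclidean_eqI)
    qed
  qed
qed

section \<open>Weak curls and integration by parts\<close>

lemma integrable_compact_support:
  fixes f :: "'a::euclidean_space \<Rightarrow> 'b::euclidean_space"
  assumes f: "continuous_on UNIV f" and K: "compact K" "\<And>x. x \<notin> K \<Longrightarrow> f x = 0"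
  shows "integrable lborel f"
proof -
  have "integrable lborel (\<lambda>x. indicator K x *\<^sub>R f x)"
    using borel_integrable_compact[OF K(1) continuous_on_subset[OF f]] by simp
  moreover have "(\<lambda>x. indicator K x *\<^sub>R f x) = f"
    using K(2) by (auto simp: indicator_def fun_eq_iff)
  ultimately show ?thesis by simp
qed

lemma lborel_integral_translate:
  fixes f :: "'a::euclidean_space \<Rightarrow> real"
  assumes "f \<in> borel_measurable borel"
  shows "(LINT x|lborel. f (c + x)) = integral\<^sup>L lborel f"
proof -
  have "integral\<^sup>L (distr lborel borel ((+) c)) f = (LINT x|lborel. f (c + x))"
    by (rule integral_distr) (use assms in auto)
  then show ?thesis by (simp add: lborel_distr_plus)
qed

text \<open>
  The integrals of the difference quotients vanish by translation invariance, and the difference quotients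
  are dominated by the mean value theorem.
\<close>

lemma integral_derivative_compact_support:
  fixes f :: "'a::euclidean_space \<Rightarrow> real"
  assumes f': "\<And>x. (f has_derivative f' x) (at x)" and D: "continuous_on UNIV (\<lambda>x. f' x b)"
    and K: "compact K" "\<And>x. x \<notin> K \<Longrightarrow> f x = 0"
  shows "(LINT x|lborel. f' x b) = 0"
proof -
  have f: "continuous_on UNIV f"
    using f' by (meson continuous_at_imp_continuous_on has_derivative_continuous)
  have fi: "integrable lborel f" by (rule integrable_compact_support[OF f K])
  have D0: "f' x b = 0" if "x \<notin> K" for x
  proof -
    have "((\<lambda>x. 0::real) has_derivative f' x) (at x)"
      by (rule has_derivative_transform_within_open[OF f', of "- K"])
        (use K that compact_imp_closed in auto)
    then have "f' x = (\<lambda>x. 0)" using has_derivative_unique has_derivative_const by blast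
    then show ?thesis by simp
  qed
  have "bounded ((\<lambda>x. f' x b) ` K)"
    by (intro compact_imp_bounded compact_continuous_image continuous_on_subset[OF D] K) auto
  then obtain M where M: "\<And>x. x \<in> K \<Longrightarrow> \<bar>f' x b\<bar> \<le> M" and M0: "0 \<le> M"
    by (auto simp: bounded_iff) (metis abs_ge_zero norm_ge_zero order_trans abs_le_D1 le_max_iff_disj max.cobounded1 max.cobounded2)
  then have M: "\<bar>f' x b\<bar> \<le> M" for x using D0[of x] by (cases "x \<in> K") auto
  \<comment> \<open>All points from which the segment in direction \<open>b\<close> meets \<open>K\<close>: outside \<open>K1\<close> the difference quotients vanish.\<close>
  define K1 where "K1 = (\<lambda>(s, x). x - s *\<^sub>R b) ` ({0..1::real} \<times> K)"
  have K1: "compact K1" unfolding K1_def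
    by (intro compact_continuous_image compact_Times K compact_Icc)
      (auto simp: case_prod_unfold intro!: continuous_intros)
  have K1m: "x \<in> K1" if "x + s *\<^sub>R b \<in> K" "0 \<le> s" "s \<le> 1" for s x
    unfolding K1_def using that by (intro image_eqI[of _ _ "(s, x + s *\<^sub>R b)"]) auto
  define q where "q n x = (f ((inverse (real (Suc n)) *\<^sub>R b) + x) - f x) / inverse (real (Suc n))" for n x
  have path: "((\<lambda>s. f (x + s *\<^sub>R b)) has_real_derivative f' (x + s *\<^sub>R b) b) (at s)" for x s
  proof -
    have "((\<lambda>s. f (x + s *\<^sub>R b)) has_derivative (\<lambda>h. f' (x + s *\<^sub>R b) (h *\<^sub>R b))) (at s)"
      by (rule has_derivative_compose[OF _ f', of "\<lambda>s. x + s *\<^sub>R b" "\<lambda>h. h *\<^sub>R b"])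
        (auto intro!: derivative_eq_intros)
    then show ?thesis
      using linear_scale[OF has_derivative_linear[OF f']]
      by (simp add: has_field_derivative_def mult_commute_abs)
  qed
  have "(\<lambda>n. LINT x|lborel. q n x) \<longlonglongrightarrow> (LINT x|lborel. f' x b)"
  proof (rule integral_dominated_convergence[where w="\<lambda>x. indicat_real K1 x * M"])
    show "(\<lambda>x. f' x b) \<in> borel_measurable lborel" using borel_measurable_continuous_onI[OF D] by simp
    show "q n \<in> borel_measurable lborel" for n
    proof -
      have "continuous_on UNIV (q n)" unfolding q_def
        by (intro continuous_intros continuous_on_compose2[OF f]) auto
      then show ?thesis using borel_measurable_continuous_onI by simp
    qed
    show "integrable lborel (\<lambda>x. indicat_real K1 x * M)"
      by (rule integrable_mult_left, rule integrable_real_indicator)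
        (use K1 emeasure_compact_finite[OF K1] in \<open>auto simp: borel_compact\<close>)
    show "AE x in lborel. (\<lambda>n. q n x) \<longlonglongrightarrow> f' x b"
    proof (rule AE_I2)
      fix x
      have "((\<lambda>h. (f (x + h *\<^sub>R b) - f x) / h) \<longlongrightarrow> f' x b) (at 0)"
        using path[of x 0] by (simp add: DERIV_def)
      then have "(\<lambda>n. (f (x + inverse (real (Suc n)) *\<^sub>R b) - f x) / inverse (real (Suc n))) \<longlonglongrightarrow> f' x b"
        by (rule filterlim_compose) (auto simp: filterlim_at LIMSEQ_inverse_real_of_nat simp del: of_nat_Suc)
      then show "(\<lambda>n. q n x) \<longlonglongrightarrow> f' x b" by (simp add: q_def add.commute)
    qed
    show "AE x in lborel. norm (q n x) \<le> indicat_real K1 x * M" for n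
    proof (rule AE_I2)
      fix x
      define h where "h = inverse (real (Suc n))"
      have h: "0 < h" "h \<le> 1" by (auto simp: h_def inverse_le_1_iff)
      obtain s where s: "0 < s" "s < h" "f (x + h *\<^sub>R b) - f (x + 0 *\<^sub>R b) = (h - 0) * f' (x + s *\<^sub>R b) b"
        using MVT2[OF h(1), of "\<lambda>s. f (x + s *\<^sub>R b)" "\<lambda>s. f' (x + s *\<^sub>R b) b"] path by auto
      have "q n x = (f (x + h *\<^sub>R b) - f x) / h" unfolding q_def h_def by (simp add: add.commute)
      then have q: "q n x = f' (x + s *\<^sub>R b) b" using h s(3) by simp
      show "norm (q n x) \<le> indicat_real K1 x * M"
      proof (cases "x \<in> K1")
        case True then show ?thesis using M q by simp
      next
        case False
        then have "x + s *\<^sub>R b \<notin> K" using K1m s h by (meson less_imp_le order_trans)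
        then show ?thesis using q D0 M0 by simp
      qed
    qed
  qed
  moreover have "(LINT x|lborel. q n x) = 0" for n
  proof -
    have fm: "f \<in> borel_measurable borel" using borel_measurable_continuous_onI[OF f] .
    have fi': "integrable lborel (\<lambda>x. f (c + x))" for c
    proof -
      have "integrable (distr lborel borel ((+) c)) f" using fi by (simp add: lborel_distr_plus)
      then show ?thesis by (subst (asm) integrable_distr_eq) (use fm in auto)
    qed
    have "(LINT x|lborel. q n x) = ((LINT x|lborel. f (inverse (real (Suc n)) *\<^sub>R b + x)) - integral\<^sup>L lborel f) / inverse (real (Suc n))"
      unfolding q_def using fi fi' by (simp del: of_nat_Suc)
    then show ?thesis by (simp add: lborel_integral_translate[OF fm])
  qed
  ultimately show ?thesis by (simp add: LIMSEQ_const_iff)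
qed

lemma test_fieldsD:
  assumes "\<phi> \<in> test_fields S"
  shows "continuous_on UNIV \<phi>" and "\<And>x. \<phi> differentiable at x"
    and "\<And>b. b \<in> Basis \<Longrightarrow> continuous_on UNIV (\<lambda>x. frechet_derivative \<phi> (at x) b)"
    and "\<exists>K. compact K \<and> K \<subseteq> S \<and> (\<forall>x. x \<notin> K \<longrightarrow> \<phi> x = 0 \<and> frechet_derivative \<phi> (at x) = (\<lambda>v. 0))"
proof -
  have C: "Ck k \<phi>" for k using assms by (simp add: test_fields_def)
  show "continuous_on UNIV \<phi>" using C[of 0] by simp
  show "\<And>x. \<phi> differentiable at x" using C[of "Suc 0"] by simp
  show "\<And>b. b \<in> Basis \<Longrightarrow> continuous_on UNIV (\<lambda>x. frechet_derivative \<phi> (at x) b)"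
    using C[of "Suc 0"] by simp
  define K where "K = closure {x. \<phi> x \<noteq> 0}"
  have K: "compact K" "K \<subseteq> S" using assms by (auto simp: test_fields_def K_def)
  have K0: "\<phi> x = 0" if "x \<notin> K" for x using that closure_subset[of "{x. \<phi> x \<noteq> 0}"] by (auto simp: K_def)
  have "frechet_derivative \<phi> (at x) = (\<lambda>v. 0)" if "x \<notin> K" for x
  proof -
    have "((\<lambda>x. 0) has_derivative (\<lambda>v. 0)) (at x)" by simp
    then have "(\<phi> has_derivative (\<lambda>v. 0)) (at x)"
      by (rule has_derivative_transform_within_open[of _ _ _ _ "- K"])
        (use K K0 that compact_imp_closed in auto)
    then show ?thesis by (metis frechet_derivative_at)
  qed
  then show "\<exists>K. compact K \<and> K \<subseteq> S \<and> (\<forall>x. x \<notin> K \<longrightarrow> \<phi> x = 0 \<and> frechet_derivative \<phi> (at x) = (\<lambda>v. 0))"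
    using K K0 by blast
qed

lemma L2_compact_support:
  fixes f :: "'a::euclidean_space \<Rightarrow> real^3"
  assumes f: "continuous_on UNIV f" and K: "compact K" "\<And>x. x \<notin> K \<Longrightarrow> f x = 0" and S: "S \<in> sets lebesgue"
  shows "f \<in> L2 (lebesgue_on S)"
proof -
  have m: "f \<in> borel_measurable (lebesgue_on S)"
    using borel_measurable_continuous_onI[OF f] by (intro measurable_restrict_space1 measurable_completion) simp
  have "integrable lborel (\<lambda>x. (norm (f x))\<^sup>2)"
    by (rule integrable_compact_support[OF _ K(1)]) (use K(2) f in \<open>auto intro!: continuous_intros\<close>)
  then have "integrable lebesgue (\<lambda>x. (norm (f x))\<^sup>2)"
    by (simp add: integrable_completion)
  then have "integrable (lebesgue_on S) (\<lambda>x. (norm (f x))\<^sup>2)"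
    using S by (intro integrable_restrict_space[THEN iffD2] integrable_mult_indicator) auto
  then show ?thesis using m by (simp add: L2_def)
qed

lemma test_fields_L2:
  assumes "\<phi> \<in> test_fields S'" "S \<in> sets lebesgue" shows "\<phi> \<in> L2 (lebesgue_on S)"
  using test_fieldsD[OF assms(1)] by (metis L2_compact_support assms(2))

lemma test_fields_derivative_L2:
  assumes "\<phi> \<in> test_fields S'" "S \<in> sets lebesgue" "b \<in> Basis"
  shows "(\<lambda>x. frechet_derivative \<phi> (at x) b) \<in> L2 (lebesgue_on S)"
proof -
  obtain K where "compact K" "\<And>x. x \<notin> K \<Longrightarrow> frechet_derivative \<phi> (at x) = (\<lambda>v. 0)"
    using test_fieldsD(4)[OF assms(1)] by blast
  then show ?thesis
    by (intro L2_compact_support[OF test_fieldsD(3)[OF assms(1,3)] _ _ assms(2), of K]) auto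
qed

lemma integral_lebesgue_on_support:
  fixes f :: "'a::euclidean_space \<Rightarrow> real"
  assumes S: "S \<in> sets lebesgue" and f: "f \<in> borel_measurable borel" and 0: "\<And>x. x \<notin> S \<Longrightarrow> f x = 0"
  shows "integral\<^sup>L (lebesgue_on S) f = integral\<^sup>L lborel f"
proof -
  have "(\<lambda>x. if x \<in> S then f x else 0) = f" using 0 by auto
  then show ?thesis
    unfolding integral_lebesgue_on_eq[OF S] using f by (simp add: integral_completion)
qed

lemma classical_curl_nth:
  "classical_curl \<phi> x $ 1 = pderiv_comp 2 3 \<phi> x - pderiv_comp 3 2 \<phi> x"
  "classical_curl \<phi> x $ 2 = pderiv_comp 3 1 \<phi> x - pderiv_comp 1 3 \<phi> x"
  "classical_curl \<phi> x $ 3 = pderiv_comp 1 2 \<phi> x - pderiv_comp 2 1 \<phi> x"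
  by (simp_all add: classical_curl_def)

lemma continuous_on_pderiv_comp:
  assumes "\<phi> \<in> test_fields S" shows "continuous_on UNIV (pderiv_comp i k \<phi>)"
  unfolding pderiv_comp_def[abs_def]
  by (intro continuous_intros test_fieldsD(3)[OF assms]) simp

lemma continuous_on_classical_curl:
  assumes "\<phi> \<in> test_fields S" shows "continuous_on UNIV (classical_curl \<phi>)"
proof (subst continuous_on_componentwise, rule ballI)
  fix b :: "real^3" assume "b \<in> Basis"
  then obtain i where b: "b = axis i 1" by (auto simp: Basis_vec_def)
  have "continuous_on UNIV (\<lambda>x. classical_curl \<phi> x $ i)"
  proof -
    consider "i = 1" | "i = 2" | "i = 3" using exhaust_3[of i] by blast
    then show ?thesis
      by cases (simp_all add: classical_curl_nth continuous_on_diff continuous_on_pderiv_comp[OF assms])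
  qed
  then show "continuous_on UNIV (\<lambda>x. classical_curl \<phi> x \<bullet> b)" by (simp add: b inner_axis)
qed

lemma classical_curl_L2:
  assumes "\<phi> \<in> test_fields S'" "S \<in> sets lebesgue" shows "classical_curl \<phi> \<in> L2 (lebesgue_on S)"
proof -
  obtain K where "compact K" "\<And>x. x \<notin> K \<Longrightarrow> frechet_derivative \<phi> (at x) = (\<lambda>v. 0)"
    using test_fieldsD(4)[OF assms(1)] by blast
  then show ?thesis
    by (intro L2_compact_support[OF continuous_on_classical_curl[OF assms(1)] _ _ assms(2), of K])
      (auto simp: vec_eq_iff forall_3 classical_curl_nth pderiv_comp_def)
qed

lemma test_fields_pderiv_ibp:
  assumes \<phi>: "\<phi> \<in> test_fields S" and \<eta>: "\<eta> \<in> test_fields S"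
  shows "integrable lborel (\<lambda>x. \<phi> x $ k * pderiv_comp i l \<eta> x)"
    and "(LINT x|lborel. \<phi> x $ k * pderiv_comp i l \<eta> x) = - (LINT x|lborel. pderiv_comp i k \<phi> x * \<eta> x $ l)"
proof -
  obtain K where K: "compact K" "\<And>x. x \<notin> K \<Longrightarrow> \<phi> x = 0" "\<And>x. x \<notin> K \<Longrightarrow> frechet_derivative \<phi> (at x) = (\<lambda>v. 0)"
    using test_fieldsD(4)[OF \<phi>] by blast
  have i1: "integrable lborel (\<lambda>x. \<phi> x $ k * pderiv_comp i l \<eta> x)"
    by (rule integrable_compact_support[OF _ K(1)])
      (auto intro!: continuous_intros continuous_on_pderiv_comp[OF \<eta>] test_fieldsD(1)[OF \<phi>] simp: K)
  then show "integrable lborel (\<lambda>x. \<phi> x $ k * pderiv_comp i l \<eta> x)" .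
  have i2: "integrable lborel (\<lambda>x. pderiv_comp i k \<phi> x * \<eta> x $ l)"
    by (rule integrable_compact_support[OF _ K(1)])
      (intro continuous_intros continuous_on_pderiv_comp[OF \<phi>] test_fieldsD(1)[OF \<eta>],
        simp add: K pderiv_comp_def)
  have d: "((\<lambda>x. \<phi> x $ k) has_derivative (\<lambda>v. frechet_derivative \<phi> (at x) v $ k)) (at x)"
    if "\<phi> \<in> test_fields S" for \<phi> k x
    by (rule bounded_linear.has_derivative[OF bounded_linear_vec_nth])
      (use test_fieldsD(2)[OF that] frechet_derivative_works in blast)
  have ax: "axis i (1::real) \<in> (Basis :: (real^3) set)" by simp
  have "(LINT x|lborel. (\<lambda>v. \<phi> x $ k * frechet_derivative \<eta> (at x) v $ l + frechet_derivative \<phi> (at x) v $ k * \<eta> x $ l) (axis i 1)) = 0"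
  proof (rule integral_derivative_compact_support[OF has_derivative_mult[OF d[OF \<phi>] d[OF \<eta>]] _ K(1)])
    show "continuous_on UNIV (\<lambda>x. \<phi> x $ k * frechet_derivative \<eta> (at x) (axis i 1) $ l + frechet_derivative \<phi> (at x) (axis i 1) $ k * \<eta> x $ l)"
      by (intro continuous_intros test_fieldsD(1)[OF \<phi>] test_fieldsD(1)[OF \<eta>]
          test_fieldsD(3)[OF \<phi> ax] test_fieldsD(3)[OF \<eta> ax])
  qed (use K in auto)
  then show "(LINT x|lborel. \<phi> x $ k * pderiv_comp i l \<eta> x) = - (LINT x|lborel. pderiv_comp i k \<phi> x * \<eta> x $ l)"
    using i1 i2 by (simp add: pderiv_comp_def[symmetric])
qed

text \<open>
  \<open>\<phi> \<bullet> curl \<eta> - \<eta> \<bullet> curl \<phi>\<close> is a divergence; the six products of partial derivatives are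
  integrated by parts one by one.
\<close>

lemma test_fields_has_curl:
  assumes \<Omega>: "open \<Omega>" and \<phi>: "\<phi> \<in> test_fields \<Omega>"
  shows "has_curl \<Omega> \<phi> (classical_curl \<phi>)"
proof -
  have \<Omega>l: "\<Omega> \<in> sets lebesgue" using \<Omega> by auto
  have "(LINT x|lebesgue_on \<Omega>. \<phi> x \<bullet> classical_curl \<eta> x) = (LINT x|lebesgue_on \<Omega>. classical_curl \<phi> x \<bullet> \<eta> x)"
    if \<eta>: "\<eta> \<in> test_fields \<Omega>" for \<eta>
  proof -
    have 1: "(LINT x|lebesgue_on \<Omega>. \<phi> x \<bullet> classical_curl \<eta> x) = (LINT x|lborel. \<phi> x \<bullet> classical_curl \<eta> x)"
    proof (rule integral_lebesgue_on_support[OF \<Omega>l])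
      show "(\<lambda>x. \<phi> x \<bullet> classical_curl \<eta> x) \<in> borel_measurable borel"
        by (intro borel_measurable_continuous_onI continuous_intros test_fieldsD(1)[OF \<phi>] continuous_on_classical_curl[OF \<eta>])
      show "\<phi> x \<bullet> classical_curl \<eta> x = 0" if "x \<notin> \<Omega>" for x
        using test_fieldsD(4)[OF \<phi>] that by (metis inner_zero_left subsetD)
    qed
    have 2: "(LINT x|lebesgue_on \<Omega>. classical_curl \<phi> x \<bullet> \<eta> x) = (LINT x|lborel. classical_curl \<phi> x \<bullet> \<eta> x)"
    proof (rule integral_lebesgue_on_support[OF \<Omega>l])
      show "(\<lambda>x. classical_curl \<phi> x \<bullet> \<eta> x) \<in> borel_measurable borel"
        by (intro borel_measurable_continuous_onI continuous_intros test_fieldsD(1)[OF \<eta>] continuous_on_classical_curl[OF \<phi>])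
      show "classical_curl \<phi> x \<bullet> \<eta> x = 0" if "x \<notin> \<Omega>" for x
        using test_fieldsD(4)[OF \<eta>] that by (metis inner_zero_right subsetD)
    qed
    note i = test_fields_pderiv_ibp(1)[OF \<phi> \<eta>] test_fields_pderiv_ibp(1)[OF \<eta> \<phi>]
    note e = test_fields_pderiv_ibp(2)[OF \<phi> \<eta>]
    show ?thesis unfolding 1 2 unfolding inner_vec_def sum_3 classical_curl_nth
      using i e by (simp add: algebra_simps)
  qed
  then show ?thesis
    unfolding has_curl_def Hspace_def using classical_curl_L2[OF \<phi> \<Omega>l] by blast
qed

lemma has_curl_unique:
  assumes \<Omega>: "open \<Omega>" and F: "has_curl \<Omega> u F" and G: "has_curl \<Omega> u G"
  shows "AE x in lebesgue_on \<Omega>. F x = G x"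
proof -
  have \<Omega>l: "\<Omega> \<in> sets lebesgue" using \<Omega> by auto
  have FL: "F \<in> L2 (lebesgue_on \<Omega>)" and GL: "G \<in> L2 (lebesgue_on \<Omega>)"
    using F G by (auto simp: has_curl_def Hspace_def)
  have "AE x in lebesgue_on \<Omega>. F x - G x = 0"
  proof (rule fundamental_lemma[OF \<Omega>])
    show "(\<lambda>x. F x - G x) \<in> Hspace \<Omega>" using L2_diff[OF FL GL] by (simp add: Hspace_def)
    fix \<phi> assume \<phi>: "\<phi> \<in> test_fields \<Omega>"
    have L: "\<phi> \<in> L2 (lebesgue_on \<Omega>)" by (rule test_fields_L2[OF \<phi> \<Omega>l])
    show "(LINT x|lebesgue_on \<Omega>. (F x - G x) \<bullet> \<phi> x) = 0"
      using F G \<phi> L2_inner_integrable[OF FL L] L2_inner_integrable[OF GL L]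
      by (simp add: inner_diff_left has_curl_def)
  qed
  then show ?thesis by simp
qed

lemma has_curl_curl:
  assumes "has_curl \<Omega> u F" shows "has_curl \<Omega> u (curl \<Omega> u)"
  unfolding curl_def using someI[of "has_curl \<Omega> u", OF assms] .

lemma L2_inner_cong_AE:
  assumes "AE x in M. u x = u' x" "AE x in M. v x = v' x"
    "u \<in> borel_measurable M" "u' \<in> borel_measurable M" "v \<in> borel_measurable M" "v' \<in> borel_measurable M"
  shows "(LINT x|M. u x \<bullet> v x) = (LINT x|M. u' x \<bullet> (v' x :: real^3))"
  using assms by (intro integral_cong_AE) auto

text \<open>
  The constant \<open>curl\<close> selects an unknown representative of the weak curl. This lemma and the next
  one replace it by any other representative.
\<close>

lemma V0space_curl:
  assumes \<Omega>: "open \<Omega>" and u: "u \<in> V0space \<Omega>" "has_curl \<Omega> u F" and \<psi>: "\<psi> \<in> Hspace \<Omega>" "has_curl \<Omega> \<psi> G"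
  shows "(LINT x|lebesgue_on \<Omega>. F x \<bullet> \<psi> x) = (LINT x|lebesgue_on \<Omega>. u x \<bullet> G x)"
proof -
  have "\<psi> \<in> Vspace \<Omega>" using \<psi> by (auto simp: Vspace_def)
  then have "(LINT x|lebesgue_on \<Omega>. curl \<Omega> u x \<bullet> \<psi> x) = (LINT x|lebesgue_on \<Omega>. u x \<bullet> curl \<Omega> \<psi> x)"
    using u by (auto simp: V0space_def)
  moreover have "(LINT x|lebesgue_on \<Omega>. curl \<Omega> u x \<bullet> \<psi> x) = (LINT x|lebesgue_on \<Omega>. F x \<bullet> \<psi> x)"
    using has_curl_unique[OF \<Omega> has_curl_curl[OF u(2)] u(2)] has_curl_curl[OF u(2)] u(2) \<psi>
    by (intro L2_inner_cong_AE) (auto simp: has_curl_def Hspace_def L2_def)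
  moreover have "(LINT x|lebesgue_on \<Omega>. u x \<bullet> curl \<Omega> \<psi> x) = (LINT x|lebesgue_on \<Omega>. u x \<bullet> G x)"
    using has_curl_unique[OF \<Omega> has_curl_curl[OF \<psi>(2)] \<psi>(2)] has_curl_curl[OF \<psi>(2)] u \<psi>
    by (intro L2_inner_cong_AE) (auto simp: has_curl_def Hspace_def L2_def V0space_def Vspace_def)
  ultimately show ?thesis by simp
qed

lemma V0spaceI:
  assumes \<Omega>: "open \<Omega>" and u: "u \<in> Hspace \<Omega>" "has_curl \<Omega> u F"
    and 0: "\<And>\<psi> G. \<psi> \<in> Hspace \<Omega> \<Longrightarrow> has_curl \<Omega> \<psi> G \<Longrightarrow>
      (LINT x|lebesgue_on \<Omega>. F x \<bullet> \<psi> x) = (LINT x|lebesgue_on \<Omega>. u x \<bullet> G x)"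
  shows "u \<in> V0space \<Omega>"
proof -
  have "(LINT x|lebesgue_on \<Omega>. curl \<Omega> u x \<bullet> \<psi> x) = (LINT x|lebesgue_on \<Omega>. u x \<bullet> curl \<Omega> \<psi> x)"
    if "\<psi> \<in> Vspace \<Omega>" for \<psi>
  proof -
    have \<psi>: "\<psi> \<in> Hspace \<Omega>" "has_curl \<Omega> \<psi> (curl \<Omega> \<psi>)"
      using that has_curl_curl by (auto simp: Vspace_def)
    have "(LINT x|lebesgue_on \<Omega>. curl \<Omega> u x \<bullet> \<psi> x) = (LINT x|lebesgue_on \<Omega>. F x \<bullet> \<psi> x)"
      using has_curl_unique[OF \<Omega> has_curl_curl[OF u(2)] u(2)] has_curl_curl[OF u(2)] u(2) \<psi>
      by (intro L2_inner_cong_AE) (auto simp: has_curl_def Hspace_def L2_def)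
    then show ?thesis using 0[OF \<psi>] by simp
  qed
  then show ?thesis using u by (auto simp: V0space_def Vspace_def)
qed

lemma test_fields_V0space:
  assumes \<Omega>: "open \<Omega>" and \<phi>: "\<phi> \<in> test_fields \<Omega>"
  shows "\<phi> \<in> V0space \<Omega>"
proof (rule V0spaceI[OF \<Omega> _ test_fields_has_curl[OF \<Omega> \<phi>]])
  have \<Omega>l: "\<Omega> \<in> sets lebesgue" using \<Omega> by auto
  show "\<phi> \<in> Hspace \<Omega>" using test_fields_L2[OF \<phi> \<Omega>l] by (simp add: Hspace_def)
  show "(LINT x|lebesgue_on \<Omega>. classical_curl \<phi> x \<bullet> \<psi> x) = (LINT x|lebesgue_on \<Omega>. \<phi> x \<bullet> G x)"
    if "has_curl \<Omega> \<psi> G" for \<psi> G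
    using that \<phi> by (simp add: has_curl_def inner_commute)
qed

section \<open>Separated test fields\<close>

lemma QT_lebesgue: "open \<Omega> \<Longrightarrow> QT \<Omega> T \<in> sets lebesgue"
  unfolding QT_def by (simp add: open_Times borel_open)

lemma has_curl_scaleR:
  assumes "has_curl \<Omega> u F" shows "has_curl \<Omega> (\<lambda>x. c *\<^sub>R u x) (\<lambda>x. c *\<^sub>R F x)"
  using assms L2_scaleR[of F] by (auto simp: has_curl_def Hspace_def)

lemma Vspace_scaleR: "u \<in> Vspace \<Omega> \<Longrightarrow> (\<lambda>x. c *\<^sub>R u x) \<in> Vspace \<Omega>"
  unfolding Vspace_def Hspace_def using L2_scaleR has_curl_scaleR by blast

lemma V0space_scaleR:
  assumes \<Omega>: "open \<Omega>" and u: "u \<in> V0space \<Omega>" shows "(\<lambda>x. c *\<^sub>R u x) \<in> V0space \<Omega>"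
proof -
  obtain F where F: "has_curl \<Omega> u F" using u by (auto simp: V0space_def Vspace_def)
  show ?thesis
  proof (rule V0spaceI[OF \<Omega> _ has_curl_scaleR[OF F]])
    show "(\<lambda>x. c *\<^sub>R u x) \<in> Hspace \<Omega>"
      using u L2_scaleR by (auto simp: V0space_def Vspace_def Hspace_def)
  qed (use V0space_curl[OF \<Omega> u F] in simp)
qed

lemma V_norm_scaleR:
  assumes \<Omega>: "open \<Omega>" and F: "has_curl \<Omega> u F" and u: "u \<in> Hspace \<Omega>"
  shows "V_norm \<Omega> (\<lambda>x. c *\<^sub>R u x) = \<bar>c\<bar> * V_norm \<Omega> u"
proof -
  note cu = has_curl_curl[OF F] and cs = has_curl_curl[OF has_curl_scaleR[OF F]]
  have "AE x in lebesgue_on \<Omega>. curl \<Omega> (\<lambda>x. c *\<^sub>R u x) x = c *\<^sub>R curl \<Omega> u x"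
    by (rule has_curl_unique[OF \<Omega> cs has_curl_scaleR[OF cu]])
  then have ae: "AE x in lebesgue_on \<Omega>. (c *\<^sub>R u x) \<bullet> (c *\<^sub>R u x) + curl \<Omega> (\<lambda>x. c *\<^sub>R u x) x \<bullet> curl \<Omega> (\<lambda>x. c *\<^sub>R u x) x
     = c\<^sup>2 * (u x \<bullet> u x + curl \<Omega> u x \<bullet> curl \<Omega> u x)"
    by eventually_elim (simp add: algebra_simps power2_eq_square)
  have [measurable]: "u \<in> borel_measurable (lebesgue_on \<Omega>)" "curl \<Omega> u \<in> borel_measurable (lebesgue_on \<Omega>)"
    "curl \<Omega> (\<lambda>x. c *\<^sub>R u x) \<in> borel_measurable (lebesgue_on \<Omega>)"
    using u cu cs by (auto simp: has_curl_def Hspace_def L2_def)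
  have "(LINT x|lebesgue_on \<Omega>. (c *\<^sub>R u x) \<bullet> (c *\<^sub>R u x) + curl \<Omega> (\<lambda>x. c *\<^sub>R u x) x \<bullet> curl \<Omega> (\<lambda>x. c *\<^sub>R u x) x)
     = (LINT x|lebesgue_on \<Omega>. c\<^sup>2 * (u x \<bullet> u x + curl \<Omega> u x \<bullet> curl \<Omega> u x))"
    by (rule integral_cong_AE[OF _ _ ae]) measurable
  then show ?thesis by (simp add: V_norm_def real_sqrt_mult)
qed

lemma L2_time_product:
  assumes \<Omega>: "open \<Omega>" and u: "u \<in> L2 (lebesgue_on \<Omega>)" and \<theta>: "continuous_on {0..T} \<theta>"
  shows "(\<lambda>z. \<theta> (snd z) *\<^sub>R u (fst z)) \<in> L2 (lebesgue_on (QT \<Omega> T))"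
proof -
  have uL: "(\<lambda>z. u (fst z)) \<in> L2 (lebesgue_on (QT \<Omega> T))"
    unfolding QT_def by (rule L2_lebesgue_on_fst) (use \<Omega> u emeasure_bounded_finite[of "{0<..<T}"] in auto)
  have "bounded (\<theta> ` {0..T})"
    by (intro compact_imp_bounded compact_continuous_image \<theta>) auto
  then obtain K where K: "\<And>t. t \<in> {0..T} \<Longrightarrow> \<bar>\<theta> t\<bar> \<le> K"
    unfolding bounded_iff real_norm_def by blast
  have "continuous_on (QT \<Omega> T) (\<lambda>z. \<theta> (snd z))"
    by (rule continuous_on_compose2[OF \<theta>]) (auto simp: QT_def intro: continuous_intros)
  then have "(\<lambda>z. \<theta> (snd z)) \<in> borel_measurable (lebesgue_on (QT \<Omega> T))"
    by (rule continuous_imp_measurable_on_sets_lebesgue[OF _ QT_lebesgue[OF \<Omega>]])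
  then have m: "(\<lambda>z. \<theta> (snd z) *\<^sub>R u (fst z)) \<in> borel_measurable (lebesgue_on (QT \<Omega> T))"
    using L2_measurable[OF uL] by measurable
  show ?thesis
    by (rule L2_bound[OF uL m, of K], rule AE_I2) (use K in \<open>auto simp: QT_def intro!: mult_right_mono\<close>)
qed

lemma LINT_eq_integral_Icc:
  fixes f :: "real \<Rightarrow> real"
  assumes "integrable (lebesgue_on {a<..<b}) f"
  shows "(LINT t|lebesgue_on {a<..<b}. f t) = integral {a..b} f" and "f integrable_on {a..b}"
proof -
  show "(LINT t|lebesgue_on {a<..<b}. f t) = integral {a..b} f"
    using lebesgue_integral_eq_integral[OF assms] by (simp add: integral_open_interval_real)
  have "f integrable_on {a<..<b}" using integrable_on_lebesgue_on[OF assms] by simp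
  then show "f integrable_on {a..b}" by (simp add: integrable_on_open_interval_real)
qed

lemma integrable_continuous_Ioo:
  fixes f :: "real \<Rightarrow> real"
  assumes "continuous_on {a..b} f" shows "integrable (lebesgue_on {a<..<b}) f"
proof -
  have "f absolutely_integrable_on {a..b}" by (rule absolutely_integrable_continuous_real[OF assms])
  then have "f absolutely_integrable_on {a<..<b}"
    by (rule set_integrable_subset) auto
  then show ?thesis
    by (simp add: set_integrable_def integrable_restrict_space)
qed

text \<open>
  A separated field takes values in the line spanned by \<open>u\<close>, so rounding \<open>\<theta>\<close> to multiples of \<open>1 / (n + 1)\<close>
  gives the required simple functions.
\<close>

lemma bochner_L2_time_product:
  assumes \<Omega>: "open \<Omega>" and T: "0 < T" and \<theta>: "continuous_on {0..T} \<theta>"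
    and F: "has_curl \<Omega> u F" and u: "u \<in> Hspace \<Omega>" and X: "\<And>c. (\<lambda>x. c *\<^sub>R u x) \<in> X"
  shows "(\<lambda>t x. \<theta> t *\<^sub>R u x) \<in> bochner_L2 T X (V_norm \<Omega>)"
proof -
  have \<theta>m: "\<theta> \<in> borel_measurable (lebesgue_on {0<..<T})"
    by (rule continuous_imp_measurable_on_sets_lebesgue[OF continuous_on_subset[OF \<theta>]]) auto
  have "bounded (\<theta> ` {0..T})"
    by (intro compact_imp_bounded compact_continuous_image \<theta>) auto
  then obtain K where K: "\<And>t. t \<in> {0..T} \<Longrightarrow> \<bar>\<theta> t\<bar> \<le> K"
    unfolding bounded_iff real_norm_def by blast
  define k where "k n t = \<lfloor>real (Suc n) * \<theta> t\<rfloor>" for n t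
  define s where "s n t = (\<lambda>x. (real_of_int (k n t) / real (Suc n)) *\<^sub>R u x)" for n t
  have kd: "\<bar>real_of_int (k n t) / real (Suc n) - \<theta> t\<bar> \<le> inverse (real (Suc n))" for n t
  proof -
    have "\<bar>real_of_int (k n t) - real (Suc n) * \<theta> t\<bar> \<le> 1" unfolding k_def by linarith
    then have "\<bar>real_of_int (k n t) - real (Suc n) * \<theta> t\<bar> / real (Suc n) \<le> 1 / real (Suc n)"
      by (rule divide_right_mono) simp
    moreover have "\<bar>real_of_int (k n t) - real (Suc n) * \<theta> t\<bar> / real (Suc n) = \<bar>real_of_int (k n t) / real (Suc n) - \<theta> t\<bar>"
    proof -
      have "real_of_int (k n t) / real (Suc n) - \<theta> t = (real_of_int (k n t) - real (Suc n) * \<theta> t) / real (Suc n)"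
        by (simp add: diff_divide_distrib del: of_nat_Suc)
      then show ?thesis by (simp add: abs_divide del: of_nat_Suc)
    qed
    ultimately show ?thesis by (simp add: inverse_eq_divide)
  qed
  have fin: "finite (s n ` {0<..<T})" for n
  proof (rule finite_subset)
    show "s n ` {0<..<T} \<subseteq> (\<lambda>i x. (real_of_int i / real (Suc n)) *\<^sub>R u x) ` {- \<lceil>real (Suc n) * K\<rceil> - 1..\<lceil>real (Suc n) * K\<rceil>}"
    proof safe
      fix t assume t: "t \<in> {0<..<T}"
      then have "\<bar>real (Suc n) * \<theta> t\<bar> \<le> real (Suc n) * K"
        using K[of t] by (simp add: abs_mult mult_left_mono)
      then have "k n t \<in> {- \<lceil>real (Suc n) * K\<rceil> - 1..\<lceil>real (Suc n) * K\<rceil>}"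
        unfolding k_def by (simp del: of_nat_Suc) linarith
      then show "s n t \<in> (\<lambda>i x. (real_of_int i / real (Suc n)) *\<^sub>R u x) ` {- \<lceil>real (Suc n) * K\<rceil> - 1..\<lceil>real (Suc n) * K\<rceil>}"
        unfolding s_def by blast
    qed
  qed simp
  have meas: "{t\<in>{0<..<T}. s n t = v} \<in> sets lebesgue" for n v
  proof -
    have "k n \<in> measurable (lebesgue_on {0<..<T}) (count_space UNIV)"
      unfolding k_def by (rule measurable_compose[OF _ measurable_real_floor]) (use \<theta>m in measurable)
    then have "k n -` {i. (\<lambda>x. (real_of_int i / real (Suc n)) *\<^sub>R u x) = v} \<inter> space (lebesgue_on {0<..<T}) \<in> sets (lebesgue_on {0<..<T})"
      by (rule measurable_sets) simp
    moreover have "k n -` {i. (\<lambda>x. (real_of_int i / real (Suc n)) *\<^sub>R u x) = v} \<inter> space (lebesgue_on {0<..<T}) = {t\<in>{0<..<T}. s n t = v}"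
      by (auto simp: s_def)
    ultimately show ?thesis by (simp add: sets_restrict_space_iff)
  qed
  have lim: "(\<lambda>n. V_norm \<Omega> (\<lambda>x. s n t x - \<theta> t *\<^sub>R u x)) \<longlonglongrightarrow> 0" for t
  proof -
    have e: "V_norm \<Omega> (\<lambda>x. s n t x - \<theta> t *\<^sub>R u x) = \<bar>real_of_int (k n t) / real (Suc n) - \<theta> t\<bar> * V_norm \<Omega> u" for n
      using V_norm_scaleR[OF \<Omega> F u, of "real_of_int (k n t) / real (Suc n) - \<theta> t"]
      by (simp add: s_def scaleR_diff_left)
    have "(\<lambda>n. real_of_int (k n t) / real (Suc n) - \<theta> t) \<longlonglongrightarrow> 0"
      by (rule Lim_null_comparison[OF _ LIMSEQ_inverse_real_of_nat]) (use kd in \<open>auto simp del: of_nat_Suc\<close>)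
    then have "(\<lambda>n. \<bar>real_of_int (k n t) / real (Suc n) - \<theta> t\<bar> * V_norm \<Omega> u) \<longlonglongrightarrow> \<bar>0\<bar> * V_norm \<Omega> u"
      by (intro tendsto_intros)
    then show ?thesis by (simp add: e)
  qed
  have int: "integrable (lebesgue_on {0<..<T}) (\<lambda>t. (V_norm \<Omega> (\<lambda>x. \<theta> t *\<^sub>R u x))\<^sup>2)"
    unfolding V_norm_scaleR[OF \<Omega> F u]
    by (intro integrable_continuous_Ioo continuous_intros \<theta>)
  have sX: "s n ` {0<..<T} \<subseteq> X" for n using X by (auto simp: s_def)
  show ?thesis
    unfolding bochner_L2_def mem_Collect_eq
    using X fin meas lim int sX by (intro conjI exI[of _ s]) auto
qed

text \<open>
  For fixed \<open>x\<close> the function \<open>\<theta>(t) \<phi>(x, t)\<close> vanishes at both end points, because the support of \<open>\<phi>\<close> is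
  a compact subset of the open cylinder; so the fundamental theorem of calculus applies on each slice.
\<close>

lemma has_time_deriv_product:
  assumes \<Omega>: "open \<Omega>" and T: "0 < T" and u: "u \<in> L2 (lebesgue_on \<Omega>)"
    and \<theta>: "\<And>t. t \<in> {0..T} \<Longrightarrow> (\<theta> has_real_derivative \<theta>' t) (at t within {0..T})"
    and \<theta>': "continuous_on {0..T} \<theta>'"
  shows "has_time_deriv \<Omega> T (\<lambda>z. \<theta> (snd z) *\<^sub>R u (fst z)) (\<lambda>z. \<theta>' (snd z) *\<^sub>R u (fst z))"
  unfolding has_time_deriv_def
proof (intro conjI ballI)
  show "(\<lambda>z. \<theta>' (snd z) *\<^sub>R u (fst z)) \<in> L2 (lebesgue_on (QT \<Omega> T))"
    by (rule L2_time_product[OF \<Omega> u \<theta>'])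
  have \<theta>c: "continuous_on {0..T} \<theta>" using \<theta> by (rule DERIV_continuous_on)
  fix \<phi> assume \<phi>: "\<phi> \<in> test_fields (QT \<Omega> T)"
  define d where "d z = frechet_derivative \<phi> (at z) (0, 1)" for z
  have B: "(0 :: real^3, 1 :: real) \<in> Basis" by (simp add: Basis_prod_def)
  have dc: "continuous_on UNIV d" unfolding d_def[abs_def] by (rule test_fieldsD(3)[OF \<phi> B])
  have dL: "d \<in> L2 (lebesgue_on (QT \<Omega> T))"
    unfolding d_def[abs_def] by (rule test_fields_derivative_L2[OF \<phi> QT_lebesgue[OF \<Omega>] B])
  have \<phi>L: "\<phi> \<in> L2 (lebesgue_on (QT \<Omega> T))" by (rule test_fields_L2[OF \<phi> QT_lebesgue[OF \<Omega>]])
  note i1 = L2_inner_integrable[OF L2_time_product[OF \<Omega> u \<theta>c] dL]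
  note i2 = L2_inner_integrable[OF L2_time_product[OF \<Omega> u \<theta>'] \<phi>L]
  define f where "f z = (\<theta> (snd z) *\<^sub>R u (fst z)) \<bullet> d z + (\<theta>' (snd z) *\<^sub>R u (fst z)) \<bullet> \<phi> z" for z
  have f: "integrable (lebesgue_on (\<Omega> \<times> {0<..<T})) f"
    using i1 i2 unfolding f_def QT_def[symmetric] by simp
  have slice: "(LINT t|lebesgue_on {0<..<T}. f (x, t)) = 0" for x
  proof -
    have \<phi>d: "((\<lambda>t. \<phi> (x, t)) has_vector_derivative d (x, t)) (at t within {0..T})" for t
    proof -
      have "(\<phi> has_derivative frechet_derivative \<phi> (at (x, t))) (at (x, t))"
        using test_fieldsD(2)[OF \<phi>] frechet_derivative_works by blast
      then have "((\<lambda>t. \<phi> (x, t)) has_derivative (\<lambda>h. frechet_derivative \<phi> (at (x, t)) (0, h))) (at t)"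
        by (rule has_derivative_compose[rotated]) (auto intro!: derivative_eq_intros)
      moreover have "frechet_derivative \<phi> (at (x, t)) (0, h) = h *\<^sub>R d (x, t)" for h
        using linear_scale[OF linear_frechet_derivative[OF test_fieldsD(2)[OF \<phi>]], of "(x,t)" h "(0, 1)"]
        by (simp add: d_def)
      ultimately show ?thesis
        by (simp add: has_vector_derivative_def has_derivative_at_withinI)
    qed
    have p': "((\<lambda>t. u x \<bullet> (\<theta> t *\<^sub>R \<phi> (x, t))) has_vector_derivative f (x, t)) (at t within {0..T})"
      if "t \<in> {0..T}" for t
    proof -
      have "((\<lambda>t. \<theta> t *\<^sub>R \<phi> (x, t)) has_vector_derivative (\<theta> t *\<^sub>R d (x, t) + \<theta>' t *\<^sub>R \<phi> (x, t))) (at t within {0..T})"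
        by (rule has_vector_derivative_scaleR[OF \<theta>[OF that] \<phi>d])
      from bounded_linear.has_vector_derivative[OF bounded_linear_inner_right this, of "u x"]
      show ?thesis by (simp add: f_def inner_add_right)
    qed
    have z: "\<phi> (x, 0) = 0" "\<phi> (x, T) = 0"
    proof -
      obtain K where K: "K \<subseteq> QT \<Omega> T" "\<And>z. z \<notin> K \<Longrightarrow> \<phi> z = 0"
        using test_fieldsD(4)[OF \<phi>] by blast
      then have "(x, 0) \<notin> K" "(x, T) \<notin> K" by (auto simp: QT_def)
      then show "\<phi> (x, 0) = 0" "\<phi> (x, T) = 0" using K(2) by auto
    qed
    have "((\<lambda>t. f (x, t)) has_integral u x \<bullet> (\<theta> T *\<^sub>R \<phi> (x, T)) - u x \<bullet> (\<theta> 0 *\<^sub>R \<phi> (x, 0))) {0..T}"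
      by (rule fundamental_theorem_of_calculus) (use T p' in auto)
    then have "integral {0..T} (\<lambda>t. f (x, t)) = 0" by (simp add: z integral_unique)
    moreover have "continuous_on {0..T} (\<lambda>t. f (x, t))"
      unfolding f_def fst_conv snd_conv
      by (intro continuous_intros \<theta>c \<theta>' continuous_on_compose2[OF dc] continuous_on_compose2[OF test_fieldsD(1)[OF \<phi>]]) auto
    ultimately show ?thesis using LINT_eq_integral_Icc(1)[OF integrable_continuous_Ioo] by simp
  qed
  have "integral\<^sup>L (lebesgue_on (QT \<Omega> T)) f = 0"
    using Fubini_lebesgue_on(6)[OF _ _ f] \<Omega> by (simp add: slice QT_def)
  then show "(LINT z|lebesgue_on (QT \<Omega> T). (\<theta> (snd z) *\<^sub>R u (fst z)) \<bullet> frechet_derivative \<phi> (at z) (0, 1))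
      = - (LINT z|lebesgue_on (QT \<Omega> T). (\<theta>' (snd z) *\<^sub>R u (fst z)) \<bullet> \<phi> z)"
    using i1 i2 by (simp add: f_def[abs_def] d_def[symmetric])
qed

text \<open>
  These are the only space-time test fields that the proof uses.
\<close>

lemma admissible_product:
  assumes \<Omega>: "open \<Omega>" and T: "0 < T" and u: "u \<in> Hspace \<Omega>" and F: "has_curl \<Omega> u F"
    and X: "\<And>c. (\<lambda>x. c *\<^sub>R u x) \<in> X"
    and \<theta>: "\<And>t. t \<in> {0..T} \<Longrightarrow> (\<theta> has_real_derivative \<theta>' t) (at t within {0..T})"
    and \<theta>': "continuous_on {0..T} \<theta>'" and \<theta>T: "\<theta> T = 0"
  shows "admissible \<Omega> T X (\<lambda>z. \<theta> (snd z) *\<^sub>R u (fst z)) (\<lambda>z. \<theta> (snd z) *\<^sub>R F (fst z))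
    (\<lambda>z. \<theta>' (snd z) *\<^sub>R u (fst z)) (\<lambda>t x. \<theta> t *\<^sub>R u x)"
proof -
  have \<theta>c: "continuous_on {0..T} \<theta>" using \<theta> by (rule DERIV_continuous_on)
  have uL: "u \<in> L2 (lebesgue_on \<Omega>)" and FL: "F \<in> L2 (lebesgue_on \<Omega>)"
    using u F by (auto simp: has_curl_def Hspace_def)
  have "has_space_curl \<Omega> T (\<lambda>z. \<theta> (snd z) *\<^sub>R u (fst z)) (\<lambda>z. \<theta> (snd z) *\<^sub>R F (fst z))"
    unfolding has_space_curl_def using L2_time_product[OF \<Omega> FL \<theta>c] has_curl_scaleR[OF F] by simp
  moreover have "cont_rep \<Omega> T (\<lambda>z. \<theta> (snd z) *\<^sub>R u (fst z)) (\<lambda>t x. \<theta> t *\<^sub>R u x)"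
    unfolding cont_rep_def
  proof (intro conjI ballI)
    show "(\<lambda>x. \<theta> t *\<^sub>R u x) \<in> Hspace \<Omega>" for t using L2_scaleR[OF uL] by (simp add: Hspace_def)
    fix t assume t: "t \<in> {0..T}"
    have "H_norm \<Omega> (\<lambda>x. \<theta> s *\<^sub>R u x - \<theta> t *\<^sub>R u x) = \<bar>\<theta> s - \<theta> t\<bar> * L2_norm (lebesgue_on \<Omega>) u" for s
      using L2_norm_scaleR[of "lebesgue_on \<Omega>" "\<theta> s - \<theta> t" u] by (simp add: H_norm_def L2_norm_def scaleR_diff_left)
    moreover have "((\<lambda>s. \<bar>\<theta> s - \<theta> t\<bar> * L2_norm (lebesgue_on \<Omega>) u) \<longlongrightarrow> \<bar>\<theta> t - \<theta> t\<bar> * L2_norm (lebesgue_on \<Omega>) u) (at t within {0..T})"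
      using \<theta>c t by (intro tendsto_intros) (auto simp: continuous_on_def)
    ultimately show "((\<lambda>s. H_norm \<Omega> (\<lambda>x. \<theta> s *\<^sub>R u x - \<theta> t *\<^sub>R u x)) \<longlongrightarrow> 0) (at t within {0..T})"
      by simp
  qed simp
  ultimately show ?thesis
    unfolding admissible_def
    using L2_time_product[OF \<Omega> uL \<theta>c] bochner_L2_time_product[OF \<Omega> T \<theta>c F u X]
      has_time_deriv_product[OF \<Omega> T uL \<theta> \<theta>'] \<theta>T by simp
qed

section \<open>The evolution of tested weak solutions\<close>

text \<open>
  Integration by parts for an integrable \<open>k\<close>, whose primitive need not be differentiable everywhere:
  both sides integrate \<open>k(s) \<rho>(r)\<close> over the triangle \<open>s \<le> r\<close>.
\<close>

lemma Fubini_triangle: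
  fixes k \<rho> :: "real \<Rightarrow> real"
  assumes T: "0 < T" and k: "integrable (lebesgue_on {0<..<T}) k" and \<rho>: "continuous_on {0..T} \<rho>"
  shows "(LINT s|lebesgue_on {0<..<T}. integral {s..T} \<rho> * k s)
    = (LINT r|lebesgue_on {0<..<T}. \<rho> r * integral {0..r} k)"
proof -
  let ?I = "{0<..<T}"
  define f where "f z = (if fst z \<le> snd z then k (fst z) * \<rho> (snd z) else 0)" for z
  have QI: "?I \<times> ?I \<in> sets lebesgue" by (simp add: open_Times borel_open)
  have "bounded (\<rho> ` {0..T})"
    by (intro compact_imp_bounded compact_continuous_image \<rho>) auto
  then obtain B where B: "\<And>t. t \<in> {0..T} \<Longrightarrow> \<bar>\<rho> t\<bar> \<le> B"
    unfolding bounded_iff real_norm_def by blast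
  have kf: "integrable (lebesgue_on (?I \<times> ?I)) (\<lambda>z. k (fst z))"
    by (rule integrable_lebesgue_on_fst[OF _ _ _ k]) (use emeasure_bounded_finite[of ?I] in auto)
  have \<rho>m: "(\<lambda>z. \<rho> (snd z)) \<in> borel_measurable (lebesgue_on (?I \<times> ?I))"
    by (rule continuous_imp_measurable_on_sets_lebesgue[OF _ QI], rule continuous_on_compose2[OF \<rho>])
      (auto intro: continuous_intros)
  have cl: "closed {z :: real \<times> real. fst z \<le> snd z}"
    by (intro closed_Collect_le continuous_intros)
  have im: "indicat_real {z :: real \<times> real. fst z \<le> snd z} \<in> borel_measurable (lebesgue_on (?I \<times> ?I))"
    by (intro measurable_restrict_space1 measurable_completion) (use cl in auto)
  have fe: "f = (\<lambda>z. indicat_real {z. fst z \<le> snd z} z * (k (fst z) * \<rho> (snd z)))"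
    by (auto simp: f_def fun_eq_iff)
  have f: "integrable (lebesgue_on (?I \<times> ?I)) f"
  proof (rule Bochner_Integration.integrable_bound)
    show "integrable (lebesgue_on (?I \<times> ?I)) (\<lambda>z. B * \<bar>k (fst z)\<bar>)"
      using kf by simp
    show "f \<in> borel_measurable (lebesgue_on (?I \<times> ?I))"
      unfolding fe using im borel_measurable_integrable[OF kf] \<rho>m by measurable
    show "AE z in lebesgue_on (?I \<times> ?I). norm (f z) \<le> norm (B * \<bar>k (fst z)\<bar>)"
    proof (rule AE_I2)
      fix z assume "z \<in> space (lebesgue_on (?I \<times> ?I))"
      then have "\<bar>\<rho> (snd z)\<bar> \<le> B" using B by auto
      then have "\<bar>k (fst z)\<bar> * \<bar>\<rho> (snd z)\<bar> \<le> \<bar>B\<bar> * \<bar>k (fst z)\<bar>"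
        by (subst mult.commute) (intro mult_right_mono, auto)
      then show "norm (f z) \<le> norm (B * \<bar>k (fst z)\<bar>)" by (simp add: f_def abs_mult)
    qed
  qed
  have s1: "(LINT r|lebesgue_on ?I. f (s, r)) = integral {s..T} \<rho> * k s" if s: "s \<in> ?I" for s
  proof -
    have i: "integrable (lebesgue_on ?I) (\<lambda>r. if s \<le> r then \<rho> r else 0)"
    proof (rule Bochner_Integration.integrable_bound[OF integrable_continuous_Ioo[OF \<rho>]])
      have "(\<lambda>r. indicat_real {s..} r * \<rho> r) \<in> borel_measurable (lebesgue_on ?I)"
        by (rule borel_measurable_times[OF _ borel_measurable_integrable[OF integrable_continuous_Ioo[OF \<rho>]]])
          (intro measurable_restrict_space1 measurable_completion, simp)
      moreover have "(\<lambda>r. indicat_real {s..} r * \<rho> r) = (\<lambda>r. if s \<le> r then \<rho> r else 0)"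
        by auto
      ultimately show "(\<lambda>r. if s \<le> r then \<rho> r else 0) \<in> borel_measurable (lebesgue_on ?I)" by simp
    qed auto
    have "(LINT r|lebesgue_on ?I. f (s, r)) = (LINT r|lebesgue_on ?I. k s * (if s \<le> r then \<rho> r else 0))"
      by (rule Bochner_Integration.integral_cong) (auto simp: f_def)
    also have "\<dots> = k s * integral {0..T} (\<lambda>r. if r \<in> {s..} then \<rho> r else 0)"
      using LINT_eq_integral_Icc(1)[OF i] by simp
    also have "integral {0..T} (\<lambda>r. if r \<in> {s..} then \<rho> r else 0) = integral ({s..} \<inter> {0..T}) \<rho>"
      by (rule integral_restrict_Int)
    also have "{s..} \<inter> {0..T} = {s..T}" using s by auto
    finally show ?thesis by simp
  qed
  have s2: "(LINT s|lebesgue_on ?I. f (s, r)) = \<rho> r * integral {0..r} k" if r: "r \<in> ?I" for r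
  proof -
    have i: "integrable (lebesgue_on ?I) (\<lambda>s. if s \<le> r then k s else 0)"
    proof (rule Bochner_Integration.integrable_bound[OF k])
      have "(\<lambda>s. indicat_real {..r} s * k s) \<in> borel_measurable (lebesgue_on ?I)"
        by (rule borel_measurable_times[OF _ borel_measurable_integrable[OF k]])
          (intro measurable_restrict_space1 measurable_completion, simp)
      moreover have "(\<lambda>s. indicat_real {..r} s * k s) = (\<lambda>s. if s \<le> r then k s else 0)"
        by auto
      ultimately show "(\<lambda>s. if s \<le> r then k s else 0) \<in> borel_measurable (lebesgue_on ?I)" by simp
    qed auto
    have "(LINT s|lebesgue_on ?I. f (s, r)) = (LINT s|lebesgue_on ?I. \<rho> r * (if s \<le> r then k s else 0))"
      by (rule Bochner_Integration.integral_cong) (auto simp: f_def)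
    also have "\<dots> = \<rho> r * integral {0..T} (\<lambda>s. if s \<in> {..r} then k s else 0)"
      using LINT_eq_integral_Icc(1)[OF i] by simp
    also have "integral {0..T} (\<lambda>s. if s \<in> {..r} then k s else 0) = integral ({..r} \<inter> {0..T}) k"
      by (rule integral_restrict_Int)
    also have "{..r} \<inter> {0..T} = {0..r}" using r by auto
    finally show ?thesis .
  qed
  have "(LINT s|lebesgue_on ?I. integral {s..T} \<rho> * k s) = (LINT s|lebesgue_on ?I. LINT r|lebesgue_on ?I. f (s, r))"
    by (rule Bochner_Integration.integral_cong) (simp_all add: s1)
  also have "\<dots> = (LINT r|lebesgue_on ?I. LINT s|lebesgue_on ?I. f (s, r))"
    by (rule trans[OF Fubini_lebesgue_on(6)[OF _ _ f] Fubini_lebesgue_on(3)[OF _ _ f, symmetric]]) simp_all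
  also have "\<dots> = (LINT r|lebesgue_on ?I. \<rho> r * integral {0..r} k)"
    by (rule Bochner_Integration.integral_cong) (simp_all add: s2)
  finally show ?thesis .
qed

text \<open>
  Taking for \<open>-\<theta>'\<close> the defect \<open>\<rho>\<close> of the claimed identity, the weak formulation becomes
  \<open>\<integral> \<rho>\<^sup>2 = 0\<close>, and \<open>\<rho>\<close> is continuous.
\<close>

lemma du_Bois_Reymond:
  fixes k \<alpha> :: "real \<Rightarrow> real"
  assumes T: "0 < T" and k: "integrable (lebesgue_on {0<..<T}) k" and \<alpha>: "continuous_on {0..T} \<alpha>"
    and weak: "\<And>\<theta> \<theta>'. (\<And>t. t \<in> {0..T} \<Longrightarrow> (\<theta> has_real_derivative \<theta>' t) (at t within {0..T})) \<Longrightarrow>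
      continuous_on {0..T} \<theta>' \<Longrightarrow> \<theta> T = 0 \<Longrightarrow>
      - (LINT t|lebesgue_on {0<..<T}. \<theta>' t * \<alpha> t) + (LINT t|lebesgue_on {0<..<T}. \<theta> t * k t) = \<theta> 0 * a"
    and t: "t \<in> {0..T}"
  shows "\<alpha> t = a - integral {0..t} k"
proof -
  have kI: "k integrable_on {0..T}" by (rule LINT_eq_integral_Icc(2)[OF k])
  define \<rho> where "\<rho> t = \<alpha> t - a + integral {0..t} k" for t
  have Kc: "continuous_on {0..T} (\<lambda>t. integral {0..t} k)"
    by (rule indefinite_integral_continuous_1[OF kI])
  have \<rho>: "continuous_on {0..T} \<rho>" unfolding \<rho>_def by (intro continuous_intros \<alpha> Kc)
  have \<rho>I: "\<rho> integrable_on {0..T}" by (rule integrable_continuous_real[OF \<rho>])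
  define \<theta> where "\<theta> t = integral {t..T} \<rho>" for t
  have "((\<lambda>t. integral {0..T} \<rho> - integral {0..t} \<rho>) has_real_derivative (0 - \<rho> t)) (at t within {0..T})"
    if "t \<in> {0..T}" for t
    by (intro DERIV_diff DERIV_const integral_has_real_derivative[OF \<rho> that])
  moreover have e: "\<theta> t = integral {0..T} \<rho> - integral {0..t} \<rho>" if "t \<in> {0..T}" for t
    using Henstock_Kurzweil_Integration.integral_combine[OF _ _ \<rho>I, of t] that by (simp add: \<theta>_def)
  ultimately have \<theta>d: "(\<theta> has_real_derivative - \<rho> t) (at t within {0..T})" if "t \<in> {0..T}" for t
    using has_field_derivative_transform_within[of "\<lambda>t. integral {0..T} \<rho> - integral {0..t} \<rho>" "- \<rho> t" t "{0..T}" 1 \<theta>] that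
    by simp
  have w: "- (LINT t|lebesgue_on {0<..<T}. - \<rho> t * \<alpha> t) + (LINT t|lebesgue_on {0<..<T}. \<theta> t * k t) = \<theta> 0 * a"
    by (rule weak[OF \<theta>d continuous_on_minus[OF \<rho>]]) (simp_all add: \<theta>_def)
  have c1: "continuous_on {0..T} (\<lambda>t. \<rho> t * \<alpha> t)" and c2: "continuous_on {0..T} (\<lambda>t. \<rho> t * integral {0..t} k)"
    and c3: "continuous_on {0..T} (\<lambda>t. \<rho> t * a)" and c4: "continuous_on {0..T} (\<lambda>t. \<rho> t * \<rho> t)"
    by (intro continuous_intros \<rho> \<alpha> Kc)+
  note i = c1[THEN integrable_continuous_Ioo] c2[THEN integrable_continuous_Ioo] c3[THEN integrable_continuous_Ioo]
  have "\<theta> 0 = (LINT t|lebesgue_on {0<..<T}. \<rho> t)"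
    using LINT_eq_integral_Icc(1)[OF integrable_continuous_Ioo[OF \<rho>]] by (simp add: \<theta>_def)
  then have "\<theta> 0 * a = (LINT t|lebesgue_on {0<..<T}. \<rho> t * a)" by simp
  moreover have "(LINT t|lebesgue_on {0<..<T}. \<theta> t * k t) = (LINT t|lebesgue_on {0<..<T}. \<rho> t * integral {0..t} k)"
    unfolding \<theta>_def by (rule Fubini_triangle[OF T k \<rho>])
  ultimately have "(LINT t|lebesgue_on {0<..<T}. \<rho> t * \<alpha> t) + (LINT t|lebesgue_on {0<..<T}. \<rho> t * integral {0..t} k)
     - (LINT t|lebesgue_on {0<..<T}. \<rho> t * a) = 0"
    using w by simp
  then have "(LINT t|lebesgue_on {0<..<T}. \<rho> t * \<alpha> t + \<rho> t * integral {0..t} k - \<rho> t * a) = 0"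
    using i by simp
  then have "(LINT t|lebesgue_on {0<..<T}. \<rho> t * \<rho> t) = 0"
    by (simp add: \<rho>_def algebra_simps)
  then have "integral {0..T} (\<lambda>t. \<rho> t * \<rho> t) = 0"
    using LINT_eq_integral_Icc(1)[OF c4[THEN integrable_continuous_Ioo]] by simp
  then have "((\<lambda>t. \<rho> t * \<rho> t) has_integral 0) {0..T}"
    using integrable_continuous_real[OF c4] by (metis integrable_integral)
  then have "\<rho> t * \<rho> t = 0"
    using has_integral_0_cbox_imp_0[of 0 T "\<lambda>t. \<rho> t * \<rho> t" t] c4 t T by simp
  then show ?thesis by (simp add: \<rho>_def)
qed

lemma cont_rep_L2: "cont_rep \<Omega> T m M \<Longrightarrow> t \<in> {0..T} \<Longrightarrow> M t \<in> L2 (lebesgue_on \<Omega>)"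
  by (simp add: cont_rep_def Hspace_def)

lemma cont_rep_norm_tendsto:
  assumes "cont_rep \<Omega> T m M" "t \<in> {0..T}"
  shows "((\<lambda>s. L2_norm (lebesgue_on \<Omega>) (\<lambda>x. M s x - M t x)) \<longlongrightarrow> 0) (at t within {0..T})"
  using assms unfolding cont_rep_def H_norm_def L2_norm_def by blast

lemma cont_rep_inner_continuous:
  assumes M: "cont_rep \<Omega> T m M" and \<phi>: "\<phi> \<in> L2 (lebesgue_on \<Omega>)"
  shows "continuous_on {0..T} (\<lambda>t. LINT x|lebesgue_on \<Omega>. M t x \<bullet> \<phi> x)"
  unfolding continuous_on_def
proof
  fix t assume t: "t \<in> {0..T}"
  let ?f = "\<lambda>t. LINT x|lebesgue_on \<Omega>. M t x \<bullet> \<phi> x"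
  have b: "\<bar>?f s - ?f t\<bar> \<le> L2_norm (lebesgue_on \<Omega>) (\<lambda>x. M s x - M t x) * L2_norm (lebesgue_on \<Omega>) \<phi>" if s: "s \<in> {0..T}" for s
  proof -
    have "?f s - ?f t = (LINT x|lebesgue_on \<Omega>. (M s x - M t x) \<bullet> \<phi> x)"
      using L2_inner_integrable[OF cont_rep_L2[OF M s] \<phi>] L2_inner_integrable[OF cont_rep_L2[OF M t] \<phi>]
      by (simp add: inner_diff_left)
    then show ?thesis
      using L2_Cauchy_Schwarz[OF L2_diff[OF cont_rep_L2[OF M s] cont_rep_L2[OF M t]] \<phi>] by simp
  qed
  have "((\<lambda>s. L2_norm (lebesgue_on \<Omega>) (\<lambda>x. M s x - M t x) * L2_norm (lebesgue_on \<Omega>) \<phi>) \<longlongrightarrow> 0 * L2_norm (lebesgue_on \<Omega>) \<phi>) (at t within {0..T})"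
    by (intro tendsto_intros cont_rep_norm_tendsto[OF M t])
  then have l: "((\<lambda>s. L2_norm (lebesgue_on \<Omega>) (\<lambda>x. M s x - M t x) * L2_norm (lebesgue_on \<Omega>) \<phi>) \<longlongrightarrow> 0) (at t within {0..T})"
    by simp
  have "((\<lambda>s. ?f s - ?f t) \<longlongrightarrow> 0) (at t within {0..T})"
    by (rule Lim_null_comparison[OF _ l]) (use b in \<open>auto simp: eventually_at_filter\<close>)
  then show "(?f \<longlongrightarrow> ?f t) (at t within {0..T})" by (simp add: LIM_zero_iff)
qed

lemma L2_QT_inner_integrable:
  assumes \<Omega>: "open \<Omega>" and p: "p \<in> L2 (lebesgue_on (QT \<Omega> T))" and v: "v \<in> L2 (lebesgue_on \<Omega>)"
  shows "integrable (lebesgue_on (\<Omega> \<times> {0<..<T})) (\<lambda>z. p z \<bullet> v (fst z))"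
proof -
  have "(\<lambda>z. 1 *\<^sub>R v (fst z)) \<in> L2 (lebesgue_on (QT \<Omega> T))"
    using L2_time_product[OF \<Omega> v, of T "\<lambda>t. 1"] by simp
  from L2_inner_integrable[OF p this] show ?thesis by (simp add: QT_def)
qed

lemma L2_slice_inner_integrable:
  assumes \<Omega>: "open \<Omega>" and p: "p \<in> L2 (lebesgue_on (QT \<Omega> T))" and v: "v \<in> L2 (lebesgue_on \<Omega>)"
  shows "AE t in lebesgue_on {0<..<T}. integrable (lebesgue_on \<Omega>) (\<lambda>x. p (x, t) \<bullet> v x)"
    and "integrable (lebesgue_on {0<..<T}) (\<lambda>t. LINT x|lebesgue_on \<Omega>. p (x, t) \<bullet> v x)"
  using Fubini_lebesgue_on(1,2)[OF _ _ L2_QT_inner_integrable[OF assms]] \<Omega> by auto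

lemma LINT_QT_time_product:
  assumes \<Omega>: "open \<Omega>" and p: "p \<in> L2 (lebesgue_on (QT \<Omega> T))" and v: "v \<in> L2 (lebesgue_on \<Omega>)"
    and \<theta>: "continuous_on {0..T} \<theta>"
  shows "(LINT z|lebesgue_on (QT \<Omega> T). p z \<bullet> (\<theta> (snd z) *\<^sub>R v (fst z)))
    = (LINT t|lebesgue_on {0<..<T}. \<theta> t * (LINT x|lebesgue_on \<Omega>. p (x, t) \<bullet> v x))"
  using Fubini_lebesgue_on(3)[OF _ _ L2_inner_integrable[OF p L2_time_product[OF \<Omega> v \<theta>], unfolded QT_def]] \<Omega>
  by (simp add: QT_def)

text \<open>
  The common form of the two weak equations. For Ampere's law, \<open>m = \<epsilon>e\<close>, \<open>p = -h\<close> and \<open>q\<close> is the current; for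
  Faraday's law, \<open>m = \<mu>h\<close>, \<open>p = e\<close> and \<open>q = 0\<close>. Tested with separated fields, the weak equation is a statement about the
  continuous scalar function \<open>t \<mapsto> (M(t), \<phi>)\<close>, for which \<open>du_Bois_Reymond\<close> removes the test function in time.
\<close>

lemma weak_evolution:
  assumes \<Omega>: "open \<Omega>" and T: "0 < T"
    and m: "m \<in> L2 (lebesgue_on (QT \<Omega> T))" and p: "p \<in> L2 (lebesgue_on (QT \<Omega> T))" and q: "q \<in> L2 (lebesgue_on (QT \<Omega> T))"
    and M: "cont_rep \<Omega> T m M"
    and weak: "\<And>\<Phi> G D P. admissible \<Omega> T X \<Phi> G D P \<Longrightarrow>
        - (LINT z|lebesgue_on (QT \<Omega> T). m z \<bullet> D z) + (LINT z|lebesgue_on (QT \<Omega> T). p z \<bullet> G z + q z \<bullet> \<Phi> z)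
        = (LINT x|lebesgue_on \<Omega>. m0 x \<bullet> P 0 x)"
    and \<phi>: "\<phi> \<in> Hspace \<Omega>" and F: "has_curl \<Omega> \<phi> F" and X: "\<And>c. (\<lambda>x. c *\<^sub>R \<phi> x) \<in> X" and t: "t \<in> {0..T}"
  shows "(LINT x|lebesgue_on \<Omega>. M t x \<bullet> \<phi> x) = (LINT x|lebesgue_on \<Omega>. m0 x \<bullet> \<phi> x)
    - integral {0..t} (\<lambda>s. (LINT x|lebesgue_on \<Omega>. p (x, s) \<bullet> F x) + (LINT x|lebesgue_on \<Omega>. q (x, s) \<bullet> \<phi> x))"
proof -
  have \<phi>L: "\<phi> \<in> L2 (lebesgue_on \<Omega>)" and FL: "F \<in> L2 (lebesgue_on \<Omega>)"
    using \<phi> F by (auto simp: has_curl_def Hspace_def)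
  let ?\<alpha> = "\<lambda>t. LINT x|lebesgue_on \<Omega>. M t x \<bullet> \<phi> x"
  let ?k1 = "\<lambda>s. LINT x|lebesgue_on \<Omega>. p (x, s) \<bullet> F x"
  let ?k2 = "\<lambda>s. LINT x|lebesgue_on \<Omega>. q (x, s) \<bullet> \<phi> x"
  note k1 = L2_slice_inner_integrable(2)[OF \<Omega> p FL] and k2 = L2_slice_inner_integrable(2)[OF \<Omega> q \<phi>L]
  have \<alpha>c: "continuous_on {0..T} ?\<alpha>" by (rule cont_rep_inner_continuous[OF M \<phi>L])
  have "AE t in lebesgue_on {0<..<T}. AE x in lebesgue_on \<Omega>. m (x, t) = M t x"
    using M by (simp add: cont_rep_def)
  with L2_slice_inner_integrable(1)[OF \<Omega> m \<phi>L] AE_space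
  have ae: "AE t in lebesgue_on {0<..<T}. (LINT x|lebesgue_on \<Omega>. m (x, t) \<bullet> \<phi> x) = ?\<alpha> t"
  proof eventually_elim
    case (elim t)
    then have Mt: "M t \<in> L2 (lebesgue_on \<Omega>)" by (intro cont_rep_L2[OF M]) auto
    have "AE x in lebesgue_on \<Omega>. m (x, t) \<bullet> \<phi> x = M t x \<bullet> \<phi> x"
      using elim(3) by eventually_elim simp
    then show ?case
      by (rule integral_cong_AE[OF borel_measurable_integrable[OF elim(1)]
        borel_measurable_integrable[OF L2_inner_integrable[OF Mt \<phi>L]]])
  qed
  show ?thesis
  proof (rule du_Bois_Reymond[OF T _ \<alpha>c _ t])
    show "integrable (lebesgue_on {0<..<T}) (\<lambda>s. ?k1 s + ?k2 s)" using k1 k2 by simp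
    fix \<theta> \<theta>' assume \<theta>: "\<And>t. t \<in> {0..T} \<Longrightarrow> (\<theta> has_real_derivative \<theta>' t) (at t within {0..T})"
      and \<theta>': "continuous_on {0..T} \<theta>'" and \<theta>T: "\<theta> T = 0"
    have \<theta>c: "continuous_on {0..T} \<theta>" using \<theta> by (rule DERIV_continuous_on)
    note adm = admissible_product[OF \<Omega> T \<phi> F X \<theta> \<theta>' \<theta>T]
    note pG = L2_inner_integrable[OF p L2_time_product[OF \<Omega> FL \<theta>c]]
      and qP = L2_inner_integrable[OF q L2_time_product[OF \<Omega> \<phi>L \<theta>c]]
    have "(LINT t|lebesgue_on {0<..<T}. \<theta>' t * (LINT x|lebesgue_on \<Omega>. m (x, t) \<bullet> \<phi> x))
        = (LINT t|lebesgue_on {0<..<T}. \<theta>' t * ?\<alpha> t)"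
    proof (rule integral_cong_AE)
      have \<theta>m: "\<theta>' \<in> borel_measurable (lebesgue_on {0<..<T})"
        using borel_measurable_integrable[OF integrable_continuous_Ioo[OF \<theta>']] .
      show "(\<lambda>t. \<theta>' t * (LINT x|lebesgue_on \<Omega>. m (x, t) \<bullet> \<phi> x)) \<in> borel_measurable (lebesgue_on {0<..<T})"
        by (rule borel_measurable_times[OF \<theta>m borel_measurable_integrable[OF L2_slice_inner_integrable(2)[OF \<Omega> m \<phi>L]]])
      show "(\<lambda>t. \<theta>' t * ?\<alpha> t) \<in> borel_measurable (lebesgue_on {0<..<T})"
        by (rule borel_measurable_times[OF \<theta>m borel_measurable_integrable[OF integrable_continuous_Ioo[OF \<alpha>c]]])
      show "AE t in lebesgue_on {0<..<T}. \<theta>' t * (LINT x|lebesgue_on \<Omega>. m (x, t) \<bullet> \<phi> x) = \<theta>' t * ?\<alpha> t"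
        using ae by eventually_elim simp
    qed
    then have 1: "(LINT z|lebesgue_on (QT \<Omega> T). m z \<bullet> (\<theta>' (snd z) *\<^sub>R \<phi> (fst z))) = (LINT t|lebesgue_on {0<..<T}. \<theta>' t * ?\<alpha> t)"
      unfolding LINT_QT_time_product[OF \<Omega> m \<phi>L \<theta>'] .
    have kk: "integrable (lebesgue_on {0<..<T}) (\<lambda>s. \<theta> s * ?k1 s)" "integrable (lebesgue_on {0<..<T}) (\<lambda>s. \<theta> s * ?k2 s)"
      using Fubini_lebesgue_on(2)[OF _ _ pG[unfolded QT_def]] Fubini_lebesgue_on(2)[OF _ _ qP[unfolded QT_def]] \<Omega>
      by simp_all
    have 2: "(LINT z|lebesgue_on (QT \<Omega> T). p z \<bullet> (\<theta> (snd z) *\<^sub>R F (fst z)) + q z \<bullet> (\<theta> (snd z) *\<^sub>R \<phi> (fst z)))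
        = (LINT s|lebesgue_on {0<..<T}. \<theta> s * (?k1 s + ?k2 s))"
      unfolding Bochner_Integration.integral_add[OF pG qP] distrib_left Bochner_Integration.integral_add[OF kk]
        LINT_QT_time_product[OF \<Omega> p FL \<theta>c] LINT_QT_time_product[OF \<Omega> q \<phi>L \<theta>c] ..
    show "- (LINT t|lebesgue_on {0<..<T}. \<theta>' t * ?\<alpha> t) + (LINT s|lebesgue_on {0<..<T}. \<theta> s * (?k1 s + ?k2 s))
        = \<theta> 0 * (LINT x|lebesgue_on \<Omega>. m0 x \<bullet> \<phi> x)"
      using weak[OF adm] unfolding 1 2 by simp
  qed
qed

section \<open>Time integrals of space-time fields\<close>

lemma measurable_lebesgue_on_slices:
  fixes A :: "'a::euclidean_space set" and B :: "'b::euclidean_space set" and f :: "'a \<times> 'b \<Rightarrow> 'c::euclidean_space"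
  assumes A: "A \<in> sets borel" and B: "B \<in> sets borel" and f: "f \<in> borel_measurable (lebesgue_on (A \<times> B))"
  shows "AE y in lebesgue_on B. (\<lambda>x. f (x, y)) \<in> borel_measurable (lebesgue_on A)"
    and "AE x in lebesgue_on A. (\<lambda>y. f (x, y)) \<in> borel_measurable (lebesgue_on B)"
proof -
  have AB: "A \<times> B \<in> sets lebesgue"
    using A B by (simp add: borel_Times)
  have Al: "A \<in> sets lebesgue" and Bl: "B \<in> sets lebesgue" using A B by auto
  have "(\<lambda>z. if z \<in> A \<times> B then f z else 0) \<in> borel_measurable lebesgue"
    by (rule borel_measurable_if[OF AB, THEN iffD2, OF f])
  then obtain g where g: "g \<in> borel_measurable borel" "AE z in lborel. (if z \<in> A \<times> B then f z else 0) = g z"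
    by (rule ex_borel_representative)
  have "AE z in lebesgue_on (A \<times> B). f z = g z"
    unfolding AE_lebesgue_on_iff[OF AB] using g(2) by eventually_elim auto
  note ae = AE_lebesgue_on_Times[OF A B this]
  have *: "h \<in> borel_measurable (lebesgue_on S)"
    if S: "S \<in> sets lebesgue" and h: "AE x in lebesgue_on S. h x = h' x" and h': "h' \<in> borel_measurable borel"
    for S :: "'d::euclidean_space set" and h h' :: "'d \<Rightarrow> 'c"
  proof -
    have "h' \<in> borel_measurable (lebesgue_on S)"
      by (intro measurable_restrict_space1 measurable_completion) (use h' in simp)
    moreover have "AE x in lebesgue_on S. h' x = h x" using h by eventually_elim simp
    ultimately show ?thesis by (rule borel_measurable_lebesgue_on_AE[OF S])
  qed
  show "AE y in lebesgue_on B. (\<lambda>x. f (x, y)) \<in> borel_measurable (lebesgue_on A)"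
    using ae(1)
  proof eventually_elim
    case (elim y)
    then show ?case by (rule *[OF Al]) (use g(1) in measurable)
  qed
  show "AE x in lebesgue_on A. (\<lambda>y. f (x, y)) \<in> borel_measurable (lebesgue_on B)"
    using ae(2)
  proof eventually_elim
    case (elim x)
    then show ?case by (rule *[OF Bl]) (use g(1) in measurable)
  qed
qed

lemma L2_slices:
  fixes A :: "'a::euclidean_space set" and B :: "'b::euclidean_space set"
  assumes A: "A \<in> sets borel" and B: "B \<in> sets borel" and f: "f \<in> L2 (lebesgue_on (A \<times> B))"
  shows "AE y in lebesgue_on B. (\<lambda>x. f (x, y)) \<in> L2 (lebesgue_on A)"
    and "AE x in lebesgue_on A. (\<lambda>y. f (x, y)) \<in> L2 (lebesgue_on B)"
proof -
  have i: "integrable (lebesgue_on (A \<times> B)) (\<lambda>z. (norm (f z))\<^sup>2)" using f by (simp add: L2_def)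
  show "AE y in lebesgue_on B. (\<lambda>x. f (x, y)) \<in> L2 (lebesgue_on A)"
    using measurable_lebesgue_on_slices(1)[OF A B L2_measurable[OF f]] Fubini_lebesgue_on(1)[OF A B i]
    by eventually_elim (simp add: L2_def)
  show "AE x in lebesgue_on A. (\<lambda>y. f (x, y)) \<in> L2 (lebesgue_on B)"
    using measurable_lebesgue_on_slices(2)[OF A B L2_measurable[OF f]] Fubini_lebesgue_on(4)[OF A B i]
    by eventually_elim (simp add: L2_def)
qed

lemma L2_subset:
  fixes S S' :: "'a::euclidean_space set"
  assumes "f \<in> L2 (lebesgue_on S)" "S' \<subseteq> S" "S \<in> sets lebesgue" "S' \<in> sets lebesgue"
  shows "f \<in> L2 (lebesgue_on S')"
proof -
  have "f \<in> borel_measurable (lebesgue_on S')"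
    using assms by (metis L2_measurable measurable_restrict_mono)
  moreover have "integrable (lebesgue_on S') (\<lambda>x. (norm (f x))\<^sup>2)"
    by (rule integrable_lebesgue_on_subset[OF _ assms(2-4)]) (use assms(1) in \<open>simp add: L2_def\<close>)
  ultimately show ?thesis by (simp add: L2_def)
qed

lemma L2_integrable_Ioo:
  fixes f :: "real \<Rightarrow> real^3"
  assumes "f \<in> L2 (lebesgue_on {a<..<b})" shows "integrable (lebesgue_on {a<..<b}) f"
proof (rule Bochner_Integration.integrable_bound)
  have "integrable (lebesgue_on {a<..<b}) (\<lambda>x. 1::real)"
    by (rule integrable_continuous_Ioo) simp
  then show "integrable (lebesgue_on {a<..<b}) (\<lambda>x. 1 + (norm (f x))\<^sup>2)"
    using assms by (simp add: L2_def)
  show "AE x in lebesgue_on {a<..<b}. norm (f x) \<le> norm (1 + (norm (f x))\<^sup>2)"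
  proof (rule AE_I2)
    fix x
    have "norm (f x) \<le> 1 + (norm (f x))\<^sup>2"
      using sum_squares_bound[of 1 "norm (f x)"] norm_ge_zero[of "f x"] by (simp del: norm_ge_zero)
    then show "norm (f x) \<le> norm (1 + (norm (f x))\<^sup>2)" by simp
  qed
qed (use assms in \<open>simp add: L2_def\<close>)

definition time_integral :: "tfield \<Rightarrow> real \<Rightarrow> real \<Rightarrow> vfield" where
  "time_integral f a b x = (LINT s|lebesgue_on {a<..<b}. f (x, s))"

text \<open>
  The Cauchy-Schwarz inequality in time, applied to \<open>f(x, \<cdot>)\<close> and to the constant vector
  \<open>y = time_integral f a b x\<close>.
\<close>

lemma time_integral_norm_bound:
  assumes f: "(\<lambda>s. f (x, s)) \<in> L2 (lebesgue_on {a<..<b})" and ab: "a \<le> b"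
  shows "(norm (time_integral f a b x))\<^sup>2 \<le> (b - a) * (LINT s|lebesgue_on {a<..<b}. (norm (f (x, s)))\<^sup>2)"
proof -
  define y where "y = time_integral f a b x"
  let ?M = "lebesgue_on {a<..<b}"
  have "(\<lambda>s. y) \<in> L2 ?M" using integrable_continuous_Ioo[of a b "\<lambda>s. (norm y)\<^sup>2"] by (simp add: L2_def)
  from L2_Cauchy_Schwarz[OF f this]
  have cs: "\<bar>LINT s|?M. f (x, s) \<bullet> y\<bar> \<le> L2_norm ?M (\<lambda>s. f (x, s)) * L2_norm ?M (\<lambda>s. y)" .
  have "(LINT s|?M. f (x, s) \<bullet> y) = y \<bullet> y"
    using L2_integrable_Ioo[OF f] by (simp add: y_def time_integral_def)
  moreover have "(L2_norm ?M (\<lambda>s. y))\<^sup>2 = (b - a) * (y \<bullet> y)"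
    using ab LINT_eq_integral_Icc(1)[OF integrable_continuous_Ioo[of a b "\<lambda>s. y \<bullet> y"]]
    by (simp add: L2_norm_power2)
  moreover have "(L2_norm ?M (\<lambda>s. f (x, s)))\<^sup>2 = (LINT s|?M. (norm (f (x, s)))\<^sup>2)"
    by (simp add: L2_norm_power2 power2_norm_eq_inner)
  ultimately have "(y \<bullet> y)\<^sup>2 \<le> (LINT s|?M. (norm (f (x, s)))\<^sup>2) * ((b - a) * (y \<bullet> y))"
    using power_mono[OF cs, of 2] by (simp add: power_mult_distrib)
  then have "y \<bullet> y * (y \<bullet> y) \<le> ((b - a) * (LINT s|?M. (norm (f (x, s)))\<^sup>2)) * (y \<bullet> y)"
    by (simp add: power2_eq_square mult_ac)
  then have "y \<bullet> y \<le> (b - a) * (LINT s|?M. (norm (f (x, s)))\<^sup>2)"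
  proof (cases "y = 0")
    case True
    then show ?thesis using ab by (auto intro!: mult_nonneg_nonneg integral_nonneg_AE)
  next
    case False
    then show ?thesis using \<open>y \<bullet> y * (y \<bullet> y) \<le> _\<close> by (simp add: mult_le_cancel_right)
  qed
  then show ?thesis by (simp add: y_def power2_norm_eq_inner)
qed

text \<open>
  Both facts come from Fubini's theorem for \<open>f(x, s) \<bullet> v(x)\<close>. Measurability of the time integral is recovered
  from that of its products with vectors \<open>v\<close> supported in balls, and square integrability from
  \<open>time_integral_norm_bound\<close>.
\<close>

lemma time_integral:
  assumes \<Omega>: "open \<Omega>" and f: "f \<in> L2 (lebesgue_on (QT \<Omega> T))" and ab: "0 \<le> a" "a \<le> b" "b \<le> T"
  shows time_integral_L2: "time_integral f a b \<in> L2 (lebesgue_on \<Omega>)"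
    and LINT_time_integral: "v \<in> L2 (lebesgue_on \<Omega>) \<Longrightarrow> (LINT x|lebesgue_on \<Omega>. time_integral f a b x \<bullet> v x)
      = (LINT s|lebesgue_on {a<..<b}. LINT x|lebesgue_on \<Omega>. f (x, s) \<bullet> v x)"
proof -
  let ?M = "lebesgue_on {a<..<b}" and ?N = "lebesgue_on \<Omega>"
  have \<Omega>b: "\<Omega> \<in> sets borel" and \<Omega>l: "\<Omega> \<in> sets lebesgue" and Ib: "{a<..<b} \<in> sets borel"
    using \<Omega> by auto
  have fL: "f \<in> L2 (lebesgue_on (\<Omega> \<times> {a<..<b}))"
    by (rule L2_subset[OF f]) (use ab \<Omega> in \<open>auto simp: QT_def open_Times borel_open intro!: sets_completionI_sets\<close>)
  have slice: "AE x in ?N. (\<lambda>s. f (x, s)) \<in> L2 ?M"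
    by (rule L2_slices(2)[OF \<Omega>b Ib fL])
  have fv: "integrable (lebesgue_on (\<Omega> \<times> {a<..<b})) (\<lambda>z. f z \<bullet> v (fst z))" if "v \<in> L2 ?N" for v
    by (rule L2_inner_integrable[OF fL L2_lebesgue_on_fst[OF \<Omega>b Ib _ that]])
      (use emeasure_bounded_finite[of "{a<..<b}"] in auto)
  have ae: "AE x in ?N. (LINT s|?M. f (x, s) \<bullet> v x) = time_integral f a b x \<bullet> v x" for v
    using slice
  proof eventually_elim
    case (elim x)
    then show ?case using L2_integrable_Ioo[OF elim] by (simp add: time_integral_def)
  qed
  have tm: "(\<lambda>x. time_integral f a b x \<bullet> v x) \<in> borel_measurable ?N" if v: "v \<in> L2 ?N" for v
  proof -
    have "(\<lambda>x. LINT s|?M. f (x, s) \<bullet> v x) \<in> borel_measurable ?N"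
      using borel_measurable_integrable[OF Fubini_lebesgue_on(5)[OF \<Omega>b Ib fv[OF v]]] by simp
    then show ?thesis by (rule borel_measurable_lebesgue_on_AE[OF \<Omega>l _ ae])
  qed
  have m: "time_integral f a b \<in> borel_measurable ?N"
  proof (subst borel_measurable_euclidean_space, rule ballI)
    fix e :: "real^3"
    \<comment> \<open>\<open>\<Omega>\<close> may have infinite measure, so \<open>f\<close> itself need not be integrable on the product; on balls it is.\<close>
    define w where "w n x = indicator (ball 0 (real n)) x *\<^sub>R e" for n :: nat and x :: "real^3"
    have "w n \<in> L2 ?N" for n
      unfolding w_def using emeasure_bounded_finite[of "ball 0 (real n)"] \<Omega>l by (intro L2_indicator) auto
    from tm[OF this] have mn: "(\<lambda>x. time_integral f a b x \<bullet> w n x) \<in> borel_measurable ?N" for n .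
    show "(\<lambda>x. time_integral f a b x \<bullet> e) \<in> borel_measurable ?N"
    proof (rule borel_measurable_LIMSEQ_real[OF _ mn])
      fix x :: "real^3"
      obtain N :: nat where N: "norm x < real N" using reals_Archimedean2 by blast
      have "eventually (\<lambda>n. time_integral f a b x \<bullet> w n x = time_integral f a b x \<bullet> e) sequentially"
        using eventually_ge_at_top[of N] by eventually_elim (use N in \<open>simp add: w_def\<close>)
      then show "(\<lambda>n. time_integral f a b x \<bullet> w n x) \<longlonglongrightarrow> time_integral f a b x \<bullet> e"
        by (rule tendsto_eventually)
    qed
  qed
  show "time_integral f a b \<in> L2 ?N"
  proof -
    have "integrable (lebesgue_on (\<Omega> \<times> {a<..<b})) (\<lambda>z. (norm (f z))\<^sup>2)" using fL by (simp add: L2_def)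
    note i = Fubini_lebesgue_on(5)[OF \<Omega>b Ib this]
    have "integrable ?N (\<lambda>x. (norm (time_integral f a b x))\<^sup>2)"
    proof (rule Bochner_Integration.integrable_bound)
      show "integrable ?N (\<lambda>x. (b - a) * (LINT s|?M. (norm (f (x, s)))\<^sup>2))" using i by simp
      show "AE x in ?N. norm ((norm (time_integral f a b x))\<^sup>2) \<le> norm ((b - a) * (LINT s|?M. (norm (f (x, s)))\<^sup>2))"
        using slice
      proof eventually_elim
        case (elim x)
        from time_integral_norm_bound[OF elim ab(2)] show ?case
          by (simp add: order_trans[OF _ abs_ge_self])
      qed
    next
      show "(\<lambda>x. (norm (time_integral f a b x))\<^sup>2) \<in> borel_measurable ?N"
        using m by measurable
    qed
    then show ?thesis using m by (simp add: L2_def)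
  qed
  show "(LINT x|?N. time_integral f a b x \<bullet> v x) = (LINT s|?M. LINT x|?N. f (x, s) \<bullet> v x)" if v: "v \<in> L2 ?N"
  proof -
    note F = Fubini_lebesgue_on(3,5,6)[OF \<Omega>b Ib fv[OF v]]
    have "(LINT x|?N. time_integral f a b x \<bullet> v x) = (LINT x|?N. LINT s|?M. f (x, s) \<bullet> v x)"
    proof (rule integral_cong_AE[OF tm[OF v]])
      show "(\<lambda>x. LINT s|?M. f (x, s) \<bullet> v x) \<in> borel_measurable ?N"
        using borel_measurable_integrable[OF F(2)] by simp
      show "AE x in ?N. time_integral f a b x \<bullet> v x = (LINT s|?M. f (x, s) \<bullet> v x)"
        using ae[of v] by eventually_elim simp
    qed
    also have "\<dots> = (LINT s|?M. LINT x|?N. f (x, s) \<bullet> v x)" using trans[OF F(3) F(1)[symmetric]] by simp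
    finally show ?thesis .
  qed
qed

lemma LINT_time_integral_difference:
  assumes \<Omega>: "open \<Omega>" and f: "f \<in> L2 (lebesgue_on (QT \<Omega> T))" and ab: "0 \<le> a" "a \<le> b" "b \<le> T"
    and v: "v \<in> L2 (lebesgue_on \<Omega>)"
  shows "(LINT x|lebesgue_on \<Omega>. time_integral f a b x \<bullet> v x)
    = integral {0..b} (\<lambda>s. LINT x|lebesgue_on \<Omega>. f (x, s) \<bullet> v x) - integral {0..a} (\<lambda>s. LINT x|lebesgue_on \<Omega>. f (x, s) \<bullet> v x)"
    and "(LINT x|lebesgue_on \<Omega>. time_integral f a b x \<bullet> v x) = integral {a..b} (\<lambda>s. LINT x|lebesgue_on \<Omega>. f (x, s) \<bullet> v x)"
proof -
  let ?g = "\<lambda>s. LINT x|lebesgue_on \<Omega>. f (x, s) \<bullet> v x"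
  have "integrable (lebesgue_on {0<..<T}) ?g" by (rule L2_slice_inner_integrable(2)[OF \<Omega> f v])
  then have "integrable (lebesgue_on {a<..<b}) ?g"
    by (rule integrable_lebesgue_on_subset) (use ab in auto)
  from LINT_eq_integral_Icc(1)[OF this]
  show *: "(LINT x|lebesgue_on \<Omega>. time_integral f a b x \<bullet> v x) = integral {a..b} ?g"
    by (simp add: LINT_time_integral[OF \<Omega> f ab v])
  have "?g integrable_on {0..T}" by (rule LINT_eq_integral_Icc(2)[OF L2_slice_inner_integrable(2)[OF \<Omega> f v]])
  then have "?g integrable_on {0..b}" by (rule integrable_on_subinterval) (use ab in auto)
  from Henstock_Kurzweil_Integration.integral_combine[OF ab(1,2) this] *
  show "(LINT x|lebesgue_on \<Omega>. time_integral f a b x \<bullet> v x) = integral {0..b} ?g - integral {0..a} ?g"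
    by simp
qed

section \<open>Continuous kernels that decrease along the diagonal\<close>

lemma integral_translate:
  fixes f :: "real \<Rightarrow> real"
  assumes "f integrable_on {a + c..b + c}"
  shows "integral {a..b} (\<lambda>x. f (x + c)) = integral {a + c..b + c} f"
proof -
  have "(f has_integral integral {a + c..b + c} f) (cbox (a + c) (b + c))"
    using assms by (simp add: integrable_integral)
  from has_integral_affinity[OF this, of 1 c]
  have "((\<lambda>x. f (x + c)) has_integral integral {a + c..b + c} f) ((\<lambda>x. x - c) ` {a + c..b + c})"
    by simp
  moreover have "(\<lambda>x. x - c) ` {a + c..b + c} = {a..b}"
    by (auto simp: image_iff intro!: bexI[of _ "x + c" for x])
  ultimately show ?thesis by (simp add: integral_unique)
qed

lemma integral_flip:
  fixes f :: "real \<Rightarrow> real"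
  assumes "f integrable_on {0..c}"
  shows "integral {0..c} (\<lambda>x. f (c - x)) = integral {0..c} f"
proof -
  have "(f has_integral integral {0..c} f) (cbox 0 c)"
    using assms by (simp add: integrable_integral)
  from has_integral_affinity[OF this, of "-1" c]
  have "((\<lambda>x. f (c - x)) has_integral integral {0..c} f) ((\<lambda>x. c - x) ` {0..c})"
    by (simp add: algebra_simps)
  moreover have "(\<lambda>x. c - x) ` {0..c} = {0..c}"
    by (auto simp: image_iff intro!: bexI[of _ "c - x" for x])
  ultimately show ?thesis by (simp add: integral_unique)
qed

text \<open>
  Substituting \<open>s = t + \<sigma>\<close> and exchanging the integrals, both terms on the left become integrals of
  \<open>G\<close> along the lines \<open>s - t = \<plusminus>\<sigma>\<close>, once \<open>\<sigma>\<close> is replaced by \<open>l - \<sigma>\<close> in the first term. By symmetry of \<open>G\<close> these are segments of the same line that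
  differ by a shift, and everything except the two ends cancels. What remains are two triangles of side
  \<open>l\<close>, one at \<open>(b, b)\<close> and one at \<open>(0, 0)\<close>.
\<close>

lemma parallelogram_integral:
  fixes G :: "real \<Rightarrow> real \<Rightarrow> real"
  assumes G: "continuous_on UNIV (\<lambda>(r, s). G r s)" and sym: "\<And>r s. G r s = G s r"
    and b: "0 \<le> b" and l: "0 \<le> l"
  defines "D \<sigma> \<equiv> integral {b..b + (l - \<sigma>)} (\<lambda>t. G t (t + \<sigma>)) - integral {0..l - \<sigma>} (\<lambda>t. G t (t + \<sigma>))"
  shows "integral {0..b} (\<lambda>t. integral {t..t + l} (\<lambda>s. G (t + l) s - G t s)) = integral {0..l} D"
    and "continuous_on {0..l} D"
proof -
  have Gc: "continuous_on S (\<lambda>x. G (f x) (g x))"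
    if "continuous_on S f" "continuous_on S g" for f g and S :: "'a::topological_space set"
    using continuous_on_compose2[OF G continuous_on_Pair[OF that]] by simp
  define P where "P \<sigma> = integral {0..b} (\<lambda>t. G (t + l) (t + \<sigma>))" for \<sigma>
  define R where "R \<sigma> = integral {0..b} (\<lambda>t. G t (t + \<sigma>))" for \<sigma>
  have Pc: "continuous_on S P" for S
  proof -
    have "continuous_on (S \<times> cbox 0 b) (\<lambda>(\<sigma>, t). G (t + l) (t + \<sigma>))"
      unfolding case_prod_unfold by (intro Gc continuous_intros)
    then show ?thesis unfolding P_def[abs_def] using integral_continuous_on_param by fastforce
  qed
  have Rc: "continuous_on S R" for S
  proof -
    have "continuous_on (S \<times> cbox 0 b) (\<lambda>(\<sigma>, t). G t (t + \<sigma>))"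
      unfolding case_prod_unfold by (intro Gc continuous_intros)
    then show ?thesis unfolding R_def[abs_def] using integral_continuous_on_param by fastforce
  qed
  have fi: "(\<lambda>t. G t (t + \<sigma>)) integrable_on {a..c}" for \<sigma> a c
    by (intro integrable_continuous_real Gc continuous_intros)
  have DPR: "D \<sigma> = P (l - \<sigma>) - R \<sigma>" if "\<sigma> \<in> {0..l}" for \<sigma>
  proof -
    define k where "k = l - \<sigma>"
    have k: "0 \<le> k" using that by (simp add: k_def)
    \<comment> \<open>The shift by \<open>l - \<sigma>\<close> moves the segment onto the line of \<open>R \<sigma>\<close>.\<close>
    have "P (l - \<sigma>) = integral {0..b} (\<lambda>t. G (t + k) ((t + k) + \<sigma>))"
      unfolding P_def k_def by (subst sym) (simp add: algebra_simps)
    also have "\<dots> = integral {0 + k..b + k} (\<lambda>t. G t (t + \<sigma>))"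
      by (rule integral_translate[of "\<lambda>t. G t (t + \<sigma>)"]) (rule fi)
    finally have 1: "P (l - \<sigma>) = integral {k..b + k} (\<lambda>t. G t (t + \<sigma>))" by simp
    have "integral {0..k} (\<lambda>t. G t (t + \<sigma>)) + integral {k..b + k} (\<lambda>t. G t (t + \<sigma>)) = integral {0..b + k} (\<lambda>t. G t (t + \<sigma>))"
      by (rule Henstock_Kurzweil_Integration.integral_combine) (use k b fi in auto)
    moreover have "R \<sigma> + integral {b..b + k} (\<lambda>t. G t (t + \<sigma>)) = integral {0..b + k} (\<lambda>t. G t (t + \<sigma>))"
      unfolding R_def by (rule Henstock_Kurzweil_Integration.integral_combine) (use k b fi in auto)
    ultimately show ?thesis unfolding 1 D_def k_def by simp
  qed
  have "integral {0..b} (\<lambda>t. integral {t..t + l} (\<lambda>s. G (t + l) s - G t s))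
      = integral {0..b} (\<lambda>t. integral {0..l} (\<lambda>\<sigma>. G (t + l) (t + \<sigma>) - G t (t + \<sigma>)))"
  proof (rule integral_cong)
    fix t
    have "integral {0..l} (\<lambda>\<sigma>. G (t + l) (\<sigma> + t) - G t (\<sigma> + t)) = integral {0 + t..l + t} (\<lambda>s. G (t + l) s - G t s)"
      by (rule integral_translate[of "\<lambda>s. G (t + l) s - G t s"]) (intro integrable_continuous_real Gc continuous_intros)
    then show "integral {t..t + l} (\<lambda>s. G (t + l) s - G t s) = integral {0..l} (\<lambda>\<sigma>. G (t + l) (t + \<sigma>) - G t (t + \<sigma>))"
      by (simp add: add.commute)
  qed
  also have "\<dots> = integral {0..l} (\<lambda>\<sigma>. integral {0..b} (\<lambda>t. G (t + l) (t + \<sigma>) - G t (t + \<sigma>)))"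
  proof -
    have "continuous_on (cbox (0, 0) (b, l)) (\<lambda>(t, \<sigma>). G (t + l) (t + \<sigma>) - G t (t + \<sigma>))"
      unfolding case_prod_unfold by (intro Gc continuous_intros)
    from integral_swap_continuous[OF this] show ?thesis by simp
  qed
  also have "\<dots> = integral {0..l} (\<lambda>\<sigma>. P \<sigma> - R \<sigma>)"
    unfolding P_def R_def
    by (intro integral_cong Henstock_Kurzweil_Integration.integral_diff integrable_continuous_real Gc continuous_intros)
  also have "\<dots> = integral {0..l} P - integral {0..l} R"
    by (intro Henstock_Kurzweil_Integration.integral_diff integrable_continuous_real Pc Rc)
  also have "integral {0..l} P = integral {0..l} (\<lambda>\<sigma>. P (l - \<sigma>))"
    by (rule integral_flip[symmetric]) (intro integrable_continuous_real Pc)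
  also have PD: "continuous_on {0..l} (\<lambda>\<sigma>. P (l - \<sigma>))"
    by (rule continuous_on_compose2[OF Pc[of UNIV]]) (auto intro: continuous_intros)
  have "integral {0..l} (\<lambda>\<sigma>. P (l - \<sigma>)) - integral {0..l} R = integral {0..l} (\<lambda>\<sigma>. P (l - \<sigma>) - R \<sigma>)"
    by (intro Henstock_Kurzweil_Integration.integral_diff[symmetric] integrable_continuous_real Rc PD)
  also have "\<dots> = integral {0..l} D"
    by (rule integral_cong) (simp add: DPR)
  finally show "integral {0..b} (\<lambda>t. integral {t..t + l} (\<lambda>s. G (t + l) s - G t s)) = integral {0..l} D" .
  have "continuous_on {0..l} (\<lambda>\<sigma>. P (l - \<sigma>) - R \<sigma>)" by (intro continuous_on_diff PD Rc)
  then show "continuous_on {0..l} D" by (rule continuous_on_eq) (simp add: DPR)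
qed

lemma integral_near_const:
  fixes f :: "real \<Rightarrow> real"
  assumes "a \<le> c" "f integrable_on {a..c}" "\<And>t. t \<in> {a..c} \<Longrightarrow> \<bar>f t - y\<bar> \<le> \<eta>"
  shows "\<bar>integral {a..c} f - (c - a) * y\<bar> \<le> (c - a) * \<eta>"
proof -
  have "integral {a..c} f \<le> integral {a..c} (\<lambda>t. y + \<eta>)"
    by (rule integral_le) (use assms in \<open>auto simp: abs_le_iff algebra_simps\<close>)
  moreover have "integral {a..c} (\<lambda>t. y - \<eta>) \<le> integral {a..c} f"
    by (rule integral_le) (use assms in \<open>auto simp: abs_le_iff algebra_simps\<close>)
  ultimately show ?thesis using assms(1) by (simp add: abs_le_iff algebra_simps)
qed

text \<open>
  If \<open>G\<close> were differentiable, the limit of \<open>bound\<close> would say that \<open>(d/dt) G(t, t) \<le> 0\<close>. For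
  continuous \<open>G\<close>, \<open>bound\<close> is integrated over \<open>t \<in> [0, b]\<close>. By \<open>parallelogram_integral\<close> the left-hand side is
  about \<open>l\<^sup>2/2 (G(b, b) - G(0, 0))\<close>, and the right-hand side telescopes to at most \<open>l\<^sup>2 \<eta> K(T)\<close>.
\<close>

lemma diagonal_decreasing_UNIV:
  fixes G :: "real \<Rightarrow> real \<Rightarrow> real"
  assumes G: "continuous_on UNIV (\<lambda>(r, s). G r s)" and sym: "\<And>r s. G r s = G s r"
    and K: "continuous_on {0..T} K" and K0: "\<And>s. s \<in> {0..T} \<Longrightarrow> 0 \<le> K s" and KT: "\<And>s. s \<in> {0..T} \<Longrightarrow> K s \<le> K T"
    and bound: "\<And>\<eta>. 0 < \<eta> \<Longrightarrow> \<exists>\<delta>>0. \<forall>l t. 0 < l \<and> l < \<delta> \<and> 0 \<le> t \<and> t + l \<le> T \<longrightarrow>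
      integral {t..t + l} (\<lambda>s. G (t + l) s - G t s) \<le> l * \<eta> * (K (t + l) - K t)"
    and b: "0 \<le> b" "b < T"
  shows "G b b \<le> G 0 0"
proof (rule field_le_epsilon)
  fix \<epsilon> :: real assume "0 < \<epsilon>"
  define \<eta> where "\<eta> = \<epsilon> / (2 + 2 * K T)"
  have KT0: "0 \<le> K T" using K0 b by simp
  have "\<eta> * (2 + 2 * K T) = \<epsilon>" using KT0 by (simp add: \<eta>_def)
  then have "2 * \<eta> + 2 * (\<eta> * K T) = \<epsilon>" by (simp add: algebra_simps)
  moreover have "0 < \<eta>" using \<open>0 < \<epsilon>\<close> KT0 by (simp add: \<eta>_def)
  ultimately have \<eta>: "0 < \<eta>" "2 * \<eta> + 2 * (\<eta> * K T) = \<epsilon>" by auto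
  have Gc: "continuous_on S (\<lambda>x. G (f x) (g x))"
    if "continuous_on S f" "continuous_on S g" for f g and S :: "real set"
    using continuous_on_compose2[OF G continuous_on_Pair[OF that]] by simp
  have near: "\<exists>d>0. \<forall>x y. \<bar>x - c\<bar> < d \<and> \<bar>y - c\<bar> < d \<longrightarrow> \<bar>G x y - G c c\<bar> \<le> \<eta>" for c
  proof -
    have "continuous (at (c, c)) (\<lambda>(r, s). G r s)" using G by (simp add: continuous_on_eq_continuous_at)
    then obtain d where d: "d > 0" "\<And>z. dist z (c, c) < d \<Longrightarrow> dist ((\<lambda>(r, s). G r s) z) (G c c) < \<eta>"
      using \<eta>(1) unfolding continuous_at_eps_delta by force
    have "\<bar>G x y - G c c\<bar> \<le> \<eta>" if "\<bar>x - c\<bar> < d / 2" "\<bar>y - c\<bar> < d / 2" for x y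
    proof -
      have "dist (x, y) (c, c) \<le> \<bar>x - c\<bar> + \<bar>y - c\<bar>"
        unfolding dist_prod_def fst_conv snd_conv dist_real_def
        by (rule order_trans[OF sqrt_sum_squares_le_sum_abs]) simp
      then show ?thesis using d(2)[of "(x, y)"] that by (simp add: dist_real_def)
    qed
    then show ?thesis using d(1) by (intro exI[of _ "d / 2"]) auto
  qed
  obtain d0 where d0: "d0 > 0" "\<And>x y. \<bar>x - 0\<bar> < d0 \<Longrightarrow> \<bar>y - 0\<bar> < d0 \<Longrightarrow> \<bar>G x y - G 0 0\<bar> \<le> \<eta>"
    using near by blast
  obtain d1 where d1: "d1 > 0" "\<And>x y. \<bar>x - b\<bar> < d1 \<Longrightarrow> \<bar>y - b\<bar> < d1 \<Longrightarrow> \<bar>G x y - G b b\<bar> \<le> \<eta>"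
    using near by blast
  obtain \<delta> where \<delta>: "\<delta> > 0" "\<And>l t. 0 < l \<Longrightarrow> l < \<delta> \<Longrightarrow> 0 \<le> t \<Longrightarrow> t + l \<le> T \<Longrightarrow>
      integral {t..t + l} (\<lambda>s. G (t + l) s - G t s) \<le> l * \<eta> * (K (t + l) - K t)"
    using bound[OF \<eta>(1)] by blast
  define l where "l = Min {d0 / 2, d1 / 2, \<delta> / 2, T - b}"
  have "0 < l" using d0(1) d1(1) \<delta>(1) b by (simp add: l_def)
  moreover have "l \<le> d0 / 2" "l \<le> d1 / 2" "l \<le> \<delta> / 2" "l \<le> T - b"
    unfolding l_def by (rule Min_le; simp)+
  ultimately have l: "0 < l" "l < d0" "l < d1" "l < \<delta>" "b + l \<le> T"
    using d0(1) d1(1) \<delta>(1) by auto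
  define D where "D \<sigma> = integral {b..b + (l - \<sigma>)} (\<lambda>t. G t (t + \<sigma>)) - integral {0..l - \<sigma>} (\<lambda>t. G t (t + \<sigma>))" for \<sigma>
  define L where "L = integral {0..b} (\<lambda>t. integral {t..t + l} (\<lambda>s. G (t + l) s - G t s))"
  have LD: "L = integral {0..l} D" and Dc: "continuous_on {0..l} D"
    unfolding L_def D_def using parallelogram_integral[OF G sym b(1), of l] l(1) by auto
  have fi: "(\<lambda>t. G t (t + \<sigma>)) integrable_on {a..c}" for \<sigma> a c
    by (intro integrable_continuous_real Gc continuous_intros)
  have Dlow: "(l - \<sigma>) * (G b b - G 0 0 - 2 * \<eta>) \<le> D \<sigma>" if \<sigma>: "\<sigma> \<in> {0..l}" for \<sigma>
  proof -
    have "\<bar>integral {b..b + (l - \<sigma>)} (\<lambda>t. G t (t + \<sigma>)) - (b + (l - \<sigma>) - b) * G b b\<bar> \<le> (b + (l - \<sigma>) - b) * \<eta>"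
      by (rule integral_near_const[OF _ fi]) (use \<sigma> l in \<open>auto intro!: d1(2)\<close>)
    moreover have "\<bar>integral {0..l - \<sigma>} (\<lambda>t. G t (t + \<sigma>)) - (l - \<sigma> - 0) * G 0 0\<bar> \<le> (l - \<sigma> - 0) * \<eta>"
      by (rule integral_near_const[OF _ fi]) (use \<sigma> l in \<open>auto intro!: d0(2)\<close>)
    ultimately show ?thesis unfolding D_def by (simp add: abs_le_iff algebra_simps)
  qed
  have "l\<^sup>2 / 2 * (G b b - G 0 0 - 2 * \<eta>) = integral {0..l} (\<lambda>\<sigma>. (l - \<sigma>) * (G b b - G 0 0 - 2 * \<eta>))"
  proof -
    have "((\<lambda>\<sigma>. (l - \<sigma>) * (G b b - G 0 0 - 2 * \<eta>)) has_integral
      (l * l - l\<^sup>2 / 2) * (G b b - G 0 0 - 2 * \<eta>) - (l * 0 - 0\<^sup>2 / 2) * (G b b - G 0 0 - 2 * \<eta>)) {0..l}"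
      by (rule fundamental_theorem_of_calculus)
        (use l in \<open>auto intro!: derivative_eq_intros simp flip: has_real_derivative_iff_has_vector_derivative\<close>)
    from integral_unique[OF this] show ?thesis by (auto simp: power2_eq_square)
  qed
  also have "\<dots> \<le> integral {0..l} D"
    by (rule integral_le) (use Dlow Dc in \<open>auto intro!: integrable_continuous_real continuous_intros\<close>)
  finally have low: "l\<^sup>2 / 2 * (G b b - G 0 0 - 2 * \<eta>) \<le> L" by (simp add: LD)
  have Kc1: "continuous_on {0..b} K" and Kc2: "continuous_on {0 + l..b + l} K"
    using b l by (auto intro!: continuous_on_subset[OF K])
  have Kc3: "continuous_on {0..b} (\<lambda>t. K (t + l))"
    by (rule continuous_on_compose2[OF Kc2]) (auto intro!: continuous_intros)
  have inner: "integral {t..t + l} (\<lambda>s. G (t + l) s - G t s) = integral {0..l} (\<lambda>s. G (t + l) (s + t) - G t (s + t))" for t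
    using integral_translate[of "\<lambda>s. G (t + l) s - G t s" 0 t l]
    by (simp add: add.commute integrable_continuous_real Gc continuous_on_diff continuous_on_const continuous_on_id)
  have Lc: "(\<lambda>t. integral {t..t + l} (\<lambda>s. G (t + l) s - G t s)) integrable_on {0..b}"
  proof -
    have "continuous_on ({0..b} \<times> cbox 0 l) (\<lambda>(t, s). G (t + l) (s + t) - G t (s + t))"
      unfolding case_prod_unfold
      by (intro continuous_on_diff continuous_on_compose2[OF G, of _ "\<lambda>z. (fst z + l, snd z + fst z)", simplified]
        continuous_on_compose2[OF G, of _ "\<lambda>z. (fst z, snd z + fst z)", simplified] continuous_intros)
    then have "continuous_on {0..b} (\<lambda>t. integral (cbox 0 l) (\<lambda>s. G (t + l) (s + t) - G t (s + t)))"
      by (rule integral_continuous_on_param)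
    then show ?thesis unfolding inner by (simp add: integrable_continuous_real)
  qed
  have "L \<le> integral {0..b} (\<lambda>t. l * \<eta> * (K (t + l) - K t))"
    unfolding L_def
    by (rule integral_le[OF Lc]) (use \<delta>(2) l Kc1 Kc3 in \<open>auto intro!: integrable_continuous_real continuous_intros\<close>)
  also have "\<dots> = l * \<eta> * (integral {0..b} (\<lambda>t. K (t + l)) - integral {0..b} K)"
    using Kc1 Kc3 by (simp add: Henstock_Kurzweil_Integration.integral_diff integrable_continuous_real)
  also have "integral {0..b} (\<lambda>t. K (t + l)) - integral {0..b} K \<le> l * K T"
  proof -
    have KI: "K integrable_on {a..c}" if "0 \<le> a" "c \<le> T" for a c
      by (rule integrable_continuous_real[OF continuous_on_subset[OF K]]) (use that in auto)
    have "integral {0..b} (\<lambda>t. K (t + l)) = integral {0 + l..b + l} K"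
      by (rule integral_translate) (use KI l in auto)
    moreover have "integral {0..l} K + integral {l..b + l} K = integral {0..b + l} K"
      by (rule Henstock_Kurzweil_Integration.integral_combine) (use KI l b in auto)
    moreover have "integral {0..b} K + integral {b..b + l} K = integral {0..b + l} K"
      by (rule Henstock_Kurzweil_Integration.integral_combine) (use KI l b in auto)
    moreover have "0 \<le> integral {0..l} K"
      by (rule integral_nonneg) (use KI K0 l b in auto)
    moreover have "integral {b..b + l} K \<le> integral {b..b + l} (\<lambda>t. K T)"
      by (rule integral_le) (use KI KT l b in auto)
    ultimately show ?thesis using l by simp
  qed
  finally have "L \<le> l * \<eta> * (l * K T)" using l \<eta> by (simp add: mult_left_mono)
  with low have "l\<^sup>2 / 2 * (G b b - G 0 0 - 2 * \<eta>) \<le> l\<^sup>2 / 2 * (2 * (\<eta> * K T))"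
    by (simp add: power2_eq_square mult_ac)
  then have "G b b - G 0 0 - 2 * \<eta> \<le> 2 * (\<eta> * K T)"
    using l(1) by (simp add: mult_le_cancel_left)
  then show "G b b \<le> G 0 0 + \<epsilon>" using \<eta>(2) by linarith
qed

text \<open>
  The kernel is extended to the plane by clamping the times to \<open>[0, T]\<close>; the end point \<open>b = T\<close>, where
  there is no room for \<open>t + l\<close>, follows by continuity.
\<close>

lemma diagonal_decreasing:
  fixes g :: "real \<Rightarrow> real \<Rightarrow> real"
  assumes g: "continuous_on ({0..T} \<times> {0..T}) (\<lambda>(r, s). g r s)"
    and sym: "\<And>r s. r \<in> {0..T} \<Longrightarrow> s \<in> {0..T} \<Longrightarrow> g r s = g s r"
    and K: "continuous_on {0..T} K" and K0: "\<And>s. s \<in> {0..T} \<Longrightarrow> 0 \<le> K s" and KT: "\<And>s. s \<in> {0..T} \<Longrightarrow> K s \<le> K T"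
    and bound: "\<And>\<eta>. 0 < \<eta> \<Longrightarrow> \<exists>\<delta>>0. \<forall>l t. 0 < l \<and> l < \<delta> \<and> 0 \<le> t \<and> t + l \<le> T \<longrightarrow>
      integral {t..t + l} (\<lambda>s. g (t + l) s - g t s) \<le> l * \<eta> * (K (t + l) - K t)"
    and b: "b \<in> {0..T}" and T: "0 < T"
  shows "g b b \<le> g 0 0"
proof -
  define c where "c x = max 0 (min T x)" for x :: real
  define G where "G r s = g (c r) (c s)" for r s
  have c: "c x \<in> {0..T}" for x using T by (auto simp: c_def)
  have cid: "c x = x" if "x \<in> {0..T}" for x using that by (auto simp: c_def)
  have "continuous_on UNIV (\<lambda>z. (c (fst z), c (snd z)))"
    unfolding c_def by (intro continuous_intros)
  from continuous_on_compose2[OF g this]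
  have Gc: "continuous_on UNIV (\<lambda>(r, s). G r s)"
    using c by (simp add: case_prod_unfold G_def image_subset_iff)
  have Gb: "\<exists>\<delta>>0. \<forall>l t. 0 < l \<and> l < \<delta> \<and> 0 \<le> t \<and> t + l \<le> T \<longrightarrow>
      integral {t..t + l} (\<lambda>s. G (t + l) s - G t s) \<le> l * \<eta> * (K (t + l) - K t)" if \<eta>: "0 < \<eta>" for \<eta>
  proof -
    obtain \<delta> where \<delta>: "\<delta> > 0" "\<And>l t. 0 < l \<Longrightarrow> l < \<delta> \<Longrightarrow> 0 \<le> t \<Longrightarrow> t + l \<le> T \<Longrightarrow>
      integral {t..t + l} (\<lambda>s. g (t + l) s - g t s) \<le> l * \<eta> * (K (t + l) - K t)"
      using bound[OF \<eta>] by blast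
    have "integral {t..t + l} (\<lambda>s. G (t + l) s - G t s) = integral {t..t + l} (\<lambda>s. g (t + l) s - g t s)"
      if "0 < l" "0 \<le> t" "t + l \<le> T" for l t
      by (rule integral_cong) (use that in \<open>simp add: G_def cid\<close>)
    then show ?thesis using \<delta> by (intro exI[of _ \<delta>]) auto
  qed
  have *: "g b b \<le> g 0 0" if "b \<in> {0..<T}" for b
    using diagonal_decreasing_UNIV[OF Gc _ K K0 KT Gb, of b] sym c that T by (simp add: G_def cid)
  have "continuous_on {0..T} (\<lambda>x. (\<lambda>(r, s). g r s) (x, x))"
    by (rule continuous_on_compose2[OF g]) (auto intro!: continuous_intros)
  then have "continuous_on (closure {0..<T}) (\<lambda>x. g x x)" using T by simp
  then show ?thesis
    by (rule continuous_le_on_closure) (use b T * in auto)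
qed

section \<open>Continuous representatives and differences in time\<close>

lemma L2_norm_bound:
  assumes u: "u \<in> L2 M" and v: "v \<in> L2 M" and K: "0 \<le> K" and "AE x in M. norm (v x) \<le> K * norm (u x)"
  shows "L2_norm M v \<le> K * L2_norm M u"
proof -
  have "(LINT x|M. v x \<bullet> v x) \<le> (LINT x|M. K\<^sup>2 * (u x \<bullet> u x))"
  proof (rule integral_mono_AE)
    show "AE x in M. v x \<bullet> v x \<le> K\<^sup>2 * (u x \<bullet> u x)"
      using assms(4)
    proof eventually_elim
      case (elim x)
      from power_mono[OF this, of 2] show ?case by (simp add: power_mult_distrib power2_norm_eq_inner)
    qed
  qed (use L2_inner_integrable[OF u u] L2_inner_integrable[OF v v] in simp_all)
  then have "sqrt (LINT x|M. v x \<bullet> v x) \<le> sqrt (K\<^sup>2 * (LINT x|M. u x \<bullet> u x))" by simp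
  then show ?thesis using K by (simp add: L2_norm_def real_sqrt_mult)
qed

lemma cont_rep_diff:
  assumes "cont_rep \<Omega> T m M" and "cont_rep \<Omega> T n N"
  shows "cont_rep \<Omega> T (\<lambda>z. m z - n z) (\<lambda>t x. M t x - N t x)"
  unfolding cont_rep_def
proof (intro conjI ballI)
  note LM = cont_rep_L2[OF assms(1)] and LN = cont_rep_L2[OF assms(2)]
  let ?n = "L2_norm (lebesgue_on \<Omega>)"
  show "(\<lambda>x. M t x - N t x) \<in> Hspace \<Omega>" if "t \<in> {0..T}" for t
    using L2_diff[OF LM[OF that] LN[OF that]] by (simp add: Hspace_def)
  have "AE t in lebesgue_on {0<..<T}. AE x in lebesgue_on \<Omega>. m (x, t) = M t x"
       "AE t in lebesgue_on {0<..<T}. AE x in lebesgue_on \<Omega>. n (x, t) = N t x"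
    using assms by (auto simp: cont_rep_def)
  then show "AE t in lebesgue_on {0<..<T}. AE x in lebesgue_on \<Omega>. m (x, t) - n (x, t) = M t x - N t x"
  proof eventually_elim
    case (elim t)
    then show ?case by eventually_elim simp
  qed
  fix t assume t: "t \<in> {0..T}"
  have b: "?n (\<lambda>x. (M s x - N s x) - (M t x - N t x)) \<le> ?n (\<lambda>x. M s x - M t x) + ?n (\<lambda>x. N s x - N t x)"
    if s: "s \<in> {0..T}" for s
  proof -
    have "?n (\<lambda>x. (M s x - M t x) + (N t x - N s x)) \<le> ?n (\<lambda>x. M s x - M t x) + ?n (\<lambda>x. N t x - N s x)"
      by (intro L2_norm_triangle L2_diff LM LN s t)
    moreover have "(\<lambda>x. (M s x - M t x) + (N t x - N s x)) = (\<lambda>x. (M s x - N s x) - (M t x - N t x))"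
      by (auto simp: algebra_simps)
    moreover have "?n (\<lambda>x. N t x - N s x) = ?n (\<lambda>x. N s x - N t x)"
      by (rule L2_norm_minus_commute)
    ultimately show ?thesis by simp
  qed
  have "((\<lambda>s. ?n (\<lambda>x. M s x - M t x) + ?n (\<lambda>x. N s x - N t x)) \<longlongrightarrow> 0 + 0) (at t within {0..T})"
    by (intro tendsto_add cont_rep_norm_tendsto[OF assms(1) t] cont_rep_norm_tendsto[OF assms(2) t])
  then have l: "((\<lambda>s. ?n (\<lambda>x. M s x - M t x) + ?n (\<lambda>x. N s x - N t x)) \<longlongrightarrow> 0) (at t within {0..T})" by simp
  have "((\<lambda>s. ?n (\<lambda>x. (M s x - N s x) - (M t x - N t x))) \<longlongrightarrow> 0) (at t within {0..T})"
    by (rule Lim_null_comparison[OF _ l]) (use b in \<open>auto simp: eventually_at_filter\<close>)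
  then show "((\<lambda>s. H_norm \<Omega> (\<lambda>x. (M s x - N s x) - (M t x - N t x))) \<longlongrightarrow> 0) (at t within {0..T})"
    by (simp add: H_norm_def L2_norm_def)
qed

lemma matrix_field_L2:
  assumes a: "bdd_meas_matrix_field \<Omega> a" and u: "u \<in> L2 (lebesgue_on \<Omega>)" and \<Omega>: "open \<Omega>"
  shows "(\<lambda>x. a x *v u x) \<in> L2 (lebesgue_on \<Omega>)"
proof -
  obtain K where "\<And>x \<xi>. x \<in> \<Omega> \<Longrightarrow> norm (a x *v \<xi>) \<le> K * norm \<xi>" using bdd_meas_matrix_field_bound[OF a] by metis
  then show ?thesis
    by (intro L2_matrix_mult[OF _ _ u, of a K]) (use a in \<open>auto simp: bdd_meas_matrix_field_def\<close>)
qed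

lemma matrix_field_L2_QT:
  assumes a: "bdd_meas_matrix_field \<Omega> a" and u: "u \<in> L2 (lebesgue_on (QT \<Omega> T))" and \<Omega>: "open \<Omega>"
  shows "(\<lambda>z. a (fst z) *v u z) \<in> L2 (lebesgue_on (QT \<Omega> T))"
proof -
  obtain K where K: "\<And>x \<xi>. x \<in> \<Omega> \<Longrightarrow> norm (a x *v \<xi>) \<le> K * norm \<xi>" using bdd_meas_matrix_field_bound[OF a] by metis
  have "(\<lambda>z. a (fst z) $ i $ k) \<in> borel_measurable (lebesgue_on (QT \<Omega> T))" for i k
    unfolding QT_def
    by (rule measurable_lebesgue_on_fst[where u="\<lambda>x. a x $ i $ k"])
      (use a \<Omega> in \<open>auto simp: bdd_meas_matrix_field_def\<close>)
  then show ?thesis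
    by (intro L2_matrix_mult[OF _ _ u, of "\<lambda>z. a (fst z)" K]) (use K in \<open>auto simp: QT_def\<close>)
qed

lemma cont_rep_matrix_field:
  assumes \<Omega>: "open \<Omega>" and a: "bdd_meas_matrix_field \<Omega> a" and M: "cont_rep \<Omega> T m M"
  shows "cont_rep \<Omega> T (\<lambda>z. a (fst z) *v m z) (\<lambda>t x. a x *v M t x)"
  unfolding cont_rep_def
proof (intro conjI ballI)
  let ?n = "L2_norm (lebesgue_on \<Omega>)"
  note LM = cont_rep_L2[OF M]
  obtain K where K: "\<And>x \<xi>. x \<in> \<Omega> \<Longrightarrow> norm (a x *v \<xi>) \<le> K * norm \<xi>" using bdd_meas_matrix_field_bound[OF a] by metis
  then have K': "norm (a x *v \<xi>) \<le> \<bar>K\<bar> * norm \<xi>" if "x \<in> \<Omega>" for x \<xi>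
    using that by (meson abs_ge_self mult_right_mono norm_ge_zero order_trans)
  show "(\<lambda>x. a x *v M t x) \<in> Hspace \<Omega>" if "t \<in> {0..T}" for t
    using matrix_field_L2[OF a LM[OF that] \<Omega>] by (simp add: Hspace_def)
  have "AE t in lebesgue_on {0<..<T}. AE x in lebesgue_on \<Omega>. m (x, t) = M t x"
    using M by (auto simp: cont_rep_def)
  then show "AE t in lebesgue_on {0<..<T}. AE x in lebesgue_on \<Omega>. a (fst (x, t)) *v m (x, t) = a x *v M t x"
  proof eventually_elim
    case (elim t)
    then show ?case by eventually_elim simp
  qed
  fix t assume t: "t \<in> {0..T}"
  have b: "?n (\<lambda>x. a x *v M s x - a x *v M t x) \<le> \<bar>K\<bar> * ?n (\<lambda>x. M s x - M t x)" if s: "s \<in> {0..T}" for s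
  proof (rule L2_norm_bound)
    show "AE x in lebesgue_on \<Omega>. norm (a x *v M s x - a x *v M t x) \<le> \<bar>K\<bar> * norm (M s x - M t x)"
      using K' by (intro AE_I2) (simp add: matrix_vector_mult_diff_distrib[symmetric])
  qed (intro L2_diff matrix_field_L2[OF a _ \<Omega>] LM s t abs_ge_zero)+
  have "((\<lambda>s. \<bar>K\<bar> * ?n (\<lambda>x. M s x - M t x)) \<longlongrightarrow> \<bar>K\<bar> * 0) (at t within {0..T})"
    by (intro tendsto_mult tendsto_const cont_rep_norm_tendsto[OF M t])
  then have l: "((\<lambda>s. \<bar>K\<bar> * ?n (\<lambda>x. M s x - M t x)) \<longlongrightarrow> 0) (at t within {0..T})" by simp
  have "((\<lambda>s. ?n (\<lambda>x. a x *v M s x - a x *v M t x)) \<longlongrightarrow> 0) (at t within {0..T})"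
    by (rule Lim_null_comparison[OF _ l]) (use b in \<open>auto simp: eventually_at_filter\<close>)
  then show "((\<lambda>s. H_norm \<Omega> (\<lambda>x. a x *v M s x - a x *v M t x)) \<longlongrightarrow> 0) (at t within {0..T})"
    by (simp add: H_norm_def L2_norm_def)
qed

lemma cont_rep_inner_continuous2:
  assumes M: "cont_rep \<Omega> T m M" and N: "cont_rep \<Omega> T n N"
  shows "continuous_on ({0..T} \<times> {0..T}) (\<lambda>(r, s). LINT x|lebesgue_on \<Omega>. M r x \<bullet> N s x)"
  unfolding continuous_on_def
proof
  let ?n = "L2_norm (lebesgue_on \<Omega>)"
  let ?S = "{0..T} \<times> {0..T}"
  note LM = cont_rep_L2[OF M] and LN = cont_rep_L2[OF N]
  fix w assume w: "w \<in> ?S"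
  obtain r0 s0 where rs: "w = (r0, s0)" "r0 \<in> {0..T}" "s0 \<in> {0..T}" using w by auto
  define f where "f r s = (LINT x|lebesgue_on \<Omega>. M r x \<bullet> N s x)" for r s
  define B where "B z = ?n (\<lambda>x. M (fst z) x - M r0 x) * (?n (\<lambda>x. N (snd z) x - N s0 x) + ?n (N s0))
      + ?n (M r0) * ?n (\<lambda>x. N (snd z) x - N s0 x)" for z
  have b: "\<bar>f r s - f r0 s0\<bar> \<le> B (r, s)" if r: "r \<in> {0..T}" and s: "s \<in> {0..T}" for r s
  proof -
    note i = L2_inner_integrable
    have "f r s - f r0 s0 = (LINT x|lebesgue_on \<Omega>. (M r x - M r0 x) \<bullet> N s x) + (LINT x|lebesgue_on \<Omega>. M r0 x \<bullet> (N s x - N s0 x))"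
      using i[OF LM[OF r] LN[OF s]] i[OF LM[OF rs(2)] LN[OF s]] i[OF LM[OF rs(2)] LN[OF rs(3)]]
      by (simp add: f_def inner_diff)
    moreover have "\<bar>LINT x|lebesgue_on \<Omega>. (M r x - M r0 x) \<bullet> N s x\<bar> \<le> ?n (\<lambda>x. M r x - M r0 x) * ?n (N s)"
      by (intro L2_Cauchy_Schwarz L2_diff LM LN r s rs)
    moreover have "\<bar>LINT x|lebesgue_on \<Omega>. M r0 x \<bullet> (N s x - N s0 x)\<bar> \<le> ?n (M r0) * ?n (\<lambda>x. N s x - N s0 x)"
      by (intro L2_Cauchy_Schwarz L2_diff LM LN r s rs)
    moreover have "?n (N s) \<le> ?n (\<lambda>x. N s x - N s0 x) + ?n (N s0)"
      using L2_norm_triangle[OF L2_diff[OF LN[OF s] LN[OF rs(3)]] LN[OF rs(3)]] by simp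
    then have "?n (\<lambda>x. M r x - M r0 x) * ?n (N s) \<le> ?n (\<lambda>x. M r x - M r0 x) * (?n (\<lambda>x. N s x - N s0 x) + ?n (N s0))"
      by (rule mult_left_mono) simp
    ultimately show ?thesis unfolding B_def fst_conv snd_conv by linarith
  qed
  have T: "fst ` ?S = {0..T}" "snd ` ?S = {0..T}" using w by auto
  have zero: "?n (\<lambda>x. 0) = 0" by (simp add: L2_norm_def)
  have "continuous (at r0 within {0..T}) (\<lambda>r. ?n (\<lambda>x. M r x - M r0 x))"
    using cont_rep_norm_tendsto[OF M rs(2)] by (simp add: continuous_within zero)
  then have "continuous (at w within ?S) (\<lambda>z. ?n (\<lambda>x. M (fst z) x - M r0 x))"
    using continuous_within_compose2[OF continuous_fst[OF continuous_ident], of w ?S "\<lambda>r. ?n (\<lambda>x. M r x - M r0 x)"] T rs(1)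
    by simp
  then have 1: "((\<lambda>z. ?n (\<lambda>x. M (fst z) x - M r0 x)) \<longlongrightarrow> 0) (at w within ?S)"
    by (simp add: continuous_within rs(1) zero)
  have "continuous (at s0 within {0..T}) (\<lambda>s. ?n (\<lambda>x. N s x - N s0 x))"
    using cont_rep_norm_tendsto[OF N rs(3)] by (simp add: continuous_within zero)
  then have "continuous (at w within ?S) (\<lambda>z. ?n (\<lambda>x. N (snd z) x - N s0 x))"
    using continuous_within_compose2[OF continuous_snd[OF continuous_ident], of w ?S "\<lambda>s. ?n (\<lambda>x. N s x - N s0 x)"] T rs(1)
    by simp
  then have 2: "((\<lambda>z. ?n (\<lambda>x. N (snd z) x - N s0 x)) \<longlongrightarrow> 0) (at w within ?S)"
    by (simp add: continuous_within rs(1) zero)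
  have "(B \<longlongrightarrow> 0 * (0 + ?n (N s0)) + ?n (M r0) * 0) (at w within ?S)"
    unfolding B_def[abs_def] by (intro tendsto_add tendsto_mult tendsto_const 1 2)
  then have l: "(B \<longlongrightarrow> 0) (at w within ?S)" by simp
  have "((\<lambda>z. f (fst z) (snd z) - f r0 s0) \<longlongrightarrow> 0) (at w within ?S)"
    by (rule Lim_null_comparison[OF _ l]) (use b in \<open>auto simp: eventually_at_filter intro!: always_eventually\<close>)
  then show "((\<lambda>(r, s). LINT x|lebesgue_on \<Omega>. M r x \<bullet> N s x) \<longlongrightarrow> (case w of (r, s) \<Rightarrow> LINT x|lebesgue_on \<Omega>. M r x \<bullet> N s x)) (at w within ?S)"
    by (simp add: LIM_zero_iff rs f_def case_prod_unfold)
qed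


lemma weak_evolution_difference:
  assumes \<Omega>: "open \<Omega>" and T: "0 < T"
    and m: "m \<in> L2 (lebesgue_on (QT \<Omega> T))" and p: "p \<in> L2 (lebesgue_on (QT \<Omega> T))" and q: "q \<in> L2 (lebesgue_on (QT \<Omega> T))"
    and M: "cont_rep \<Omega> T m M"
    and weak: "\<And>\<Phi> G D P. admissible \<Omega> T X \<Phi> G D P \<Longrightarrow>
        - (LINT z|lebesgue_on (QT \<Omega> T). m z \<bullet> D z) + (LINT z|lebesgue_on (QT \<Omega> T). p z \<bullet> G z + q z \<bullet> \<Phi> z)
        = (LINT x|lebesgue_on \<Omega>. m0 x \<bullet> P 0 x)"
    and \<phi>: "\<phi> \<in> Hspace \<Omega>" and F: "has_curl \<Omega> \<phi> F" and X: "\<And>c. (\<lambda>x. c *\<^sub>R \<phi> x) \<in> X"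
    and ab: "0 \<le> a" "a \<le> b" "b \<le> T"
  shows "(LINT x|lebesgue_on \<Omega>. (M b x - M a x) \<bullet> \<phi> x)
    = - (LINT x|lebesgue_on \<Omega>. time_integral p a b x \<bullet> F x) - (LINT x|lebesgue_on \<Omega>. time_integral q a b x \<bullet> \<phi> x)"
proof -
  have \<phi>L: "\<phi> \<in> L2 (lebesgue_on \<Omega>)" and FL: "F \<in> L2 (lebesgue_on \<Omega>)"
    using \<phi> F by (auto simp: has_curl_def Hspace_def)
  let ?k1 = "\<lambda>s. LINT x|lebesgue_on \<Omega>. p (x, s) \<bullet> F x"
  let ?k2 = "\<lambda>s. LINT x|lebesgue_on \<Omega>. q (x, s) \<bullet> \<phi> x"
  have at: "a \<in> {0..T}" and bt: "b \<in> {0..T}" using ab by auto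
  have k: "integral {0..t} (\<lambda>s. ?k1 s + ?k2 s) = integral {0..t} ?k1 + integral {0..t} ?k2" if "t \<in> {0..T}" for t
  proof -
    have "?k1 integrable_on {0..T}" "?k2 integrable_on {0..T}"
      by (rule LINT_eq_integral_Icc(2)[OF L2_slice_inner_integrable(2)[OF \<Omega> p FL]],
          rule LINT_eq_integral_Icc(2)[OF L2_slice_inner_integrable(2)[OF \<Omega> q \<phi>L]])
    then have "?k1 integrable_on {0..t}" "?k2 integrable_on {0..t}"
      using that by (auto elim!: integrable_on_subinterval)
    then show ?thesis by (rule Henstock_Kurzweil_Integration.integral_add)
  qed
  have ev: "(LINT x|lebesgue_on \<Omega>. M t x \<bullet> \<phi> x) = (LINT x|lebesgue_on \<Omega>. m0 x \<bullet> \<phi> x)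
      - integral {0..t} (\<lambda>s. ?k1 s + ?k2 s)" if "t \<in> {0..T}" for t
    by (rule weak_evolution[OF \<Omega> T m p q M _ \<phi> F X that]) (rule weak)
  have "(LINT x|lebesgue_on \<Omega>. (M b x - M a x) \<bullet> \<phi> x)
      = (LINT x|lebesgue_on \<Omega>. M b x \<bullet> \<phi> x) - (LINT x|lebesgue_on \<Omega>. M a x \<bullet> \<phi> x)"
    using L2_inner_integrable[OF cont_rep_L2[OF M at] \<phi>L] L2_inner_integrable[OF cont_rep_L2[OF M bt] \<phi>L]
    by (simp add: inner_diff_left)
  also have "\<dots> = integral {0..a} (\<lambda>s. ?k1 s + ?k2 s) - integral {0..b} (\<lambda>s. ?k1 s + ?k2 s)"
    using ev[OF at] ev[OF bt] by simp
  also have "\<dots> = - (LINT x|lebesgue_on \<Omega>. time_integral p a b x \<bullet> F x) - (LINT x|lebesgue_on \<Omega>. time_integral q a b x \<bullet> \<phi> x)"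
    unfolding k[OF at] k[OF bt] LINT_time_integral_difference(1)[OF \<Omega> p ab FL]
      LINT_time_integral_difference(1)[OF \<Omega> q ab \<phi>L] by simp
  finally show ?thesis .
qed

text \<open>
  \<open>weak_evolution\<close> at time 0 determines the products of \<open>M(0)\<close> with all smooth compactly supported fields.
\<close>

lemma weak_initial_value:
  assumes \<Omega>: "open \<Omega>" and T: "0 < T"
    and m: "m \<in> L2 (lebesgue_on (QT \<Omega> T))" and p: "p \<in> L2 (lebesgue_on (QT \<Omega> T))" and q: "q \<in> L2 (lebesgue_on (QT \<Omega> T))"
    and M: "cont_rep \<Omega> T m M" and m0: "m0 \<in> Hspace \<Omega>"
    and weak: "\<And>\<Phi> G D P. admissible \<Omega> T X \<Phi> G D P \<Longrightarrow>
        - (LINT z|lebesgue_on (QT \<Omega> T). m z \<bullet> D z) + (LINT z|lebesgue_on (QT \<Omega> T). p z \<bullet> G z + q z \<bullet> \<Phi> z)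
        = (LINT x|lebesgue_on \<Omega>. m0 x \<bullet> P 0 x)"
    and X: "V0space \<Omega> \<subseteq> X"
  shows "AE x in lebesgue_on \<Omega>. M 0 x = m0 x"
proof -
  have \<Omega>l: "\<Omega> \<in> sets lebesgue" using \<Omega> by auto
  have T0: "0 \<in> {0..T}" using T by simp
  have m0L: "m0 \<in> L2 (lebesgue_on \<Omega>)" using m0 by (simp add: Hspace_def)
  have "AE x in lebesgue_on \<Omega>. M 0 x - m0 x = 0"
  proof (rule fundamental_lemma[OF \<Omega>])
    show "(\<lambda>x. M 0 x - m0 x) \<in> Hspace \<Omega>"
      using L2_diff[OF cont_rep_L2[OF M T0] m0L] by (simp add: Hspace_def)
    fix \<phi> assume \<phi>: "\<phi> \<in> test_fields \<Omega>"
    have L: "\<phi> \<in> L2 (lebesgue_on \<Omega>)" by (rule test_fields_L2[OF \<phi> \<Omega>l])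
    have "(LINT x|lebesgue_on \<Omega>. M 0 x \<bullet> \<phi> x) = (LINT x|lebesgue_on \<Omega>. m0 x \<bullet> \<phi> x)"
    proof -
      have \<phi>H: "\<phi> \<in> Hspace \<Omega>" using L by (simp add: Hspace_def)
      have cX: "(\<lambda>x. c *\<^sub>R \<phi> x) \<in> X" for c
        using V0space_scaleR[OF \<Omega> test_fields_V0space[OF \<Omega> \<phi>]] X by blast
      have "(LINT x|lebesgue_on \<Omega>. M 0 x \<bullet> \<phi> x) = (LINT x|lebesgue_on \<Omega>. m0 x \<bullet> \<phi> x)
        - integral {0..0} (\<lambda>s. (LINT x|lebesgue_on \<Omega>. p (x, s) \<bullet> classical_curl \<phi> x) + (LINT x|lebesgue_on \<Omega>. q (x, s) \<bullet> \<phi> x))"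
        by (rule weak_evolution[OF \<Omega> T m p q M _ \<phi>H test_fields_has_curl[OF \<Omega> \<phi>] cX T0]) (rule weak)
      then show ?thesis by simp
    qed
    then show "(LINT x|lebesgue_on \<Omega>. (M 0 x - m0 x) \<bullet> \<phi> x) = 0"
      using L2_inner_integrable[OF cont_rep_L2[OF M T0] L] L2_inner_integrable[OF m0L L]
      by (simp add: inner_diff_left)
  qed
  then show ?thesis by simp
qed

lemma LINT_time_integral_cont_rep:
  assumes \<Omega>: "open \<Omega>" and m: "m \<in> L2 (lebesgue_on (QT \<Omega> T))" and M: "cont_rep \<Omega> T m M"
    and ab: "0 \<le> a" "a \<le> b" "b \<le> T" and v: "v \<in> L2 (lebesgue_on \<Omega>)"
  shows "(LINT x|lebesgue_on \<Omega>. time_integral m a b x \<bullet> v x) = integral {a..b} (\<lambda>s. LINT x|lebesgue_on \<Omega>. M s x \<bullet> v x)"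
proof -
  let ?f = "\<lambda>s. LINT x|lebesgue_on \<Omega>. m (x, s) \<bullet> v x" and ?g = "\<lambda>s. LINT x|lebesgue_on \<Omega>. M s x \<bullet> v x"
  have I: "{0<..<T} \<in> sets lebesgue" by simp
  have "AE s in lebesgue_on {0<..<T}. AE x in lebesgue_on \<Omega>. m (x, s) = M s x" using M by (simp add: cont_rep_def)
  with L2_slice_inner_integrable(1)[OF \<Omega> m v] AE_space
  have "AE s in lebesgue_on {0<..<T}. ?f s = ?g s"
  proof eventually_elim
    case (elim s)
    then have Ms: "M s \<in> L2 (lebesgue_on \<Omega>)" by (intro cont_rep_L2[OF M]) auto
    have "AE x in lebesgue_on \<Omega>. m (x, s) \<bullet> v x = M s x \<bullet> v x"
      using elim(3) by eventually_elim simp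
    then show ?case
      by (rule integral_cong_AE[OF borel_measurable_integrable[OF elim(1)]
        borel_measurable_integrable[OF L2_inner_integrable[OF Ms v]]])
  qed
  then obtain N where N: "N \<in> null_sets lborel" "{s. \<not> (s \<in> {0<..<T} \<longrightarrow> ?f s = ?g s)} \<subseteq> N"
    unfolding AE_lebesgue_on_iff[OF I] by (auto elim!: AE_E simp: null_sets_def)
  have "integral {a..b} ?f = integral {a..b} ?g"
  proof (rule integral_spike[where S="N \<union> {0, T}"])
    have "negligible N" using N(1) by (simp add: negligible_iff_null_sets null_sets_completionI)
    then show "negligible (N \<union> {0, T})" by simp
    show "?g s = ?f s" if "s \<in> {a..b} - (N \<union> {0, T})" for s
    proof -
      have "s \<in> {0<..<T}" "s \<notin> N" using that ab by auto
      then show ?thesis using N(2) by auto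
    qed
  qed
  then show ?thesis using LINT_time_integral_difference(2)[OF \<Omega> m ab v] by simp
qed

section \<open>Energy of the difference of two weak solutions\<close>

text \<open>
  Along simple functions the composition is a finite sum of functions that are measurable by hypothesis; continuity in
  the last variable, which holds off a null set \<open>N\<close>, passes to the limit.
\<close>

lemma caratheodory_superposition_L2:
  assumes \<Omega>: "open \<Omega>" and g: "caratheodory \<Omega> T g"
    and bnd: "\<forall>z\<in>QT \<Omega> T. \<forall>\<xi>. norm (g z \<xi>) \<le> c * norm \<xi>" and u: "u \<in> L2 (lebesgue_on (QT \<Omega> T))"
  shows "(\<lambda>z. g z (u z)) \<in> L2 (lebesgue_on (QT \<Omega> T))"
proof (rule L2_bound[OF u, of _ c])
  let ?M = "lebesgue_on (QT \<Omega> T)"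
  have gm: "(\<lambda>z. g z \<xi>) \<in> borel_measurable ?M" for \<xi> using g by (simp add: caratheodory_def)
  obtain F where F: "\<And>i. simple_function ?M (F i)" "\<And>z. z \<in> space ?M \<Longrightarrow> (\<lambda>i. F i z) \<longlonglongrightarrow> u z"
    using borel_measurable_implies_sequence_metric[OF L2_measurable[OF u], of 0] by metis
  have gF: "(\<lambda>z. g z (F i z)) \<in> borel_measurable ?M" for i
  proof -
    have "(\<lambda>z. \<Sum>y\<in>F i ` space ?M. indicat_real (F i -` {y} \<inter> space ?M) z *\<^sub>R g z y) \<in> borel_measurable ?M"
      using simple_functionD(2)[OF F(1)]
      by (intro borel_measurable_sum borel_measurable_scaleR borel_measurable_indicator gm)
    moreover have "g z (F i z) = (\<Sum>y\<in>F i ` space ?M. indicat_real (F i -` {y} \<inter> space ?M) z *\<^sub>R g z y)"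
      if z: "z \<in> space ?M" for z
    proof -
      have "(\<Sum>y\<in>F i ` space ?M. indicat_real (F i -` {y} \<inter> space ?M) z *\<^sub>R g z y)
          = (\<Sum>y\<in>F i ` space ?M. if y = F i z then g z y else 0)"
        using z by (intro sum.cong) (auto simp: indicator_def)
      also have "\<dots> = g z (F i z)" using z simple_functionD(1)[OF F(1)[of i]] by simp
      finally show ?thesis by simp
    qed
    ultimately show ?thesis by (subst measurable_cong)
  qed
  have "AE z in ?M. continuous_on UNIV (g z)" using g by (simp add: caratheodory_def)
  then obtain N where N: "N \<in> sets ?M" "emeasure ?M N = 0" "{z \<in> space ?M. \<not> continuous_on UNIV (g z)} \<subseteq> N"
    by (auto elim!: AE_E)
  have h: "(\<lambda>z. indicat_real (- N) z *\<^sub>R g z (u z)) \<in> borel_measurable ?M"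
  proof (rule borel_measurable_LIMSEQ_metric)
    show "(\<lambda>z. indicat_real (- N) z *\<^sub>R g z (F i z)) \<in> borel_measurable ?M" for i
    proof (intro borel_measurable_scaleR gF)
      have "indicat_real (- N) = (\<lambda>z. 1 - indicat_real N z)" by (auto simp: indicator_def)
      then show "indicat_real (- N) \<in> borel_measurable ?M" using N(1) by simp
    qed
    fix z assume z: "z \<in> space ?M"
    show "(\<lambda>i. indicat_real (- N) z *\<^sub>R g z (F i z)) \<longlonglongrightarrow> indicat_real (- N) z *\<^sub>R g z (u z)"
    proof (cases "z \<in> N")
      case False
      then have "continuous_on UNIV (g z)" using N(3) z by blast
      then have "(\<lambda>i. g z (F i z)) \<longlonglongrightarrow> g z (u z)"
        by (rule continuous_on_tendsto_compose[OF _ F(2)[OF z]]) simp_all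
      then show ?thesis by (intro tendsto_scaleR tendsto_const)
    qed simp
  qed
  have "AE z in ?M. z \<notin> N" by (rule AE_not_in) (use N in auto)
  then have "AE z in ?M. indicat_real (- N) z *\<^sub>R g z (u z) = g z (u z)" by eventually_elim simp
  then show "(\<lambda>z. g z (u z)) \<in> borel_measurable ?M"
    by (rule borel_measurable_lebesgue_on_AE[OF QT_lebesgue[OF \<Omega>] h])
  show "AE z in ?M. norm (g z (u z)) \<le> c * norm (u z)"
    by (rule AE_I2) (use bnd in simp)
qed

lemma symmetric_matrix_inner:
  fixes a :: "real^'n^'n"
  assumes "transpose a = a" shows "(a *v u) \<bullet> v = (a *v v) \<bullet> u"
proof -
  have "(a *v v) \<bullet> u = u \<bullet> (a *v v)" by (rule inner_commute)
  also have "\<dots> = (u v* a) \<bullet> v" by (rule dot_lmul_matrix[symmetric])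
  also have "\<dots> = (transpose a *v u) \<bullet> v" by simp
  finally show ?thesis using assms by simp
qed

text \<open>
  The linear system satisfied by the difference of two solutions; all that is retained of the nonlinearity
  is the sign condition \<open>monotone\<close>. In the equation for \<open>h\<close> the vanishing term \<open>0 \<bullet> \<Psi> z\<close> gives both equations the
  shape of \<open>weak_evolution\<close>.
\<close>

locale maxwell_difference =
  fixes \<Omega> :: "(real^3) set" and T :: real and \<epsilon> \<mu> :: "real^3 \<Rightarrow> real^3^3"
    and e h q :: tfield and e0 h0 :: vfield and E H :: "real \<Rightarrow> vfield"
  assumes \<Omega>: "open \<Omega>" and T: "0 < T"
    and \<epsilon>: "bdd_meas_matrix_field \<Omega> \<epsilon>" and \<mu>: "bdd_meas_matrix_field \<Omega> \<mu>"
    and sym\<epsilon>: "\<And>x. x \<in> \<Omega> \<Longrightarrow> transpose (\<epsilon> x) = \<epsilon> x" and sym\<mu>: "\<And>x. x \<in> \<Omega> \<Longrightarrow> transpose (\<mu> x) = \<mu> x"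
    and e: "e \<in> L2 (lebesgue_on (QT \<Omega> T))" and h: "h \<in> L2 (lebesgue_on (QT \<Omega> T))"
    and q: "q \<in> L2 (lebesgue_on (QT \<Omega> T))"
    and E: "cont_rep \<Omega> T e E" and H: "cont_rep \<Omega> T h H"
    and weak_e: "\<And>\<Phi> G D P. admissible \<Omega> T (V0space \<Omega>) \<Phi> G D P \<Longrightarrow>
        - (LINT z|lebesgue_on (QT \<Omega> T). (\<epsilon> (fst z) *v e z) \<bullet> D z)
        + (LINT z|lebesgue_on (QT \<Omega> T). - h z \<bullet> G z + q z \<bullet> \<Phi> z)
        = (LINT x|lebesgue_on \<Omega>. (\<epsilon> x *v e0 x) \<bullet> P 0 x)"
    and weak_h: "\<And>\<Psi> G D P. admissible \<Omega> T (Vspace \<Omega>) \<Psi> G D P \<Longrightarrow>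
        - (LINT z|lebesgue_on (QT \<Omega> T). (\<mu> (fst z) *v h z) \<bullet> D z)
        + (LINT z|lebesgue_on (QT \<Omega> T). e z \<bullet> G z + 0 \<bullet> \<Psi> z)
        = (LINT x|lebesgue_on \<Omega>. (\<mu> x *v h0 x) \<bullet> P 0 x)"
    and monotone: "\<And>z. z \<in> QT \<Omega> T \<Longrightarrow> 0 \<le> q z \<bullet> e z"
begin

text \<open>
  The polarized energy; the energy itself is its restriction to the diagonal. Unlike the energy, it can be
  integrated in one of its arguments, which is what testing with time integrals produces.
\<close>

definition two_time_energy :: "real \<Rightarrow> real \<Rightarrow> real" where
  "two_time_energy r s = weighted_inner \<Omega> \<epsilon> (E r) (E s) + weighted_inner \<Omega> \<mu> (H r) (H s)"

lemma cont_rep_\<epsilon>E: "cont_rep \<Omega> T (\<lambda>z. \<epsilon> (fst z) *v e z) (\<lambda>t x. \<epsilon> x *v E t x)"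
  by (rule cont_rep_matrix_field[OF \<Omega> \<epsilon> E])

lemma cont_rep_\<mu>H: "cont_rep \<Omega> T (\<lambda>z. \<mu> (fst z) *v h z) (\<lambda>t x. \<mu> x *v H t x)"
  by (rule cont_rep_matrix_field[OF \<Omega> \<mu> H])

lemma two_time_energy_continuous: "continuous_on ({0..T} \<times> {0..T}) (\<lambda>(r, s). two_time_energy r s)"
  using continuous_on_add[OF cont_rep_inner_continuous2[OF cont_rep_\<epsilon>E E] cont_rep_inner_continuous2[OF cont_rep_\<mu>H H]]
  by (simp add: two_time_energy_def weighted_inner_def case_prod_unfold)

lemma two_time_energy_commute: "two_time_energy r s = two_time_energy s r"
  unfolding two_time_energy_def weighted_inner_def
  by (intro arg_cong2[where f="(+)"] Bochner_Integration.integral_cong)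
    (simp_all add: symmetric_matrix_inner[OF sym\<epsilon>, of _ "E r _" "E s _"] symmetric_matrix_inner[OF sym\<mu>, of _ "H r _" "H s _"])

lemma LINT_time_integral_weighted:
  assumes a: "bdd_meas_matrix_field \<Omega> a" and m: "m \<in> L2 (lebesgue_on (QT \<Omega> T))" and M: "cont_rep \<Omega> T m M"
    and rs: "0 \<le> r" "r \<le> s" "s \<le> T"
  shows "(LINT x|lebesgue_on \<Omega>. (a x *v M s x - a x *v M r x) \<bullet> time_integral m r s x)
      = integral {r..s} (\<lambda>\<tau>. weighted_inner \<Omega> a (M s) (M \<tau>) - weighted_inner \<Omega> a (M r) (M \<tau>))"
proof -
  have st: "s \<in> {0..T}" and rt: "r \<in> {0..T}" using rs by auto
  note aL = matrix_field_L2[OF a cont_rep_L2[OF M st] \<Omega>] matrix_field_L2[OF a cont_rep_L2[OF M rt] \<Omega>]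
  have "(LINT x|lebesgue_on \<Omega>. (a x *v M s x - a x *v M r x) \<bullet> time_integral m r s x)
      = integral {r..s} (\<lambda>\<tau>. LINT x|lebesgue_on \<Omega>. M \<tau> x \<bullet> (a x *v M s x - a x *v M r x))"
    using LINT_time_integral_cont_rep[OF \<Omega> m M rs L2_diff[OF aL]] by (simp add: inner_commute)
  also have "\<dots> = integral {r..s} (\<lambda>\<tau>. weighted_inner \<Omega> a (M s) (M \<tau>) - weighted_inner \<Omega> a (M r) (M \<tau>))"
  proof (rule integral_cong)
    fix \<tau> assume "\<tau> \<in> {r..s}"
    then have \<tau>: "\<tau> \<in> {0..T}" using rs by auto
    show "(LINT x|lebesgue_on \<Omega>. M \<tau> x \<bullet> (a x *v M s x - a x *v M r x)) = weighted_inner \<Omega> a (M s) (M \<tau>) - weighted_inner \<Omega> a (M r) (M \<tau>)"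
      using L2_inner_integrable[OF aL(1) cont_rep_L2[OF M \<tau>]] L2_inner_integrable[OF aL(2) cont_rep_L2[OF M \<tau>]]
      by (simp add: weighted_inner_def inner_diff_right inner_commute[of "M \<tau> _"])
  qed
  finally show ?thesis .
qed

lemma weighted_inner_continuous:
  assumes a: "bdd_meas_matrix_field \<Omega> a" and M: "cont_rep \<Omega> T m M" and s: "s \<in> {0..T}"
  shows "continuous_on {0..T} (\<lambda>\<tau>. weighted_inner \<Omega> a (M s) (M \<tau>))"
  using cont_rep_inner_continuous[OF M matrix_field_L2[OF a cont_rep_L2[OF M s] \<Omega>]]
  by (simp add: weighted_inner_def inner_commute)

text \<open>
  The equation for \<open>h\<close> says that \<open>A\<close> lies in \<open>V\<^sub>0\<close> with curl \<open>-W\<close>. This makes \<open>A\<close> admissible in the equation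
  for \<open>e\<close>, where the term with the curl turns into the product of \<open>W\<close> and \<open>B\<close>.
\<close>

lemma energy_identity:
  assumes ab: "0 \<le> a" "a \<le> b" "b \<le> T"
  shows "integral {a..b} (\<lambda>s. two_time_energy b s - two_time_energy a s)
    = - (LINT x|lebesgue_on \<Omega>. time_integral q a b x \<bullet> time_integral e a b x)"
proof -
  define A where "A = time_integral e a b"
  define B where "B = time_integral h a b"
  define W where "W x = \<mu> x *v H b x - \<mu> x *v H a x" for x
  have at: "a \<in> {0..T}" and bt: "b \<in> {0..T}" using ab by auto
  have AL: "A \<in> L2 (lebesgue_on \<Omega>)" unfolding A_def by (rule time_integral_L2[OF \<Omega> e ab])
  have AH: "A \<in> Hspace \<Omega>" using AL by (simp add: Hspace_def)
  have WL: "W \<in> L2 (lebesgue_on \<Omega>)"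
    unfolding W_def by (intro L2_diff cont_rep_L2[OF cont_rep_\<mu>H] at bt)
  have curlA: "(LINT x|lebesgue_on \<Omega>. - W x \<bullet> \<psi> x) = (LINT x|lebesgue_on \<Omega>. A x \<bullet> G x)"
    if \<psi>: "\<psi> \<in> Hspace \<Omega>" and G: "has_curl \<Omega> \<psi> G" for \<psi> G
  proof -
    have X: "(\<lambda>x. c *\<^sub>R \<psi> x) \<in> Vspace \<Omega>" for c
      by (rule Vspace_scaleR) (use \<psi> G in \<open>auto simp: Vspace_def\<close>)
    have "(LINT x|lebesgue_on \<Omega>. W x \<bullet> \<psi> x)
        = - (LINT x|lebesgue_on \<Omega>. A x \<bullet> G x) - (LINT x|lebesgue_on \<Omega>. time_integral (\<lambda>z. 0) a b x \<bullet> \<psi> x)"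
      unfolding W_def A_def
      by (rule weak_evolution_difference[OF \<Omega> T matrix_field_L2_QT[OF \<mu> h \<Omega>] e L2_zero cont_rep_\<mu>H _ \<psi> G X ab])
        (rule weak_h)
    then show ?thesis by (simp add: time_integral_def)
  qed
  have cA: "has_curl \<Omega> A (\<lambda>x. - W x)"
    unfolding has_curl_def
  proof (intro conjI ballI)
    show "(\<lambda>x. - W x) \<in> Hspace \<Omega>" using L2_minus[OF WL] by (simp add: Hspace_def)
    fix \<phi> assume \<phi>: "\<phi> \<in> test_fields \<Omega>"
    have "\<phi> \<in> Hspace \<Omega>" using test_fields_L2[OF \<phi>, of \<Omega>] \<Omega> by (simp add: Hspace_def)
    from curlA[OF this test_fields_has_curl[OF \<Omega> \<phi>]]
    show "(LINT x|lebesgue_on \<Omega>. A x \<bullet> classical_curl \<phi> x) = (LINT x|lebesgue_on \<Omega>. - W x \<bullet> \<phi> x)" by simp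
  qed
  have AV: "A \<in> V0space \<Omega>" by (rule V0spaceI[OF \<Omega> AH cA curlA])
  have "(LINT x|lebesgue_on \<Omega>. (\<epsilon> x *v E b x - \<epsilon> x *v E a x) \<bullet> A x)
      = - (LINT x|lebesgue_on \<Omega>. time_integral (\<lambda>z. - h z) a b x \<bullet> - W x) - (LINT x|lebesgue_on \<Omega>. time_integral q a b x \<bullet> A x)"
    by (rule weak_evolution_difference[OF \<Omega> T matrix_field_L2_QT[OF \<epsilon> e \<Omega>] L2_minus[OF h] q cont_rep_\<epsilon>E _ AH cA V0space_scaleR[OF \<Omega> AV] ab])
      (rule weak_e)
  also have "time_integral (\<lambda>z. - h z) a b = (\<lambda>x. - B x)"
    by (auto simp: time_integral_def B_def)
  finally have 1: "(LINT x|lebesgue_on \<Omega>. (\<epsilon> x *v E b x - \<epsilon> x *v E a x) \<bullet> A x) + (LINT x|lebesgue_on \<Omega>. W x \<bullet> B x)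
      = - (LINT x|lebesgue_on \<Omega>. time_integral q a b x \<bullet> A x)"
    by (simp add: inner_commute)
  have sub: "{a..b} \<subseteq> {0..T}" using ab by auto
  have ci: "(\<lambda>\<tau>. weighted_inner \<Omega> \<epsilon> (E b) (E \<tau>) - weighted_inner \<Omega> \<epsilon> (E a) (E \<tau>)) integrable_on {a..b}"
    "(\<lambda>\<tau>. weighted_inner \<Omega> \<mu> (H b) (H \<tau>) - weighted_inner \<Omega> \<mu> (H a) (H \<tau>)) integrable_on {a..b}"
    by (intro integrable_continuous_real continuous_on_diff continuous_on_subset[OF _ sub]
        weighted_inner_continuous[OF \<epsilon> E] weighted_inner_continuous[OF \<mu> H] at bt)+
  have "integral {a..b} (\<lambda>s. two_time_energy b s - two_time_energy a s)
    = integral {a..b} (\<lambda>\<tau>. (weighted_inner \<Omega> \<epsilon> (E b) (E \<tau>) - weighted_inner \<Omega> \<epsilon> (E a) (E \<tau>))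
        + (weighted_inner \<Omega> \<mu> (H b) (H \<tau>) - weighted_inner \<Omega> \<mu> (H a) (H \<tau>)))"
    by (rule integral_cong) (simp add: two_time_energy_def)
  also have "\<dots> = (LINT x|lebesgue_on \<Omega>. (\<epsilon> x *v E b x - \<epsilon> x *v E a x) \<bullet> A x) + (LINT x|lebesgue_on \<Omega>. W x \<bullet> B x)"
    unfolding Henstock_Kurzweil_Integration.integral_add[OF ci] A_def B_def W_def
      LINT_time_integral_weighted[OF \<epsilon> e E ab] LINT_time_integral_weighted[OF \<mu> h H ab] ..
  finally show ?thesis using 1 by (simp add: A_def)
qed

text \<open>
  The square of the norm of \<open>E(s) - E(r)\<close> is a combination of values of the continuous function
  \<open>f(r, s) = (E(r), E(s))\<close> on a compact square, taken in nearby pairs.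
\<close>

lemma E_uniformly_continuous:
  assumes "0 < \<eta>"
  shows "\<exists>\<delta>>0. \<forall>r\<in>{0..T}. \<forall>s\<in>{0..T}. \<bar>r - s\<bar> < \<delta> \<longrightarrow> L2_norm (lebesgue_on \<Omega>) (\<lambda>x. E s x - E r x) < \<eta>"
proof -
  define f where "f = (\<lambda>(r, s). LINT x|lebesgue_on \<Omega>. E r x \<bullet> E s x)"
  have "uniformly_continuous_on ({0..T} \<times> {0..T}) f"
    unfolding f_def by (intro compact_uniformly_continuous cont_rep_inner_continuous2[OF E E] compact_Times compact_Icc)
  moreover have "0 < \<eta>\<^sup>2 / 2" using assms by simp
  ultimately obtain \<delta> where \<delta>: "\<delta> > 0"
    "\<And>z w. z \<in> {0..T} \<times> {0..T} \<Longrightarrow> w \<in> {0..T} \<times> {0..T} \<Longrightarrow> dist w z < \<delta> \<Longrightarrow> dist (f w) (f z) < \<eta>\<^sup>2 / 2"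
    unfolding uniformly_continuous_on_def by meson
  have "L2_norm (lebesgue_on \<Omega>) (\<lambda>x. E s x - E r x) < \<eta>"
    if r: "r \<in> {0..T}" and s: "s \<in> {0..T}" and rs: "\<bar>r - s\<bar> < \<delta>" for r s
  proof -
    note i = L2_inner_integrable[OF cont_rep_L2[OF E] cont_rep_L2[OF E]]
    have "(L2_norm (lebesgue_on \<Omega>) (\<lambda>x. E s x - E r x))\<^sup>2
        = (LINT x|lebesgue_on \<Omega>. (E s x \<bullet> E s x - E r x \<bullet> E s x) + (E r x \<bullet> E r x - E s x \<bullet> E r x))"
      unfolding L2_norm_power2
      by (rule Bochner_Integration.integral_cong) (auto simp: inner_diff inner_commute algebra_simps)
    also have "\<dots> = (f (s, s) - f (r, s)) + (f (r, r) - f (s, r))"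
      using i[OF s s] i[OF r s] i[OF r r] i[OF s r] by (simp add: f_def)
    also have "\<dots> < \<eta>\<^sup>2 / 2 + \<eta>\<^sup>2 / 2"
    proof (rule add_strict_mono)
      have "dist (f (s, s)) (f (r, s)) < \<eta>\<^sup>2 / 2"
        by (rule \<delta>(2)) (use r s rs in \<open>auto simp: dist_Pair_Pair dist_real_def abs_minus_commute\<close>)
      then show "f (s, s) - f (r, s) < \<eta>\<^sup>2 / 2" unfolding dist_real_def by linarith
      have "dist (f (r, r)) (f (s, r)) < \<eta>\<^sup>2 / 2"
        by (rule \<delta>(2)) (use r s rs in \<open>auto simp: dist_Pair_Pair dist_real_def abs_minus_commute\<close>)
      then show "f (r, r) - f (s, r) < \<eta>\<^sup>2 / 2" unfolding dist_real_def by linarith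
    qed
    finally have "(L2_norm (lebesgue_on \<Omega>) (\<lambda>x. E s x - E r x))\<^sup>2 < \<eta>\<^sup>2" by simp
    then show ?thesis using assms by (intro power_less_imp_less_base[of _ 2 \<eta>]) auto
  qed
  then show ?thesis using \<delta>(1) by (intro exI[of _ \<delta>]) auto
qed

definition q_norm :: "real \<Rightarrow> real" where
  "q_norm s = L2_norm (lebesgue_on \<Omega>) (\<lambda>x. q (x, s))"

lemma q_norm_integrable: "integrable (lebesgue_on {0<..<T}) q_norm"
proof (rule Bochner_Integration.integrable_bound)
  have i: "integrable (lebesgue_on {0<..<T}) (\<lambda>s. LINT x|lebesgue_on \<Omega>. q (x, s) \<bullet> q (x, s))"
    using Fubini_lebesgue_on(2)[OF _ _ L2_inner_integrable[OF q q, unfolded QT_def]] \<Omega> by simp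
  have "integrable (lebesgue_on {0<..<T}) (\<lambda>s. 1 :: real)" by (rule integrable_continuous_Ioo) simp
  then show "integrable (lebesgue_on {0<..<T}) (\<lambda>s. 1 + (LINT x|lebesgue_on \<Omega>. q (x, s) \<bullet> q (x, s)))"
    using i by simp
  show "q_norm \<in> borel_measurable (lebesgue_on {0<..<T})"
    unfolding q_norm_def[abs_def] L2_norm_def using borel_measurable_integrable[OF i] by measurable
  show "AE s in lebesgue_on {0<..<T}. norm (q_norm s) \<le> norm (1 + (LINT x|lebesgue_on \<Omega>. q (x, s) \<bullet> q (x, s)))"
  proof (rule AE_I2)
    fix s
    have "q_norm s \<le> 1 + (q_norm s)\<^sup>2"
      using sum_squares_bound[of 1 "q_norm s"] L2_norm_nonneg[of "lebesgue_on \<Omega>" "\<lambda>x. q (x, s)"]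
      unfolding q_norm_def power_one mult_1_right by linarith
    moreover have "(q_norm s)\<^sup>2 = (LINT x|lebesgue_on \<Omega>. q (x, s) \<bullet> q (x, s))"
      by (simp add: q_norm_def L2_norm_power2)
    ultimately show "norm (q_norm s) \<le> norm (1 + (LINT x|lebesgue_on \<Omega>. q (x, s) \<bullet> q (x, s)))"
      by (simp add: q_norm_def)
  qed
qed

text \<open>
  Up to the order of integration, the scalar product on the left is the double integral of \<open>(q(s), E(\<sigma>))\<close>
  over \<open>s, \<sigma> \<in> [a, b]\<close>. The sign condition gives \<open>(q(s), E(s)) \<ge> 0\<close>, and replacing
  \<open>E(s)\<close> by \<open>E(\<sigma>)\<close> costs at most \<open>\<eta>\<close> times the norm of \<open>q(s)\<close>.
\<close>

lemma dissipation_lower_bound: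
  assumes ab: "0 \<le> a" "a \<le> b" "b \<le> T" and \<eta>: "0 < \<eta>"
    and E_near: "\<And>r s. r \<in> {a..b} \<Longrightarrow> s \<in> {a..b} \<Longrightarrow> L2_norm (lebesgue_on \<Omega>) (\<lambda>x. E s x - E r x) \<le> \<eta>"
  shows "- (LINT x|lebesgue_on \<Omega>. time_integral q a b x \<bullet> time_integral e a b x)
    \<le> (b - a) * \<eta> * integral {a..b} q_norm"
proof -
  define A where "A = time_integral e a b"
  have AL: "A \<in> L2 (lebesgue_on \<Omega>)" unfolding A_def by (rule time_integral_L2[OF \<Omega> e ab])
  have I: "{a<..<b} \<in> sets lebesgue" "{0<..<T} \<in> sets lebesgue" by auto
  have "AE s in lebesgue_on {0<..<T}. AE x in lebesgue_on \<Omega>. e (x, s) = E s x" using E by (simp add: cont_rep_def)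
  moreover have "AE s in lebesgue_on {0<..<T}. (\<lambda>x. q (x, s)) \<in> L2 (lebesgue_on \<Omega>)"
    by (rule L2_slices(1)[OF _ _ q[unfolded QT_def]]) (use \<Omega> in auto)
  moreover have "AE s in lebesgue_on {0<..<T}. (\<lambda>x. e (x, s)) \<in> L2 (lebesgue_on \<Omega>)"
    by (rule L2_slices(1)[OF _ _ e[unfolded QT_def]]) (use \<Omega> in auto)
  ultimately have "AE s in lebesgue_on {0<..<T}. s \<in> {a<..<b} \<longrightarrow>
      - (LINT x|lebesgue_on \<Omega>. q (x, s) \<bullet> A x) \<le> (b - a) * \<eta> * q_norm s"
    using AE_space
  proof eventually_elim
    case (elim s)
    show ?case
    proof
      assume s: "s \<in> {a<..<b}"
      have sT: "s \<in> {0..T}" "s \<in> {a..b}" using s ab by auto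
      let ?f = "\<lambda>\<sigma>. LINT x|lebesgue_on \<Omega>. E \<sigma> x \<bullet> q (x, s)"
      have nonneg: "0 \<le> ?f s"
      proof -
        have "0 \<le> (LINT x|lebesgue_on \<Omega>. e (x, s) \<bullet> q (x, s))"
        proof (rule integral_nonneg_AE, rule AE_I2)
          fix x assume "x \<in> space (lebesgue_on \<Omega>)"
          then show "0 \<le> e (x, s) \<bullet> q (x, s)"
            using monotone[of "(x, s)"] elim(4) by (simp add: inner_commute QT_def)
        qed
        also have "\<dots> = ?f s"
          by (rule L2_inner_cong_AE)
            (use elim cont_rep_L2[OF E sT(1)] in \<open>simp_all add: L2_def\<close>)
        finally show ?thesis .
      qed
      have f: "- (\<eta> * q_norm s) \<le> ?f \<sigma>" if \<sigma>: "\<sigma> \<in> {a..b}" for \<sigma>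
      proof -
        have \<sigma>T: "\<sigma> \<in> {0..T}" using \<sigma> ab by auto
        have "?f \<sigma> - ?f s = (LINT x|lebesgue_on \<Omega>. (E \<sigma> x - E s x) \<bullet> q (x, s))"
          using L2_inner_integrable[OF cont_rep_L2[OF E \<sigma>T] elim(2)] L2_inner_integrable[OF cont_rep_L2[OF E sT(1)] elim(2)]
          by (simp add: inner_diff_left)
        moreover have "\<bar>LINT x|lebesgue_on \<Omega>. (E \<sigma> x - E s x) \<bullet> q (x, s)\<bar> \<le> L2_norm (lebesgue_on \<Omega>) (\<lambda>x. E \<sigma> x - E s x) * q_norm s"
          unfolding q_norm_def by (intro L2_Cauchy_Schwarz L2_diff cont_rep_L2[OF E] \<sigma>T sT elim(2))
        moreover have "L2_norm (lebesgue_on \<Omega>) (\<lambda>x. E \<sigma> x - E s x) * q_norm s \<le> \<eta> * q_norm s"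
          by (intro mult_right_mono E_near \<sigma> sT) (simp add: q_norm_def)
        ultimately show ?thesis using nonneg by linarith
      qed
      have fc: "continuous_on {a..b} ?f"
        by (rule continuous_on_subset[OF cont_rep_inner_continuous[OF E elim(2)]]) (use ab in auto)
      have "(LINT x|lebesgue_on \<Omega>. q (x, s) \<bullet> A x) = integral {a..b} ?f"
        using LINT_time_integral_cont_rep[OF \<Omega> e E ab elim(2)] by (simp add: A_def inner_commute)
      moreover have "integral {a..b} (\<lambda>\<sigma>. - (\<eta> * q_norm s)) \<le> integral {a..b} ?f"
        by (rule integral_le) (use f in \<open>auto intro!: integrable_continuous_real fc\<close>)
      ultimately show "- (LINT x|lebesgue_on \<Omega>. q (x, s) \<bullet> A x) \<le> (b - a) * \<eta> * q_norm s"
        using ab(2) by (simp add: algebra_simps)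
    qed
  qed
  then have ae: "AE s in lebesgue_on {a<..<b}. - (LINT x|lebesgue_on \<Omega>. q (x, s) \<bullet> A x) \<le> (b - a) * \<eta> * q_norm s"
    unfolding AE_lebesgue_on_iff[OF I(1)] AE_lebesgue_on_iff[OF I(2)]
    by eventually_elim (use ab in auto)
  have sub: "integrable (lebesgue_on {a<..<b}) f" if f: "integrable (lebesgue_on {0<..<T}) f" for f :: "real \<Rightarrow> real"
    by (rule integrable_lebesgue_on_subset[OF f _ I(2) I(1)]) (use ab in auto)
  note qi = sub[OF q_norm_integrable] and Ai = sub[OF L2_slice_inner_integrable(2)[OF \<Omega> q AL]]
  have "- (LINT x|lebesgue_on \<Omega>. time_integral q a b x \<bullet> A x) = (LINT s|lebesgue_on {a<..<b}. - (LINT x|lebesgue_on \<Omega>. q (x, s) \<bullet> A x))"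
    using LINT_time_integral[OF \<Omega> q ab AL] Ai by simp
  also have "\<dots> \<le> (LINT s|lebesgue_on {a<..<b}. (b - a) * \<eta> * q_norm s)"
    by (rule integral_mono_AE[OF _ _ ae]) (use qi Ai in simp_all)
  also have "\<dots> = (b - a) * \<eta> * integral {a..b} q_norm"
    using LINT_eq_integral_Icc(1)[OF qi] by simp
  finally show ?thesis unfolding A_def .
qed

lemma energy_decreasing:
  assumes t: "t \<in> {0..T}"
  shows "two_time_energy t t \<le> two_time_energy 0 0"
proof -
  \<comment> \<open>The dissipation over \<open>[t, t + l]\<close> is controlled by an increment of \<open>K\<close>, so the errors add up to at most \<open>K T\<close>.\<close>
  define K where "K t = integral {0..t} q_norm" for t
  have qI: "q_norm integrable_on {0..T}" by (rule LINT_eq_integral_Icc(2)[OF q_norm_integrable])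
  have qn: "0 \<le> q_norm s" for s by (simp add: q_norm_def)
  have qs: "q_norm integrable_on {a..b}" if "0 \<le> a" "b \<le> T" for a b
    by (rule integrable_on_subinterval[OF qI]) (use that in auto)
  have Kd: "K b - K a = integral {a..b} q_norm" if "0 \<le> a" "a \<le> b" "b \<le> T" for a b
    using Henstock_Kurzweil_Integration.integral_combine[of 0 a b q_norm] that qs by (simp add: K_def)
  show ?thesis
  proof (rule diagonal_decreasing[OF two_time_energy_continuous two_time_energy_commute _ _ _ _ t T])
    show "continuous_on {0..T} K"
      unfolding K_def by (rule indefinite_integral_continuous_1[OF qI])
    show "0 \<le> K s" if "s \<in> {0..T}" for s
      unfolding K_def by (rule integral_nonneg) (use that qs qn in auto)
    show "K s \<le> K T" if "s \<in> {0..T}" for s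
    proof -
      have "0 \<le> integral {s..T} q_norm" by (rule integral_nonneg) (use that qs qn in auto)
      then show ?thesis using Kd[of s T] that by simp
    qed
    fix \<eta> :: real assume \<eta>: "0 < \<eta>"
    obtain \<delta> where \<delta>: "\<delta> > 0" "\<And>r s. r \<in> {0..T} \<Longrightarrow> s \<in> {0..T} \<Longrightarrow> \<bar>r - s\<bar> < \<delta> \<Longrightarrow>
        L2_norm (lebesgue_on \<Omega>) (\<lambda>x. E s x - E r x) < \<eta>"
      using E_uniformly_continuous[OF \<eta>] by blast
    have "integral {t..t + l} (\<lambda>s. two_time_energy (t + l) s - two_time_energy t s) \<le> l * \<eta> * (K (t + l) - K t)"
      if l: "0 < l" "l < \<delta>" "0 \<le> t" "t + l \<le> T" for l t
    proof -
      have tl: "t \<le> t + l" using l by simp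
      have "L2_norm (lebesgue_on \<Omega>) (\<lambda>x. E s x - E r x) \<le> \<eta>" if "r \<in> {t..t + l}" "s \<in> {t..t + l}" for r s
        by (intro less_imp_le \<delta>(2)) (use that l in auto)
      from dissipation_lower_bound[OF l(3) tl l(4) \<eta> this]
      show ?thesis unfolding energy_identity[OF l(3) tl l(4)] Kd[OF l(3) tl l(4)] by simp
    qed
    then show "\<exists>\<delta>>0. \<forall>l t. 0 < l \<and> l < \<delta> \<and> 0 \<le> t \<and> t + l \<le> T \<longrightarrow>
        integral {t..t + l} (\<lambda>s. two_time_energy (t + l) s - two_time_energy t s) \<le> l * \<eta> * (K (t + l) - K t)"
      using \<delta>(1) by blast
  qed
qed

lemma initial_values:
  assumes e0: "e0 \<in> Hspace \<Omega>" and h0: "h0 \<in> Hspace \<Omega>"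
  shows "AE x in lebesgue_on \<Omega>. \<epsilon> x *v E 0 x = \<epsilon> x *v e0 x" and "AE x in lebesgue_on \<Omega>. \<mu> x *v H 0 x = \<mu> x *v h0 x"
proof -
  have m0: "(\<lambda>x. \<epsilon> x *v e0 x) \<in> Hspace \<Omega>" "(\<lambda>x. \<mu> x *v h0 x) \<in> Hspace \<Omega>"
    using matrix_field_L2[OF \<epsilon> _ \<Omega>, of e0] matrix_field_L2[OF \<mu> _ \<Omega>, of h0] e0 h0 by (auto simp: Hspace_def)
  show "AE x in lebesgue_on \<Omega>. \<epsilon> x *v E 0 x = \<epsilon> x *v e0 x"
    by (rule weak_initial_value[OF \<Omega> T matrix_field_L2_QT[OF \<epsilon> e \<Omega>] L2_minus[OF h] q cont_rep_\<epsilon>E m0(1) _ subset_refl]) (rule weak_e)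
  show "AE x in lebesgue_on \<Omega>. \<mu> x *v H 0 x = \<mu> x *v h0 x"
    by (rule weak_initial_value[OF \<Omega> T matrix_field_L2_QT[OF \<mu> h \<Omega>] e L2_zero cont_rep_\<mu>H m0(2)], rule weak_h)
      (auto simp: V0space_def)
qed

text \<open>
  The equation determines only the images of the initial values under \<open>a\<close>; symmetry of \<open>a\<close> moves it onto
  whichever factor is to be replaced.
\<close>

lemma weighted_inner_cong_AE:
  assumes a: "bdd_meas_matrix_field \<Omega> a" and sym: "\<And>x. x \<in> \<Omega> \<Longrightarrow> transpose (a x) = a x"
    and u: "u \<in> L2 (lebesgue_on \<Omega>)" and v: "v \<in> L2 (lebesgue_on \<Omega>)"
    and uv: "AE x in lebesgue_on \<Omega>. a x *v u x = a x *v v x"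
  shows "weighted_inner \<Omega> a u u = weighted_inner \<Omega> a v v"
  unfolding weighted_inner_def
proof (rule integral_cong_AE)
  show "(\<lambda>x. (a x *v u x) \<bullet> u x) \<in> borel_measurable (lebesgue_on \<Omega>)"
    "(\<lambda>x. (a x *v v x) \<bullet> v x) \<in> borel_measurable (lebesgue_on \<Omega>)"
    using L2_inner_integrable[OF matrix_field_L2[OF a u \<Omega>] u] L2_inner_integrable[OF matrix_field_L2[OF a v \<Omega>] v] by auto
  show "AE x in lebesgue_on \<Omega>. (a x *v u x) \<bullet> u x = (a x *v v x) \<bullet> v x"
    using uv AE_space
  proof eventually_elim
    case (elim x)
    have "(a x *v u x) \<bullet> u x = (a x *v v x) \<bullet> u x" using elim by simp
    also have "\<dots> = (a x *v u x) \<bullet> v x" using symmetric_matrix_inner[OF sym] elim by simp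
    finally show ?case using elim by simp
  qed
qed

lemma energy_estimate:
  assumes t: "t \<in> {0..T}" and e0: "e0 \<in> Hspace \<Omega>" and h0: "h0 \<in> Hspace \<Omega>"
  shows "weighted_inner \<Omega> \<epsilon> (E t) (E t) + weighted_inner \<Omega> \<mu> (H t) (H t)
    \<le> weighted_inner \<Omega> \<epsilon> e0 e0 + weighted_inner \<Omega> \<mu> h0 h0"
proof -
  have 0: "0 \<in> {0..T}" using T by simp
  have L: "e0 \<in> L2 (lebesgue_on \<Omega>)" "h0 \<in> L2 (lebesgue_on \<Omega>)" using e0 h0 by (auto simp: Hspace_def)
  show ?thesis
    using energy_decreasing[OF t]
      weighted_inner_cong_AE[OF \<epsilon> sym\<epsilon> cont_rep_L2[OF E 0] L(1) initial_values(1)[OF e0 h0]]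
      weighted_inner_cong_AE[OF \<mu> sym\<mu> cont_rep_L2[OF H 0] L(2) initial_values(2)[OF e0 h0]]
    by (simp add: two_time_energy_def)
qed

end

section \<open>Continuous dependence on the initial data\<close>

lemma admissibleD:
  assumes "admissible \<Omega> T X \<Phi> G D P" and T: "0 < T"
  shows "\<Phi> \<in> L2 (lebesgue_on (QT \<Omega> T))" "G \<in> L2 (lebesgue_on (QT \<Omega> T))" "D \<in> L2 (lebesgue_on (QT \<Omega> T))"
    "P 0 \<in> L2 (lebesgue_on \<Omega>)"
  using assms cont_rep_L2[of \<Omega> T \<Phi> P 0]
  by (auto simp: admissible_def has_space_curl_def has_time_deriv_def)

lemma weighted_norm_power2:
  assumes "c > 0" "\<forall>x\<in>\<Omega>. \<forall>\<xi>. (a x *v \<xi>) \<bullet> \<xi> \<ge> c * (norm \<xi>)\<^sup>2"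
  shows "(weighted_norm \<Omega> a u)\<^sup>2 = weighted_inner \<Omega> a u u"
proof -
  have "0 \<le> weighted_inner \<Omega> a u u"
    unfolding weighted_inner_def
  proof (rule integral_nonneg_AE, rule AE_I2)
    fix x assume "x \<in> space (lebesgue_on \<Omega>)"
    then have "c * (norm (u x))\<^sup>2 \<le> (a x *v u x) \<bullet> u x" using assms(2) by simp
    moreover have "0 \<le> c * (norm (u x))\<^sup>2" using assms(1) by simp
    ultimately show "0 \<le> (a x *v u x) \<bullet> u x" by linarith
  qed
  then show ?thesis by (simp add: weighted_norm_def)
qed

theorem theorem4p2:
  fixes \<Omega> :: "(real^3) set" and T \<epsilon>' \<mu>' c1 :: real
    and \<epsilon> \<mu> :: "real^3 \<Rightarrow> real^3^3"
    and j j1 :: "(real^3) \<times> real \<Rightarrow> real^3 \<Rightarrow> real^3" and j0 :: tfield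
    and e01 h01 e02 h02 :: vfield
    and e1 h1 e2 h2 :: tfield
    and E1 H1 E2 H2 :: "real \<Rightarrow> vfield"
  assumes "open \<Omega>" and "0 < T"
    and "bdd_meas_matrix_field \<Omega> \<epsilon>" and "bdd_meas_matrix_field \<Omega> \<mu>"
    and "\<forall>x\<in>\<Omega>. transpose (\<epsilon> x) = \<epsilon> x" and "\<forall>x\<in>\<Omega>. transpose (\<mu> x) = \<mu> x"
    and "\<epsilon>' > 0" and "\<forall>x\<in>\<Omega>. \<forall>\<xi>. (\<epsilon> x *v \<xi>) \<bullet> \<xi> \<ge> \<epsilon>' * (norm \<xi>)\<^sup>2"
    and "\<mu>' > 0" and "\<forall>x\<in>\<Omega>. \<forall>\<xi>. (\<mu> x *v \<xi>) \<bullet> \<xi> \<ge> \<mu>' * (norm \<xi>)\<^sup>2"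
    and "\<forall>z\<in>QT \<Omega> T. \<forall>\<xi>. j z \<xi> = j0 z + j1 z \<xi>"
    and "j0 \<in> L2 (lebesgue_on (QT \<Omega> T))"
    and "caratheodory \<Omega> T j1"
    and "c1 > 0" and "\<forall>z\<in>QT \<Omega> T. \<forall>\<xi>. norm (j1 z \<xi>) \<le> c1 * norm \<xi>"
    and "\<forall>z\<in>QT \<Omega> T. \<forall>\<xi> \<eta>. (j z \<xi> - j z \<eta>) \<bullet> (\<xi> - \<eta>) \<ge> 0"
    and "e01 \<in> Hspace \<Omega>" and "h01 \<in> Hspace \<Omega>"
    and "e02 \<in> Hspace \<Omega>" and "h02 \<in> Hspace \<Omega>"
    and "weak_solution \<Omega> T \<epsilon> \<mu> j e01 h01 e1 h1"
    and "weak_solution \<Omega> T \<epsilon> \<mu> j e02 h02 e2 h2"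
    and "cont_rep \<Omega> T e1 E1" and "cont_rep \<Omega> T h1 H1"
    and "cont_rep \<Omega> T e2 E2" and "cont_rep \<Omega> T h2 H2"
  shows "\<forall>t\<in>{0..T}.
      (weighted_norm \<Omega> \<epsilon> (\<lambda>x. E1 t x - E2 t x))\<^sup>2 + (weighted_norm \<Omega> \<mu> (\<lambda>x. H1 t x - H2 t x))\<^sup>2
      \<le> (weighted_norm \<Omega> \<epsilon> (\<lambda>x. e01 x - e02 x))\<^sup>2 + (weighted_norm \<Omega> \<mu> (\<lambda>x. h01 x - h02 x))\<^sup>2"
proof
  fix t assume t: "t \<in> {0..T}"
  note [simp] = matrix_vector_mult_diff_distrib inner_diff_left
  note \<Omega> = assms(1) and T = assms(2) and \<epsilon> = assms(3) and \<mu> = assms(4)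
  note W1 = assms(21) and W2 = assms(22)
  let ?Q = "lebesgue_on (QT \<Omega> T)"
  have e1: "e1 \<in> L2 ?Q" and h1: "h1 \<in> L2 ?Q" and e2: "e2 \<in> L2 ?Q" and h2: "h2 \<in> L2 ?Q"
    using W1 W2 by (auto simp: weak_solution_def)
  have e0: "e01 \<in> L2 (lebesgue_on \<Omega>)" "e02 \<in> L2 (lebesgue_on \<Omega>)"
    and h0: "h01 \<in> L2 (lebesgue_on \<Omega>)" "h02 \<in> L2 (lebesgue_on \<Omega>)"
    using assms(17-20) by (auto simp: Hspace_def)
  have jL: "(\<lambda>z. j z (u z)) \<in> L2 ?Q" if u: "u \<in> L2 ?Q" for u
  proof -
    have s: "(\<lambda>z. j0 z + j1 z (u z)) \<in> L2 ?Q"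
      by (rule L2_add[OF assms(12) caratheodory_superposition_L2[OF \<Omega> assms(13) assms(15) u]])
    have "(\<lambda>z. j z (u z)) \<in> borel_measurable ?Q"
      using L2_measurable[OF s] assms(11) by (subst measurable_cong[where g="\<lambda>z. j0 z + j1 z (u z)"]) auto
    then show ?thesis using assms(11) by (intro L2_cong_AE[OF s]) auto
  qed
  define q where "q z = j z (e1 z) - j z (e2 z)" for z
  have q: "q \<in> L2 ?Q" unfolding q_def by (intro L2_diff jL e1 e2)
  interpret maxwell_difference \<Omega> T \<epsilon> \<mu> "\<lambda>z. e1 z - e2 z" "\<lambda>z. h1 z - h2 z" q
    "\<lambda>x. e01 x - e02 x" "\<lambda>x. h01 x - h02 x" "\<lambda>t x. E1 t x - E2 t x" "\<lambda>t x. H1 t x - H2 t x"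
  proof
    show "(\<lambda>z. e1 z - e2 z) \<in> L2 ?Q" "(\<lambda>z. h1 z - h2 z) \<in> L2 ?Q"
      by (intro L2_diff e1 e2 h1 h2)+
    show "cont_rep \<Omega> T (\<lambda>z. e1 z - e2 z) (\<lambda>t x. E1 t x - E2 t x)"
      "cont_rep \<Omega> T (\<lambda>z. h1 z - h2 z) (\<lambda>t x. H1 t x - H2 t x)"
      by (intro cont_rep_diff assms(23-26))+
    show "0 \<le> q z \<bullet> (e1 z - e2 z)" if "z \<in> QT \<Omega> T" for z
      using assms(16) that unfolding q_def by blast
  next
    fix \<Phi> G D P assume adm: "admissible \<Omega> T (V0space \<Omega>) \<Phi> G D P"
    note L = admissibleD[OF adm T]
    note i = L2_inner_integrable
    note [simp] = i[OF matrix_field_L2_QT[OF \<epsilon> e1 \<Omega>] L(3)] i[OF matrix_field_L2_QT[OF \<epsilon> e2 \<Omega>] L(3)]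
      i[OF h1 L(2)] i[OF h2 L(2)] i[OF jL[OF e1] L(1)] i[OF jL[OF e2] L(1)]
      i[OF matrix_field_L2[OF \<epsilon> e0(1) \<Omega>] L(4)] i[OF matrix_field_L2[OF \<epsilon> e0(2) \<Omega>] L(4)]
    have eq: "- (LINT z|?Q. (\<epsilon> (fst z) *v e z) \<bullet> D z) + (LINT z|?Q. - (h z \<bullet> G z) + j z (e z) \<bullet> \<Phi> z)
        = (LINT x|lebesgue_on \<Omega>. (\<epsilon> x *v e0 x) \<bullet> P 0 x)"
      if "weak_solution \<Omega> T \<epsilon> \<mu> j e0 h0 e h" for e0 h0 e h
      using that adm unfolding weak_solution_def by blast
    show "- (LINT z|?Q. (\<epsilon> (fst z) *v (e1 z - e2 z)) \<bullet> D z) + (LINT z|?Q. - (h1 z - h2 z) \<bullet> G z + q z \<bullet> \<Phi> z)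
        = (LINT x|lebesgue_on \<Omega>. (\<epsilon> x *v (e01 x - e02 x)) \<bullet> P 0 x)"
      using eq[OF W1] eq[OF W2] unfolding q_def by (simp add: algebra_simps)
  next
    fix \<Psi> G D P assume adm: "admissible \<Omega> T (Vspace \<Omega>) \<Psi> G D P"
    note L = admissibleD[OF adm T]
    note i = L2_inner_integrable
    note [simp] = i[OF matrix_field_L2_QT[OF \<mu> h1 \<Omega>] L(3)] i[OF matrix_field_L2_QT[OF \<mu> h2 \<Omega>] L(3)]
      i[OF e1 L(2)] i[OF e2 L(2)]
      i[OF matrix_field_L2[OF \<mu> h0(1) \<Omega>] L(4)] i[OF matrix_field_L2[OF \<mu> h0(2) \<Omega>] L(4)]
    have eq: "- (LINT z|?Q. (\<mu> (fst z) *v h z) \<bullet> D z) + (LINT z|?Q. e z \<bullet> G z)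
        = (LINT x|lebesgue_on \<Omega>. (\<mu> x *v h0 x) \<bullet> P 0 x)"
      if "weak_solution \<Omega> T \<epsilon> \<mu> j e0 h0 e h" for e0 h0 e h
      using that adm unfolding weak_solution_def by blast
    show "- (LINT z|?Q. (\<mu> (fst z) *v (h1 z - h2 z)) \<bullet> D z) + (LINT z|?Q. (e1 z - e2 z) \<bullet> G z + 0 \<bullet> \<Psi> z)
        = (LINT x|lebesgue_on \<Omega>. (\<mu> x *v (h01 x - h02 x)) \<bullet> P 0 x)"
      using eq[OF W1] eq[OF W2] by (simp add: algebra_simps)
  qed (use assms q in auto)
  have "(\<lambda>x. e01 x - e02 x) \<in> Hspace \<Omega>" "(\<lambda>x. h01 x - h02 x) \<in> Hspace \<Omega>"
    using L2_diff[OF e0] L2_diff[OF h0] by (auto simp: Hspace_def)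
  from energy_estimate[OF t this]
  show "(weighted_norm \<Omega> \<epsilon> (\<lambda>x. E1 t x - E2 t x))\<^sup>2 + (weighted_norm \<Omega> \<mu> (\<lambda>x. H1 t x - H2 t x))\<^sup>2
      \<le> (weighted_norm \<Omega> \<epsilon> (\<lambda>x. e01 x - e02 x))\<^sup>2 + (weighted_norm \<Omega> \<mu> (\<lambda>x. h01 x - h02 x))\<^sup>2"
    by (simp only: weighted_norm_power2[OF assms(7,8)] weighted_norm_power2[OF assms(9,10)])
qed

end
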